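(* Consider the two-observer sequential detection problem described in the context. Let $\Gamma^1$ be any fixed policy of observer 1. Then there is a policy of observer 2 minimizing $\mathcal{J}(\Gamma^1,\cdot)$ (an optimal policy for observer 2) which, as long as observer 2 has not yet stopped, is characterized as follows. (a) At time $T$, for some $0\le\alpha_T\le 1$, $$U^2_T=\begin{cases}1 & \text{if } \Pi^2_T\le\alpha_T,\\ 0 & \text{if } \Pi^2_T>\alpha_T.\end{cases}$$ (b) For each $t=1,2,\dots,T-1$, if $\mathbf 1_{\{\tau^1<t\}}=1$, then for some $0\le\alpha_t(1)\le\beta_t(1)\le 1$, $$U^2_t=\begin{cases}1 & \text{if } \Pi^2_t\le\alpha_t(1),\\ b & \text{if } \alpha_t(1)<\Pi^2_t\le\beta_t(1),\\ 0 & \text{if } \Pi^2_t>\beta_t(1).\end{cases}$$ (c) For each $t=1,2,\dots,T-1$, if $\mathbf 1_{\{\tau^1<t\}}=0$, then for some $0\le\alpha_t(0)\le\beta_t(0)\le\delta_t(0)\le\theta_t(0)\le 1$, $$U^2_t=\begin{cases}b & \text{if } \Pi^2_t<\alpha_t(0),\\ 1 & \text{if } \alpha_t(0)\le\Pi^2_t\le\beta_t(0),\\ b & \text{if } \beta_t(0)<\Pi^2_t<\delta_t(0),\\ 0 & \text{if } \delta_t(0)\le\Pi^2_t\le\theta_t(0),\\ b & \text{if } \Pi^2_t>\theta_t(0).\end{cases}$$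
   Context: Setting. A hypothesis $H\in\{0,1\}$ has known prior $P(H=0)=p_0$, $P(H=1)=1-p_0$. Observer $i\in\{1,2\}$ can make observations $Y^i_1,Y^i_2,\dots$ with values in $\mathcal Y^i$; given $H$, each $Y^i_t$ has a known discrete distribution $P^i_t(\cdot|H)$ or a known density $f^i_t(\cdot|H)$. Given $H$, the observations of each observer at different times are independent, and the two observation sequences are independent of each other. Decisions. At time $t$ a still-active observer $i$ chooses $U^i_t\in\{0,1,b\}$, where $b$ (blank) means continue, by $$U^i_t=\gamma^i_t(Y^i_{1:t},U^1_{1:t-1},U^2_{1:t-1}),$$ where $X_{1:t}$ denotes $X_1,\dots,X_t$. The collection $\Gamma^i=(\gamma^i_1,\dots,\gamma^i_T)$ is the policy of observer $i$. Let $\tau^i=\min\{t:U^i_t\ne b\}$. After $\tau^i$, observer $i$ takes no further observations and makes no further decisions. There is a finite horizon $T$, and policies must satisfy $\tau^1\le T$, $\tau^2\le T$ (so an observer active at time $T$ must choose $0$ or $1$). Cost. Let $\tau^{\min}=\min\{\tau^1,\tau^2\}$, $\tau^{\max}=\max\{\tau^1,\tau^2\}$, and $L=1$ if $\tau^2<\tau^1$, $L=2$ if $\tau^2\ge\tau^1$. With constants $K>k>0$ and a non-negative function $J(\cdot,\cdot)$ on $\{0,1\}^2$ with $J(0,0)=J(1,1)=0$, the cost is $$\mathcal J(\Gamma^1,\Gamma^2)=\mathbb E^{\Gamma^1,\Gamma^2}\big[K(\tau^{\min}-1)+k(\tau^{\max}-\tau^{\min})+J(U^L_{\tau^{\max}},H)\big].$$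 Belief of observer 2. Given $\Gamma^1$ and $\gamma^2_{1:t-1}$, $\Pi^2_t:=P(H=0\,|\,Y^2_{1:t},U^1_{1:t-1},U^2_{1:t-1}=b_{1:t-1})$, where $b_{1:t-1}$ is the sequence of $t-1$ blanks, and $\Pi^2_0=p_0$. $\mathbf 1_A$ is the indicator of the event $A$.
   Formalization: Part (c) fails if observer 1 inverts observer 2's message; it is stated literally unless, given H=1 and nobody stopped before t, sending 0 is strictly cheaper in expectation than sending 1, and then with decisions 0 and 1 interchanged; all characterizations hold almost surely. *)

theory Defs
  imports "HOL-Probability.Probability"
begin

datatype hyp = H0 | H1

datatype decision = Blank | Decide (verdict: hyp)

text \<open>
  Observer 1 sees observations of type \<open>'a\<close>, observer 2 of type \<open>'b\<close>. The measure \<open>N\<close> attached to an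
  observer carries the sigma-algebra of the observation space and is the reference measure for the
  densities: a counting measure for discrete observations, Lebesgue measure for real-valued ones with
  a density in the usual sense. Conditional laws are only constrained for hypotheses of positive
  probability.
\<close>

locale detection_model = prob_space M
  for M :: "'w measure" +
  fixes H :: "'w \<Rightarrow> hyp" and p0 :: real
    and N1 :: "'a measure" and f1 :: "nat \<Rightarrow> hyp \<Rightarrow> 'a \<Rightarrow> ennreal" and Y1 :: "nat \<Rightarrow> 'w \<Rightarrow> 'a"
    and N2 :: "'b measure" and f2 :: "nat \<Rightarrow> hyp \<Rightarrow> 'b \<Rightarrow> ennreal" and Y2 :: "nat \<Rightarrow> 'w \<Rightarrow> 'b"
  assumes H_measurable: "H \<in> measurable M (count_space UNIV)"
    and prior: "prob {\<omega> \<in> space M. H \<omega> = H0} = p0"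
    and ref1: "sigma_finite_measure N1"
    and ref2: "sigma_finite_measure N2"
    and density1: "\<And>h t. prob {\<omega> \<in> space M. H \<omega> = h} > 0 \<Longrightarrow> t \<ge> 1 \<Longrightarrow>
      distributed (uniform_measure M {\<omega> \<in> space M. H \<omega> = h}) N1 (Y1 t) (f1 t h)"
    and density2: "\<And>h t. prob {\<omega> \<in> space M. H \<omega> = h} > 0 \<Longrightarrow> t \<ge> 1 \<Longrightarrow>
      distributed (uniform_measure M {\<omega> \<in> space M. H \<omega> = h}) N2 (Y2 t) (f2 t h)"
    and indep1: "\<And>h. prob {\<omega> \<in> space M. H \<omega> = h} > 0 \<Longrightarrow>
      prob_space.indep_vars (uniform_measure M {\<omega> \<in> space M. H \<omega> = h}) (\<lambda>_. N1) Y1 {1..}"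
    and indep2: "\<And>h. prob {\<omega> \<in> space M. H \<omega> = h} > 0 \<Longrightarrow>
      prob_space.indep_vars (uniform_measure M {\<omega> \<in> space M. H \<omega> = h}) (\<lambda>_. N2) Y2 {1..}"
    and indep12: "\<And>h. prob {\<omega> \<in> space M. H \<omega> = h} > 0 \<Longrightarrow>
      prob_space.indep_set (uniform_measure M {\<omega> \<in> space M. H \<omega> = h})
        (sets (vimage_algebra (space M) (\<lambda>\<omega>. restrict (\<lambda>t. Y1 t \<omega>) {1..}) (PiM {1..} (\<lambda>_. N1))))
        (sets (vimage_algebra (space M) (\<lambda>\<omega>. restrict (\<lambda>t. Y2 t \<omega>) {1..}) (PiM {1..} (\<lambda>_. N2))))"

text \<open>
  What an observer knows when deciding at time \<open>t\<close>: the own observations up to \<open>t\<close>, and the decisions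
  of observers 1 and 2 (in this order, for both observers) up to \<open>t - 1\<close>.
\<close>

type_synonym 'y history = "(nat \<Rightarrow> 'y) \<times> (nat \<Rightarrow> decision) \<times> (nat \<Rightarrow> decision)"
type_synonym 'y policy = "nat \<Rightarrow> 'y history \<Rightarrow> decision"

definition history ::
    "(nat \<Rightarrow> 'y) \<Rightarrow> (nat \<Rightarrow> decision) \<Rightarrow> (nat \<Rightarrow> decision) \<Rightarrow> nat \<Rightarrow> 'y history" where
  "history y u1 u2 t = (restrict y {1..t}, restrict u1 {1..<t}, restrict u2 {1..<t})"

definition history_space :: "'y measure \<Rightarrow> nat \<Rightarrow> 'y history measure" where
  "history_space N t = PiM {1..t} (\<lambda>_. N) \<Otimes>\<^sub>M
     (PiM {1..<t} (\<lambda>_. count_space UNIV) \<Otimes>\<^sub>M PiM {1..<t} (\<lambda>_. count_space UNIV))"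

definition is_policy :: "nat \<Rightarrow> 'y measure \<Rightarrow> 'y policy \<Rightarrow> bool" where
  "is_policy T N \<Gamma> \<longleftrightarrow>
     (\<forall>t\<in>{1..T}. \<Gamma> t \<in> measurable (history_space N t) (count_space UNIV)) \<and>
     (\<forall>x\<in>space (history_space N T). \<Gamma> T x \<noteq> Blank)"

text \<open>An observer that has stopped makes no further decisions; this is recorded as \<^const>\<open>Blank\<close>.\<close>

definition move ::
    "'y policy \<Rightarrow> (nat \<Rightarrow> 'y) \<Rightarrow> (nat \<Rightarrow> decision) \<Rightarrow> (nat \<Rightarrow> decision) \<Rightarrow> (nat \<Rightarrow> decision)
      \<Rightarrow> nat \<Rightarrow> decision" where
  "move \<Gamma> y own u1 u2 t =
     (if \<exists>s\<in>{1..<t}. own s \<noteq> Blank then Blank else \<Gamma> t (history y u1 u2 t))"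

primrec run ::
    "'a policy \<Rightarrow> 'b policy \<Rightarrow> (nat \<Rightarrow> 'a) \<Rightarrow> (nat \<Rightarrow> 'b) \<Rightarrow> nat
      \<Rightarrow> (nat \<Rightarrow> decision) \<times> (nat \<Rightarrow> decision)" where
  "run \<Gamma>1 \<Gamma>2 y1 y2 0 = (\<lambda>_. Blank, \<lambda>_. Blank)"
| "run \<Gamma>1 \<Gamma>2 y1 y2 (Suc n) =
     (let (u1, u2) = run \<Gamma>1 \<Gamma>2 y1 y2 n in
       (u1(Suc n := move \<Gamma>1 y1 u1 u1 u2 (Suc n)),
        u2(Suc n := move \<Gamma>2 y2 u2 u1 u2 (Suc n))))"

definition U1 ::
    "'a policy \<Rightarrow> 'b policy \<Rightarrow> (nat \<Rightarrow> 'w \<Rightarrow> 'a) \<Rightarrow> (nat \<Rightarrow> 'w \<Rightarrow> 'b) \<Rightarrow> 'w \<Rightarrow> nat \<Rightarrow> decision"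
  where "U1 \<Gamma>1 \<Gamma>2 Y1 Y2 \<omega> t = fst (run \<Gamma>1 \<Gamma>2 (\<lambda>s. Y1 s \<omega>) (\<lambda>s. Y2 s \<omega>) t) t"

definition U2 ::
    "'a policy \<Rightarrow> 'b policy \<Rightarrow> (nat \<Rightarrow> 'w \<Rightarrow> 'a) \<Rightarrow> (nat \<Rightarrow> 'w \<Rightarrow> 'b) \<Rightarrow> 'w \<Rightarrow> nat \<Rightarrow> decision"
  where "U2 \<Gamma>1 \<Gamma>2 Y1 Y2 \<omega> t = snd (run \<Gamma>1 \<Gamma>2 (\<lambda>s. Y1 s \<omega>) (\<lambda>s. Y2 s \<omega>) t) t"

definition stop_time :: "(nat \<Rightarrow> decision) \<Rightarrow> nat" where
  "stop_time u = (LEAST t. t \<ge> 1 \<and> u t \<noteq> Blank)"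

definition active :: "(nat \<Rightarrow> decision) \<Rightarrow> nat \<Rightarrow> bool" where
  "active u t \<longleftrightarrow> (\<forall>s\<in>{1..<t}. u s = Blank)"

definition path_cost ::
    "real \<Rightarrow> real \<Rightarrow> (hyp \<Rightarrow> hyp \<Rightarrow> real) \<Rightarrow> (nat \<Rightarrow> decision) \<Rightarrow> (nat \<Rightarrow> decision) \<Rightarrow> hyp \<Rightarrow> real" where
  "path_cost K k J u1 u2 h =
     (let \<tau>1 = stop_time u1; \<tau>2 = stop_time u2; \<tau>min = min \<tau>1 \<tau>2; \<tau>max = max \<tau>1 \<tau>2;
          final = (if \<tau>2 < \<tau>1 then u1 \<tau>max else u2 \<tau>max)
      in K * (real \<tau>min - 1) + k * (real \<tau>max - real \<tau>min) + J (verdict final) h)"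

definition exp_cost ::
    "'w measure \<Rightarrow> ('w \<Rightarrow> hyp) \<Rightarrow> (nat \<Rightarrow> 'w \<Rightarrow> 'a) \<Rightarrow> (nat \<Rightarrow> 'w \<Rightarrow> 'b) \<Rightarrow>
      real \<Rightarrow> real \<Rightarrow> (hyp \<Rightarrow> hyp \<Rightarrow> real) \<Rightarrow> 'a policy \<Rightarrow> 'b policy \<Rightarrow> real" where
  "exp_cost M H Y1 Y2 K k J \<Gamma>1 \<Gamma>2 =
     (LINT \<omega>|M. path_cost K k J (U1 \<Gamma>1 \<Gamma>2 Y1 Y2 \<omega>) (U2 \<Gamma>1 \<Gamma>2 Y1 Y2 \<omega>) (H \<omega>))"

text \<open>
  The conditional probability of \<open>H = H0\<close> given everything observer 2 knows at time \<open>t\<close>. While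
  observer 2 is active, its past decisions are all \<^const>\<open>Blank\<close>, so on that event this is the belief
  given the own observations, the decisions of observer 1, and \<open>t - 1\<close> own blanks.
\<close>

definition belief2 ::
    "'w measure \<Rightarrow> ('w \<Rightarrow> hyp) \<Rightarrow> (nat \<Rightarrow> 'w \<Rightarrow> 'a) \<Rightarrow> 'b measure \<Rightarrow> (nat \<Rightarrow> 'w \<Rightarrow> 'b) \<Rightarrow>
      'a policy \<Rightarrow> 'b policy \<Rightarrow> nat \<Rightarrow> 'w \<Rightarrow> real" where
  "belief2 M H Y1 N2 Y2 \<Gamma>1 \<Gamma>2 t =
     real_cond_exp M
       (vimage_algebra (space M)
         (\<lambda>\<omega>. history (\<lambda>s. Y2 s \<omega>) (U1 \<Gamma>1 \<Gamma>2 Y1 Y2 \<omega>) (U2 \<Gamma>1 \<Gamma>2 Y1 Y2 \<omega>) t)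
         (history_space N2 t))
       (indicator {\<omega> \<in> space M. H \<omega> = H0})"

definition four_threshold ::
    "hyp \<Rightarrow> hyp \<Rightarrow> real \<Rightarrow> real \<Rightarrow> real \<Rightarrow> real \<Rightarrow> real \<Rightarrow> decision" where
  "four_threshold lo hi \<alpha> \<beta> \<delta> \<theta> \<pi> =
     (if \<pi> < \<alpha> then Blank
      else if \<pi> \<le> \<beta> then Decide lo
      else if \<pi> < \<delta> then Blank
      else if \<pi> \<le> \<theta> then Decide hi
      else Blank)"

text \<open>
  If observer 2 stops first, its decision is only a message to observer 1, who is free to read the
  message \<open>0\<close> as evidence for \<open>H = H1\<close> and vice versa. \<open>swaps_labels\<close> says that observer 1 does so
  at time \<open>t\<close>: if \<open>H = H1\<close> and nobody stopped before \<open>t\<close>, then sending \<open>0\<close> is strictly cheaper in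
  expectation than sending \<open>1\<close>. (Expectations over the event, not normalised by its probability.)
  For such a policy the optimal stopping messages appear with the names \<open>0\<close> and \<open>1\<close> interchanged.
\<close>

definition stop_at :: "nat \<Rightarrow> hyp \<Rightarrow> 'y policy" where
  "stop_at t h = (\<lambda>s _. if s < t then Blank else Decide h)"

definition swaps_labels ::
    "'w measure \<Rightarrow> ('w \<Rightarrow> hyp) \<Rightarrow> (nat \<Rightarrow> 'w \<Rightarrow> 'a) \<Rightarrow> (nat \<Rightarrow> 'w \<Rightarrow> 'b) \<Rightarrow>
      real \<Rightarrow> real \<Rightarrow> (hyp \<Rightarrow> hyp \<Rightarrow> real) \<Rightarrow> 'a policy \<Rightarrow> nat \<Rightarrow> bool" where
  "swaps_labels M H Y1 Y2 K k J \<Gamma>1 t \<longleftrightarrow>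
     (let C = (\<lambda>h. LINT \<omega>:{\<omega> \<in> space M. H \<omega> = H1 \<and> active (U1 \<Gamma>1 (stop_at t h) Y1 Y2 \<omega>) t}|M.
                 path_cost K k J (U1 \<Gamma>1 (stop_at t h) Y1 Y2 \<omega>) (U2 \<Gamma>1 (stop_at t h) Y1 Y2 \<omega>) H1)
      in C H0 < C H1)"

end

theory Submission
  imports Defs
begin

text \<open>
  Let \<open>B\<close> be the decision path of observer 1 as long as observer 2 keeps silent. It is a function of the
  observations of observer 1 only, hence independent of those of observer 2 given \<open>H\<close>. So the
  cost of a policy of observer 2 is an iterated integral over reference measures, in which a history
  enters through the pair \<open>(a, b)\<close> of likelihoods of the two hypotheses. Backward induction
  gives value functions of \<open>(a, b)\<close> that are homogeneous and superadditive: they depend on the posterior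
  alone and are concave in it, whereas stopping costs are affine. The set of posteriors where a given
  stopping decision is optimal is therefore an interval. Once observer 1 has stopped, the
  intervals of the two decisions contain 0 and 1, respectively, which leaves two thresholds instead of four.
\<close>

section \<open>Concave functions and thresholds on the unit interval\<close>

text \<open>The decisions of observer 1 depend on those of observer 2, so there is no fixed joint
  law of decisions to condition on. But observer 2 acts on observer 1 only through the time and the
  label of its stop: for each pair \<open>(t, d)\<close> the path of observer 1, including its
  reaction to a stop at \<open>t\<close> with verdict \<open>d\<close>, is again a function of the
  observations of observer 1 alone. Hence every expected cost is built from finitely many numbers
  \<open>C\<close>, indexed by silent histories. Weights stay unnormalised and in
  \<open>ennreal\<close>, so the recursion never divides by the probability of a history; the
  posterior enters only when two values are compared. The thresholds of (b) must not depend on when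
  or how observer 1 stopped. This holds because the cost incurred so far is common to all remaining
  choices, and what is left is a one-observer problem with cost \<open>k\<close> per step. In (c)
  the only possible history is all blanks. There the stopping costs depend on the reaction of
  observer 1, so the order of the two intervals is read off at posterior 0, which is where
  \<open>swaps_labels\<close> comes from.\<close>

definition affine01 :: "(real \<Rightarrow> real) \<Rightarrow> bool" where
  "affine01 f \<longleftrightarrow> (\<forall>p\<in>{0..1}. f p = (1 - p) * f 0 + p * f 1)"

definition concave01 :: "(real \<Rightarrow> real) \<Rightarrow> bool" where
  "concave01 w \<longleftrightarrow> (\<forall>x\<in>{0..1}. \<forall>y\<in>{0..1}. \<forall>s\<in>{0..1}.
     (1 - s) * w x + s * w y \<le> w ((1 - s) * x + s * y))"

lemma convex_point_in_01: "(1 - s) * x + s * y \<in> {0..1}"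
  if "x \<in> {0..1}" "y \<in> {0..1}" "s \<in> {0..1}" for x y s :: real
  using convexD[OF convex_real_interval(5)[of 0 1] that(1,2), of "1 - s" s] that(3) by simp

lemma affine01_combine:
  assumes "affine01 f" "x \<in> {0..1}" "y \<in> {0..1}" "s \<in> {0..1}"
  shows "f ((1 - s) * x + s * y) = (1 - s) * f x + s * f y"
proof -
  have "f ((1 - s) * x + s * y) = (1 - ((1 - s) * x + s * y)) * f 0 + ((1 - s) * x + s * y) * f 1"
    using assms(1) convex_point_in_01[OF assms(2-)] unfolding affine01_def by blast
  moreover have "f x = (1 - x) * f 0 + x * f 1" "f y = (1 - y) * f 0 + y * f 1"
    using assms unfolding affine01_def by blast+
  ultimately show ?thesis by (simp only:) (simp add: algebra_simps)
qed

lemma affine01_continuous: "affine01 f \<Longrightarrow> continuous_on {0..1} f"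
  by (rule continuous_on_eq[of _ "\<lambda>p. (1 - p) * f 0 + p * f 1"])
     (intro continuous_intros, metis affine01_def)

lemma closed_subinterval:
  fixes S :: "real set"
  assumes S: "S \<subseteq> {0..1}" "S \<noteq> {}" "closed S" "convex S"
  obtains a b where "0 \<le> a" "a \<le> b" "b \<le> 1" "S = {a..b}"
proof -
  have "compact S"
    using S(1,3) by (meson bounded_subset bounded_closed_interval compact_eq_bounded_closed)
  then obtain a b where ab: "S = {a..b}"
    using convex_connected[OF S(4)] connected_compact_interval_1 by metis
  then show ?thesis using that[of a b] S(1,2) by auto
qed

lemma closed_le_set:
  fixes f g :: "real \<Rightarrow> real"
  assumes "continuous_on {0..1} f" "continuous_on {0..1} g"
  shows "closed {p \<in> {0..1}. f p \<le> g p}"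
  using assms by (intro continuous_on_closed_Collect_le) auto

text \<open>The difference \<open>f - w\<close> is convex on the unit interval, and sublevel sets of
  a convex function are convex.\<close>

lemma convex_affine_le_concave:
  assumes "affine01 f" "concave01 w"
  shows "convex {p \<in> {0..1}. f p \<le> w p}"
  unfolding convex_alt
proof (intro ballI allI impI)
  fix x y s assume x: "x \<in> {p \<in> {0..1}. f p \<le> w p}" and y: "y \<in> {p \<in> {0..1}. f p \<le> w p}"
    and "0 \<le> s \<and> s \<le> (1::real)"
  then have s: "s \<in> {0..1}" by auto
  have "f ((1 - s) * x + s * y) = (1 - s) * f x + s * f y"
    using x y s by (intro affine01_combine assms) auto
  also have "\<dots> \<le> (1 - s) * w x + s * w y"
    using x y s by (intro add_mono mult_left_mono) auto
  also have "\<dots> \<le> w ((1 - s) * x + s * y)"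
    using assms(2) x y s unfolding concave01_def by blast
  finally show "(1 - s) *\<^sub>R x + s *\<^sub>R y \<in> {p \<in> {0..1}. f p \<le> w p}"
    using convex_point_in_01[of x y s] x y s by auto
qed

lemma affine01_concave: "affine01 f \<Longrightarrow> concave01 f"
  by (simp add: concave01_def affine01_combine)

text \<open>An intersection of two closed convex sets: an affine function is also concave, so the
  comparison with the other verdict is handled like the comparison with continuing.\<close>

lemma stop_region_interval:
  fixes f g w :: "real \<Rightarrow> real"
  assumes "affine01 f" "affine01 g" "concave01 w" "continuous_on {0..1} w"
    and "\<exists>p\<in>{0..1}. f p \<le> g p \<and> f p \<le> w p"
  obtains a b where "0 \<le> a" "a \<le> b" "b \<le> 1"
    "{p \<in> {0..1}. f p \<le> g p \<and> f p \<le> w p} = {a..b}"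
proof -
  have eq: "{p \<in> {0..1}. f p \<le> g p \<and> f p \<le> w p} = {p \<in> {0..1}. f p \<le> g p} \<inter> {p \<in> {0..1}. f p \<le> w p}"
    by auto
  show ?thesis
  proof (rule closed_subinterval[of "{p \<in> {0..1}. f p \<le> g p \<and> f p \<le> w p}"])
    show "closed {p \<in> {0..1}. f p \<le> g p \<and> f p \<le> w p}"
      unfolding eq
      by (rule closed_Int[OF closed_le_set[OF affine01_continuous[OF assms(1)] affine01_continuous[OF assms(2)]]
        closed_le_set[OF affine01_continuous[OF assms(1)] assms(4)]])
    show "convex {p \<in> {0..1}. f p \<le> g p \<and> f p \<le> w p}"
      unfolding eq
      by (rule convex_Int[OF convex_affine_le_concave[OF assms(1) affine01_concave[OF assms(2)]]
        convex_affine_le_concave[OF assms(1,3)]])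
  qed (use assms(5) that in auto)
qed

text \<open>Ties are broken to match the half-open ranges of the two-threshold rule: they go to
  \<open>Decide H1\<close> first, and to \<open>Blank\<close> rather than \<open>Decide H0\<close>.
  The type is any linear order, since the rule is applied both to \<open>ennreal\<close> values and
  to their real normalisations.\<close>

definition accept_rule :: "'c::linorder \<Rightarrow> 'c \<Rightarrow> 'c \<Rightarrow> decision" where
  "accept_rule l1 l0 w =
     (if l1 \<le> l0 \<and> l1 \<le> w then Decide H1 else if l0 < w then Decide H0 else Blank)"

text \<open>Here a tie with continuing stops, which makes both stopping regions closed as in
  \<open>four_threshold\<close>. A tie between the labels goes to \<open>lo\<close>, in the
  applications a label that is no dearer at posterior 0.\<close>

definition message_rule :: "hyp \<Rightarrow> hyp \<Rightarrow> 'c::linorder \<Rightarrow> 'c \<Rightarrow> 'c \<Rightarrow> decision" where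
  "message_rule lo hi l_lo l_hi w =
     (if l_lo \<le> l_hi \<and> l_lo \<le> w then Decide lo else if l_hi \<le> w then Decide hi else Blank)"

text \<open>The argument is the posterior of \<open>H0\<close>, so 0 means certainty of
  \<open>H1\<close>. The region of \<open>H1\<close> is an interval that contains 0.\<close>

lemma one_threshold:
  fixes f1 f0 :: "real \<Rightarrow> real"
  assumes "affine01 f1" "affine01 f0" "f1 0 \<le> f0 0"
  shows "\<exists>\<alpha>. 0 \<le> \<alpha> \<and> \<alpha> \<le> 1 \<and> (\<forall>p\<in>{0..1}. f1 p \<le> f0 p \<longleftrightarrow> p \<le> \<alpha>)"
proof -
  obtain a b where ab: "0 \<le> a" "a \<le> b" "b \<le> 1" and S: "{p \<in> {0..1}. f1 p \<le> f0 p \<and> f1 p \<le> f0 p} = {a..b}"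
    using assms by (elim stop_region_interval[of f1 f0 f0])
      (auto intro: affine01_concave affine01_continuous intro!: bexI[of _ 0])
  have "0 \<in> {a..b}" unfolding S[symmetric] using assms by auto
  then have "a = 0" using ab by auto
  have f1_iff: "f1 p \<le> f0 p \<longleftrightarrow> p \<in> {a..b}" if "p \<in> {0..1}" for p
    unfolding S[symmetric] using that by auto
  have "\<forall>p\<in>{0..1}. f1 p \<le> f0 p \<longleftrightarrow> p \<le> b"
    using f1_iff \<open>a = 0\<close> by auto
  then show ?thesis using ab by (intro exI[of _ b]) auto
qed

lemma two_thresholds:
  fixes f1 f0 w :: "real \<Rightarrow> real"
  assumes "affine01 f1" "affine01 f0" and w: "concave01 w" "continuous_on {0..1} w"
    and f1_0: "f1 0 \<le> f0 0" "f1 0 \<le> w 0" and f0_1: "f0 1 < w 1"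
  shows "\<exists>\<alpha> \<beta>. 0 \<le> \<alpha> \<and> \<alpha> \<le> \<beta> \<and> \<beta> \<le> 1 \<and>
    (\<forall>p\<in>{0..1}. accept_rule (f1 p) (f0 p) (w p) =
       (if p \<le> \<alpha> then Decide H1 else if p \<le> \<beta> then Blank else Decide H0))"
proof -
  obtain a \<alpha> where a: "0 \<le> a" "a \<le> \<alpha>" "\<alpha> \<le> 1"
    and S: "{p \<in> {0..1}. f1 p \<le> f0 p \<and> f1 p \<le> w p} = {a..\<alpha>}"
    using assms by (elim stop_region_interval[of f1 f0 w]) (auto intro!: bexI[of _ 0])
  have "0 \<in> {a..\<alpha>}" unfolding S[symmetric] using assms by auto
  then have a0: "a = 0" using a by auto
  have lo: "f1 p \<le> f0 p \<and> f1 p \<le> w p \<longleftrightarrow> p \<le> \<alpha>" if "p \<in> {0..1}" for p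
  proof -
    have "f1 p \<le> f0 p \<and> f1 p \<le> w p \<longleftrightarrow> p \<in> {a..\<alpha>}" unfolding S[symmetric] using that by simp
    then show ?thesis using \<open>a = 0\<close> that by simp
  qed
  \<comment> \<open>On \<open>R\<close> continuing is no worse than \<open>H0\<close>. By concavity
    of \<open>w\<close> and \<open>f0 1 < w 1\<close>, a strict preference for \<open>H0\<close> at
    some point extends to everything above it, so \<open>R\<close> is an initial segment.\<close>
  define R where "R = {p \<in> {0..1}. w p \<le> f0 p}"
  show ?thesis
  proof (cases "R = {}")
    case True
    have f0_less: "f0 p < w p" if "p \<in> {0..1}" for p
    proof -
      have "p \<notin> R" using True by simp
      then show ?thesis using that by (auto simp: R_def not_le)
    qed
    have "accept_rule (f1 p) (f0 p) (w p) =
       (if p \<le> \<alpha> then Decide H1 else if p \<le> \<alpha> then Blank else Decide H0)" if "p \<in> {0..1}" for p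
      unfolding accept_rule_def lo[OF that] using f0_less[OF that] by simp
    then show ?thesis using a by (intro exI[of _ \<alpha>]) auto
  next
    case False
    have "closed R" unfolding R_def
      by (rule closed_le_set[OF w(2) affine01_continuous[OF assms(2)]])
    have bdd: "bdd_above R" by (rule bdd_aboveI[of _ 1]) (auto simp: R_def)
    define b where "b = Sup R"
    have bR: "b \<in> R" unfolding b_def using False bdd \<open>closed R\<close> by (rule closed_contains_Sup)
    have R_iff: "p \<in> R \<longleftrightarrow> p \<le> b" if p: "p \<in> {0..1}" for p
    proof
      show "p \<in> R \<Longrightarrow> p \<le> b" unfolding b_def by (rule cSup_upper[OF _ bdd])
    next
      assume "p \<le> b"
      show "p \<in> R"
      proof (rule ccontr)
        assume "p \<notin> R"
        then have wp: "f0 p < w p" using p by (auto simp: R_def)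
        have "b < 1" using bR f0_1 by (auto simp: R_def less_le)
        \<comment> \<open>Writes \<open>b\<close> as a convex combination of \<open>p\<close> and 1;
          concavity of \<open>w\<close> then forces \<open>f0 b < w b\<close>, against
          \<open>b\<close> being in \<open>R\<close>.\<close>
        define s where "s = (b - p) / (1 - p)"
        have p1: "p < 1" using \<open>p \<le> b\<close> \<open>b < 1\<close> by auto
        have s: "s \<in> {0..1}" "s < 1" using p1 \<open>p \<le> b\<close> \<open>b < 1\<close> by (auto simp: s_def field_simps)
        have "s * (1 - p) = b - p" using p1 by (simp add: s_def)
        then have b_eq: "(1 - s) * p + s * 1 = b" by (simp add: algebra_simps)
        have "f0 b = (1 - s) * f0 p + s * f0 1"
          using affine01_combine[OF assms(2) p _ s(1), of 1] b_eq by simp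
        also have "\<dots> < (1 - s) * w p + s * w 1"
          using s wp f0_1 by (intro add_less_le_mono mult_strict_left_mono mult_left_mono) auto
        also have "\<dots> \<le> w b"
          using w(1)[unfolded concave01_def, rule_format, OF p _ s(1), of 1] b_eq by simp
        finally show False using bR by (simp add: R_def)
      qed
    qed
    \<comment> \<open>The region of \<open>H1\<close>, which has priority, may reach beyond
      \<open>b\<close>; the maximum then makes the blank range empty.\<close>
    have "accept_rule (f1 p) (f0 p) (w p) =
       (if p \<le> \<alpha> then Decide H1 else if p \<le> max \<alpha> b then Blank else Decide H0)"
      if "p \<in> {0..1}" for p
      unfolding accept_rule_def lo[OF that] using R_iff[OF that] that
      by (auto simp: R_def not_le max_def)
    moreover have "b \<le> 1" using bR by (simp add: R_def)
    ultimately show ?thesis using a by (intro exI[of _ \<alpha>] exI[of _ "max \<alpha> b"]) auto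
  qed
qed

lemma interval_minus_countable:
  fixes a b :: real
  assumes "countable D" "a < b"
  obtains e where "a < e" "e < b" "e \<notin> D"
proof -
  have "\<not> {a<..<b} \<subseteq> D"
    using assms uncountable_open_interval[of a b] countable_subset by blast
  then obtain e where "e \<in> {a<..<b}" "e \<notin> D" by blast
  then show ?thesis using that[of e] by auto
qed

text \<open>
  The four thresholds force both stopping regions to be nonempty. An empty region is represented by a
  single point, which may be chosen outside any given countable set, hence outside the atoms of the
  law of the belief.
\<close>

lemma four_thresholds:
  fixes f_lo f_hi w :: "real \<Rightarrow> real"
  assumes aff: "affine01 f_lo" "affine01 f_hi" and w: "concave01 w" "continuous_on {0..1} w"
    and le0: "f_lo 0 \<le> f_hi 0" and D: "countable D"
  shows "\<exists>\<alpha> \<beta> \<delta> \<theta> e. 0 \<le> \<alpha> \<and> \<alpha> \<le> \<beta> \<and> \<beta> \<le> \<delta> \<and> \<delta> \<le> \<theta> \<and> \<theta> \<le> 1 \<and> e \<notin> D \<and>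
    (\<forall>p\<in>{0..1} - {e}. message_rule lo hi (f_lo p) (f_hi p) (w p) = four_threshold lo hi \<alpha> \<beta> \<delta> \<theta> p)"
proof -
  define A where "A = {p \<in> {0..1}. f_lo p \<le> f_hi p \<and> f_lo p \<le> w p}"
  define B where "B = {p \<in> {0..1}. f_hi p \<le> f_lo p \<and> f_hi p \<le> w p}"
  have rule_eq: "message_rule lo hi (f_lo p) (f_hi p) (w p) =
      (if p \<in> A then Decide lo else if p \<in> B then Decide hi else Blank)" if "p \<in> {0..1}" for p
    using that by (auto simp: message_rule_def A_def B_def)
  have witness: ?thesis
    if "0 \<le> \<alpha>" "\<alpha> \<le> \<beta>" "\<beta> \<le> \<delta>" "\<delta> \<le> \<theta>" "\<theta> \<le> 1" "e \<notin> D"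
      and "\<And>p. p \<in> {0..1} \<Longrightarrow> p \<noteq> e \<Longrightarrow>
        (if p \<in> A then Decide lo else if p \<in> B then Decide hi else Blank) = four_threshold lo hi \<alpha> \<beta> \<delta> \<theta> p"
    for \<alpha> \<beta> \<delta> \<theta> e
    using that rule_eq by (metis (no_types, lifting) DiffE insertI1)
  obtain e0 where e0: "0 < e0" "e0 < (1::real)" "e0 \<notin> D"
    using D by (rule interval_minus_countable[of D 0 1]) auto
  \<comment> \<open>\<open>lo\<close> wins ties, so \<open>hi\<close> is actually played only at
    points of \<open>B\<close> outside \<open>A\<close>. Thus \<open>B \<subseteq> A\<close> says
    that \<open>hi\<close> never appears.\<close>
  consider "B \<subseteq> A" "A = {}" | "B \<subseteq> A" "A \<noteq> {}" | "\<not> B \<subseteq> A" "A = {}" | "\<not> B \<subseteq> A" "A \<noteq> {}" by blast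
  then show ?thesis
  proof cases
    case 1
    \<comment> \<open>All four thresholds coincide at \<open>e0\<close>, the only point where
      \<open>four_threshold\<close> then stops.\<close>
    then show ?thesis using e0
      by (intro witness[of e0 e0 e0 e0 e0]) (auto simp: four_threshold_def)
  next
    case 2
    then obtain a b where ab: "0 \<le> a" "a \<le> b" "b \<le> 1" "A = {a..b}"
      unfolding A_def using aff w by (elim stop_region_interval[of f_lo f_hi w]) auto
    show ?thesis
    proof (cases "b = 1")
      \<comment> \<open>There is no room above 1 for a dummy point. Since \<open>lo\<close> is
        tested first, the \<open>hi\<close> range consisting of 1 alone is never reached.\<close>
      case True
      then show ?thesis using 2 ab e0
        by (intro witness[of a 1 1 1 e0]) (auto simp: four_threshold_def)
    next
      case False
      then obtain e where "b < e" "e < 1" "e \<notin> D"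
        using D ab by (elim interval_minus_countable[of D b 1]) auto
      then show ?thesis using 2 ab
        by (intro witness[of a b e e e]) (auto simp: four_threshold_def)
    qed
  next
    case 3
    then obtain a b where ab: "0 \<le> a" "a \<le> b" "b \<le> 1" "B = {a..b}"
      unfolding B_def using aff w by (elim stop_region_interval[of f_hi f_lo w]) auto
    \<comment> \<open>Makes room below \<open>a\<close> for the dummy point of the empty
      \<open>lo\<close> region: at 0 the label \<open>lo\<close> is no dearer, so 0 in
      \<open>B\<close> would put 0 into \<open>A\<close>.\<close>
    have "a \<noteq> 0"
    proof
      assume "a = 0"
      then have "0 \<in> B" using ab by auto
      then have "0 \<in> A" using le0 by (auto simp: A_def B_def)
      then show False using 3 by simp
    qed
    then obtain e where "0 < e" "e < a" "e \<notin> D"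
      using D ab by (elim interval_minus_countable[of D 0 a]) auto
    then show ?thesis using 3 ab
      by (intro witness[of e e a b e]) (auto simp: four_threshold_def)
  next
    case 4
    then obtain a b where ab: "0 \<le> a" "a \<le> b" "b \<le> 1" "A = {a..b}"
      unfolding A_def using aff w by (elim stop_region_interval[of f_lo f_hi w]) auto
    from 4 obtain c d where cd: "0 \<le> c" "c \<le> d" "d \<le> 1" "B = {c..d}"
      unfolding B_def using aff w by (elim stop_region_interval[of f_hi f_lo w]) auto
    from 4 obtain q where "q \<in> B" "q \<notin> A" by blast
    then have q: "q \<in> {0..1}" "f_hi q < f_lo q" by (auto simp: A_def B_def)
    \<comment> \<open>\<open>f_hi - f_lo\<close> is affine, nonnegative at 0 and negative at
      \<open>q\<close>, hence strictly decreasing. It is nonnegative on \<open>A\<close> and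
      nonpositive on \<open>B\<close>, so the intervals share at most an endpoint.\<close>
    have "b \<le> c"
    proof (rule ccontr)
      assume "\<not> b \<le> c"
      have slope: "f p = f 0 + p * (f 1 - f 0)" if "affine01 f" "p \<in> {0..1}" for f p
        using that[unfolded affine01_def] by (auto simp: algebra_simps)
      define m where "m = (f_hi 1 - f_hi 0) - (f_lo 1 - f_lo 0)"
      have diff: "f_hi p - f_lo p = (f_hi 0 - f_lo 0) + p * m" if "p \<in> {0..1}" for p
        using slope[OF aff(1) that] slope[OF aff(2) that] by (simp add: m_def algebra_simps)
      have "q * m < 0" using diff[OF q(1)] q(2) le0 by linarith
      then have "m < 0" using q(1) by (auto simp: mult_less_0_iff)
      have "b \<in> A" "c \<in> B" using ab cd by auto
      then have "f_hi b - f_lo b \<ge> 0" "f_hi c - f_lo c \<le> 0" "b \<in> {0..1}" "c \<in> {0..1}"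
        by (auto simp: A_def B_def)
      moreover have "b * m < c * m" using \<open>\<not> b \<le> c\<close> \<open>m < 0\<close> by (intro mult_strict_right_mono_neg) auto
      ultimately show False using diff[of b] diff[of c] by linarith
    qed
    then show ?thesis using 4 ab cd e0
      by (intro witness[of a b c d e0]) (auto simp: four_threshold_def)
  qed
qed

section \<open>Homogeneous value functions\<close>

text \<open>
  A value function takes the unnormalised weights of \<open>H = H0\<close> and \<open>H = H1\<close>. Being homogeneous it
  depends on the posterior probability only, up to a factor, and superadditivity is then concavity.
  The Lipschitz bounds yield finiteness and continuity up to the endpoints, and show that a weight
  with constant \<open>0\<close> is irrelevant.
\<close>

locale value_function =
  fixes q0 q1 :: ennreal and X :: "ennreal \<Rightarrow> ennreal \<Rightarrow> ennreal"
  assumes homogeneous: "X (c * a) (c * b) = c * X a b"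
    and superadditive: "X a b + X a' b' \<le> X (a + a') (b + b')"
    and lipschitz0: "X (a + e) b \<le> X a b + q0 * e"
    and lipschitz1: "X a (b + e) \<le> X a b + q1 * e"
    and measurable_pair: "(\<lambda>p. X (fst p) (snd p)) \<in> borel_measurable (borel \<Otimes>\<^sub>M borel)"
begin

lemma measurable_value [measurable (raw)]:
  assumes [measurable]: "f \<in> borel_measurable N" "g \<in> borel_measurable N"
  shows "(\<lambda>x. X (f x) (g x)) \<in> borel_measurable N"
  using measurable_compose[OF _ measurable_pair, of "\<lambda>x. (f x, g x)" N] by simp

lemma zero: "X 0 0 = 0"
  using homogeneous[of 0 0 0] by simp

lemma mono0: "X a b \<le> X (a + e) b"
proof -
  have "X a b + 0 \<le> X a b + X e 0" by (intro add_left_mono) simp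
  also have "\<dots> \<le> X (a + e) (b + 0)" by (rule superadditive)
  finally show ?thesis by simp
qed

lemma mono1: "X a b \<le> X a (b + e)"
proof -
  have "X a b + 0 \<le> X a b + X 0 e" by (intro add_left_mono) simp
  also have "\<dots> \<le> X (a + 0) (b + e)" by (rule superadditive)
  finally show ?thesis by simp
qed

lemma le_linear: "X a b \<le> q0 * a + q1 * b"
proof -
  have "X (0 + a) b \<le> X 0 b + q0 * a" by (rule lipschitz0)
  also have "X 0 b \<le> q1 * b" using lipschitz1[of 0 0 b] by (simp add: zero)
  finally show ?thesis by (simp add: add_ac)
qed

end

lemma value_function_affine:
  assumes "c0 \<le> q0" "c1 \<le> q1"
  shows "value_function q0 q1 (\<lambda>a b. a * c0 + b * c1)"
proof
  show "(a + e) * c0 + b * c1 \<le> a * c0 + b * c1 + q0 * e" for a b e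
  proof -
    have "(a + e) * c0 + b * c1 = a * c0 + b * c1 + c0 * e" by (simp add: algebra_simps)
    also have "\<dots> \<le> a * c0 + b * c1 + q0 * e" by (intro add_left_mono mult_right_mono assms) simp
    finally show ?thesis .
  qed
  show "a * c0 + (b + e) * c1 \<le> a * c0 + b * c1 + q1 * e" for a b e
  proof -
    have "a * c0 + (b + e) * c1 = a * c0 + b * c1 + c1 * e" by (simp add: algebra_simps)
    also have "\<dots> \<le> a * c0 + b * c1 + q1 * e" by (intro add_left_mono mult_right_mono assms) simp
    finally show ?thesis .
  qed
qed (auto simp: algebra_simps)

text \<open>The optimisation step of the recursion preserves concavity: a minimum of superadditive
  functions is superadditive.\<close>

lemma value_function_min:
  assumes "value_function q0 q1 X" "value_function q0 q1 Z"
  shows "value_function q0 q1 (\<lambda>a b. min (X a b) (Z a b))"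
proof -
  interpret X: value_function q0 q1 X by fact
  interpret Z: value_function q0 q1 Z by fact
  show ?thesis
  proof
    show "min (X (c * a) (c * b)) (Z (c * a) (c * b)) = c * min (X a b) (Z a b)" for c a b
      by (cases "X a b \<le> Z a b")
         (auto simp: X.homogeneous Z.homogeneous min_def mult_left_mono intro!: antisym)
    show "min (X a b) (Z a b) + min (X a' b') (Z a' b') \<le> min (X (a + a') (b + b')) (Z (a + a') (b + b'))"
      for a b a' b'
      by (intro min.boundedI order_trans[OF _ X.superadditive] order_trans[OF _ Z.superadditive] add_mono) auto
    show "min (X (a + e) b) (Z (a + e) b) \<le> min (X a b) (Z a b) + q0 * e" for a b e
      using X.lipschitz0[of a e b] Z.lipschitz0[of a e b]
      by (auto simp: min_def intro: order_trans)
    show "min (X a (b + e)) (Z a (b + e)) \<le> min (X a b) (Z a b) + q1 * e" for a b e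
      using X.lipschitz1[of a b e] Z.lipschitz1[of a b e]
      by (auto simp: min_def intro: order_trans)
  qed measurable
qed

lemma value_function_add:
  assumes "value_function q0 q1 X" "value_function q0' q1' Z"
  shows "value_function (q0 + q0') (q1 + q1') (\<lambda>a b. X a b + Z a b)"
proof -
  interpret X: value_function q0 q1 X by fact
  interpret Z: value_function q0' q1' Z by fact
  show ?thesis
  proof
    show "X a b + Z a b + (X a' b' + Z a' b') \<le> X (a + a') (b + b') + Z (a + a') (b + b')" for a b a' b'
      using add_mono[OF X.superadditive[of a b a' b'] Z.superadditive[of a b a' b']] by (simp add: add_ac)
    show "X (a + e) b + Z (a + e) b \<le> X a b + Z a b + (q0 + q0') * e" for a b e
      using add_mono[OF X.lipschitz0[of a e b] Z.lipschitz0[of a e b]] by (simp add: add_ac distrib_right)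
    show "X a (b + e) + Z a (b + e) \<le> X a b + Z a b + (q1 + q1') * e" for a b e
      using add_mono[OF X.lipschitz1[of a b e] Z.lipschitz1[of a b e]] by (simp add: add_ac distrib_right)
  qed (auto simp: X.homogeneous Z.homogeneous distrib_left)
qed

lemma value_function_sum:
  assumes "finite I" "\<And>i. i \<in> I \<Longrightarrow> value_function (q0 i) (q1 i) (X i)"
  shows "value_function (\<Sum>i\<in>I. q0 i) (\<Sum>i\<in>I. q1 i) (\<lambda>a b. \<Sum>i\<in>I. X i a b)"
  using assms
proof (induction I rule: finite_induct)
  case empty
  show ?case using value_function_affine[of 0 0 0 0] by simp
next
  case (insert i I)
  then show ?case using value_function_add[of "q0 i" "q1 i" "X i"] by simp
qed

text \<open>Averaging over the next observation. Homogeneity and superadditivity hold pointwise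
  under the integral; as \<open>g0\<close> and \<open>g1\<close> have integral one, the Lipschitz
  constants do not grow.\<close>

lemma value_function_integral:
  assumes "value_function q0 q1 X" "sigma_finite_measure N"
    and [measurable]: "g0 \<in> borel_measurable N" "g1 \<in> borel_measurable N"
    and int: "(\<integral>\<^sup>+y. g0 y \<partial>N) = 1" "(\<integral>\<^sup>+y. g1 y \<partial>N) = 1"
  shows "value_function q0 q1 (\<lambda>a b. \<integral>\<^sup>+y. X (a * g0 y) (b * g1 y) \<partial>N)"
proof -
  interpret X: value_function q0 q1 X by fact
  interpret N: sigma_finite_measure N by fact
  show ?thesis
  proof
    show "(\<integral>\<^sup>+y. X (c * a * g0 y) (c * b * g1 y) \<partial>N) = c * (\<integral>\<^sup>+y. X (a * g0 y) (b * g1 y) \<partial>N)" for c a b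
      unfolding mult.assoc X.homogeneous by (rule nn_integral_cmult) measurable
    show "(\<integral>\<^sup>+y. X (a * g0 y) (b * g1 y) \<partial>N) + (\<integral>\<^sup>+y. X (a' * g0 y) (b' * g1 y) \<partial>N)
      \<le> (\<integral>\<^sup>+y. X ((a + a') * g0 y) ((b + b') * g1 y) \<partial>N)" for a b a' b'
      unfolding distrib_right
      by (subst nn_integral_add[symmetric]) (auto intro!: nn_integral_mono X.superadditive)
    show "(\<integral>\<^sup>+y. X ((a + e) * g0 y) (b * g1 y) \<partial>N) \<le> (\<integral>\<^sup>+y. X (a * g0 y) (b * g1 y) \<partial>N) + q0 * e" for a b e
    proof -
      have "(\<integral>\<^sup>+y. X ((a + e) * g0 y) (b * g1 y) \<partial>N)
          \<le> (\<integral>\<^sup>+y. X (a * g0 y) (b * g1 y) + (q0 * e) * g0 y \<partial>N)"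
        using X.lipschitz0 by (intro nn_integral_mono) (simp add: distrib_right mult.assoc)
      also have "\<dots> = (\<integral>\<^sup>+y. X (a * g0 y) (b * g1 y) \<partial>N) + q0 * e"
        by (subst nn_integral_add) (auto simp: nn_integral_cmult int)
      finally show ?thesis .
    qed
    show "(\<integral>\<^sup>+y. X (a * g0 y) ((b + e) * g1 y) \<partial>N) \<le> (\<integral>\<^sup>+y. X (a * g0 y) (b * g1 y) \<partial>N) + q1 * e" for a b e
    proof -
      have "(\<integral>\<^sup>+y. X (a * g0 y) ((b + e) * g1 y) \<partial>N)
          \<le> (\<integral>\<^sup>+y. X (a * g0 y) (b * g1 y) + (q1 * e) * g1 y \<partial>N)"
        using X.lipschitz1 by (intro nn_integral_mono) (simp add: distrib_right mult.assoc)
      also have "\<dots> = (\<integral>\<^sup>+y. X (a * g0 y) (b * g1 y) \<partial>N) + q1 * e"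
        by (subst nn_integral_add) (auto simp: nn_integral_cmult int)
      finally show ?thesis .
    qed
    show "(\<lambda>p. \<integral>\<^sup>+y. X (fst p * g0 y) (snd p * g1 y) \<partial>N) \<in> borel_measurable (borel \<Otimes>\<^sub>M borel)"
      by measurable
  qed
qed

section \<open>From likelihoods to joint weights\<close>

definition weight_inverse :: "ennreal \<Rightarrow> ennreal" where
  "weight_inverse q = (if q = 0 then 0 else inverse q)"

text \<open>Expresses a value of the likelihoods \<open>(a, b)\<close> through the joint weights
  \<open>(Q0 * a, Q1 * b)\<close>, from which the posterior is formed. A vanishing \<open>Q\<close>
  cannot be divided by; \<open>weight_inverse\<close> sends it to 0, so the corresponding argument
  of \<open>X\<close> is set to 0.\<close>

definition rescale :: "ennreal \<Rightarrow> ennreal \<Rightarrow> (ennreal \<Rightarrow> ennreal \<Rightarrow> ennreal) \<Rightarrow> ennreal \<Rightarrow> ennreal \<Rightarrow> ennreal" where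
  "rescale Q0 Q1 X a b = X (a * weight_inverse Q0) (b * weight_inverse Q1)"

lemma weight_inverse_mult: "q < top \<Longrightarrow> q * weight_inverse q = (if q = 0 then 0 else 1)"
  using ennreal_divide_self[of q] by (simp add: weight_inverse_def divide_ennreal_def)

lemma value_function_rescale:
  assumes "value_function (D * Q0) (D * Q1) X" "Q0 < top" "Q1 < top"
  shows "value_function D D (rescale Q0 Q1 X)"
proof -
  interpret X: value_function "D * Q0" "D * Q1" X by fact
  show ?thesis
  proof
    show "rescale Q0 Q1 X (a + e) b \<le> rescale Q0 Q1 X a b + D * e" for a b e
    proof -
      have "rescale Q0 Q1 X (a + e) b \<le> rescale Q0 Q1 X a b + D * Q0 * (e * weight_inverse Q0)"
        unfolding rescale_def distrib_right by (rule X.lipschitz0)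
      also have "D * Q0 * (e * weight_inverse Q0) = D * e * (Q0 * weight_inverse Q0)" by (simp add: mult_ac)
      also have "\<dots> \<le> D * e * 1" by (intro mult_left_mono) (simp_all add: weight_inverse_mult assms)
      finally show ?thesis by simp
    qed
    show "rescale Q0 Q1 X a (b + e) \<le> rescale Q0 Q1 X a b + D * e" for a b e
    proof -
      have "rescale Q0 Q1 X a (b + e) \<le> rescale Q0 Q1 X a b + D * Q1 * (e * weight_inverse Q1)"
        unfolding rescale_def distrib_right by (rule X.lipschitz1)
      also have "D * Q1 * (e * weight_inverse Q1) = D * e * (Q1 * weight_inverse Q1)" by (simp add: mult_ac)
      also have "\<dots> \<le> D * e * 1" by (intro mult_left_mono) (simp_all add: weight_inverse_mult assms)
      finally show ?thesis by simp
    qed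
    show "(\<lambda>p. rescale Q0 Q1 X (fst p) (snd p)) \<in> borel_measurable (borel \<Otimes>\<^sub>M borel)"
      unfolding rescale_def by measurable
  qed (auto simp: rescale_def X.homogeneous X.superadditive distrib_right mult.assoc)
qed

text \<open>If \<open>Q0\<close> is 0, the Lipschitz constant \<open>D * Q0\<close> is 0 and
  \<open>X\<close> does not depend on its first argument, so setting it to 0 is harmless; likewise
  for \<open>Q1\<close>. This is why the constants carry the factor \<open>Q\<close>
  throughout.\<close>

lemma rescale_weights:
  assumes "value_function (D * Q0) (D * Q1) X" "Q0 < top" "Q1 < top"
  shows "X a b = rescale Q0 Q1 X (Q0 * a) (Q1 * b)"
proof -
  interpret X: value_function "D * Q0" "D * Q1" X by fact
  have inv: "Q * a * weight_inverse Q = (if Q = 0 then 0 else a)" if "Q < top" for Q a :: ennreal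
  proof -
    have "Q * a * weight_inverse Q = a * (Q * weight_inverse Q)" by (simp add: mult_ac)
    then show ?thesis using that by (simp add: weight_inverse_mult)
  qed
  have X0: "X a b = X 0 b" if "Q0 = 0" for a b
    using X.lipschitz0[of 0 a b] X.mono0[of 0 b a] that by (simp add: antisym)
  have X1: "X a b = X a 0" if "Q1 = 0" for a b
    using X.lipschitz1[of a 0 b] X.mono1[of a 0 b] that by (simp add: antisym)
  show ?thesis
    unfolding rescale_def inv[OF assms(2)] inv[OF assms(3)]
    using X0[of a b] X1[of a b] X1[of 0 b] by auto
qed

section \<open>Normalised values on the unit interval\<close>

definition on_simplex :: "(ennreal \<Rightarrow> ennreal \<Rightarrow> ennreal) \<Rightarrow> real \<Rightarrow> real" where
  "on_simplex X p = enn2real (X (ennreal p) (ennreal (1 - p)))"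

context value_function
begin

lemma ennreal_on_simplex:
  assumes "q0 < top" "q1 < top"
  shows "ennreal (on_simplex X p) = X (ennreal p) (ennreal (1 - p))"
proof -
  have "X (ennreal p) (ennreal (1 - p)) < top"
    using assms by (intro le_less_trans[OF le_linear]) (simp add: ennreal_mult_less_top)
  then show ?thesis by (simp add: on_simplex_def)
qed

text \<open>\<open>(a, b)\<close> is \<open>a + b\<close> times the point of the simplex with first
  coordinate \<open>a / (a + b)\<close>; homogeneity pulls the factor out.\<close>

lemma eq_on_simplex:
  assumes fin: "q0 < top" "q1 < top" and ab: "a < top" "b < top" "a + b \<noteq> 0"
  shows "X a b = (a + b) * ennreal (on_simplex X (enn2real (a / (a + b))))"
proof -
  obtain x where x: "a = ennreal x" "0 \<le> x" using ab by (cases a) auto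
  obtain y where y: "b = ennreal y" "0 \<le> y" using ab by (cases b) auto
  have s: "x + y > 0" using ab x y by (auto simp: ennreal_plus[symmetric] simp del: ennreal_plus)
  have "a + b = ennreal (x + y)" using x y by simp
  moreover have "a / (a + b) = ennreal (x / (x + y))"
    using x y s by (simp add: divide_ennreal flip: ennreal_plus)
  moreover have "a = ennreal (x + y) * ennreal (x / (x + y))"
    using x y s by (subst ennreal_mult[symmetric]) auto
  moreover have "b = ennreal (x + y) * ennreal (1 - x / (x + y))"
    using x y s by (subst ennreal_mult[symmetric]) (auto simp: field_simps)
  ultimately show ?thesis
    using ennreal_on_simplex[OF fin, of "x / (x + y)"] x y s homogeneous
    by (metis divide_nonneg_nonneg add_nonneg_nonneg enn2real_ennreal)
qed

text \<open>The segment between \<open>(x, 1 - x)\<close> and \<open>(y, 1 - y)\<close> stays on the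
  simplex; homogeneity absorbs its coefficients and superadditivity gives the inequality.\<close>

lemma concave_on_simplex:
  assumes fin: "q0 < top" "q1 < top"
  shows "concave01 (on_simplex X)"
  unfolding concave01_def
proof (intro ballI)
  fix x y s :: real assume *: "x \<in> {0..1}" "y \<in> {0..1}" "s \<in> {0..1}"
  let ?z = "(1 - s) * x + s * y"
  have z: "?z \<in> {0..1}" using * by (rule convex_point_in_01)
  have nn: "0 \<le> on_simplex X p" for p by (simp add: on_simplex_def)
  have "ennreal ((1 - s) * on_simplex X x + s * on_simplex X y) =
      ennreal (1 - s) * X (ennreal x) (ennreal (1 - x)) + ennreal s * X (ennreal y) (ennreal (1 - y))"
    using * nn by (simp add: ennreal_plus ennreal_mult flip: ennreal_on_simplex[OF fin])
  also have "\<dots> \<le> X (ennreal (1 - s) * ennreal x + ennreal s * ennreal y)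
      (ennreal (1 - s) * ennreal (1 - x) + ennreal s * ennreal (1 - y))"
    unfolding homogeneous[symmetric] by (rule superadditive)
  also have "ennreal (1 - s) * ennreal x + ennreal s * ennreal y = ennreal ?z"
    using * by (simp flip: ennreal_mult ennreal_plus)
  also have "ennreal (1 - s) * ennreal (1 - x) + ennreal s * ennreal (1 - y) = ennreal (1 - ?z)"
    using * by (simp flip: ennreal_mult ennreal_plus) (simp add: algebra_simps)
  also have "X (ennreal ?z) (ennreal (1 - ?z)) = ennreal (on_simplex X ?z)"
    by (rule ennreal_on_simplex[OF fin, symmetric])
  finally show "(1 - s) * on_simplex X x + s * on_simplex X y \<le> on_simplex X ?z"
    using nn by (simp add: ennreal_le_iff)
qed

text \<open>Concavity would give continuity in the interior only. Going from \<open>x\<close> up to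
  \<open>y\<close> raises one weight and lowers the other by the same amount; monotonicity in one
  weight and the Lipschitz bound in the other control the change in each direction.\<close>

lemma continuous_on_simplex:
  assumes fin: "q0 < top" "q1 < top"
  shows "continuous_on {0..1} (on_simplex X)"
proof -
  obtain c0 where c0: "q0 = ennreal c0" "0 \<le> c0" using fin by (cases q0) auto
  obtain c1 where c1: "q1 = ennreal c1" "0 \<le> c1" using fin by (cases q1) auto
  have nn: "0 \<le> on_simplex X p" for p by (simp add: on_simplex_def)
  have bound: "on_simplex X x \<le> on_simplex X y + c1 * (y - x) \<and>
      on_simplex X y \<le> on_simplex X x + c0 * (y - x)"
    if "0 \<le> x" "x \<le> y" "y \<le> 1" for x y
  proof
    have x: "ennreal (1 - x) = ennreal (1 - y) + ennreal (y - x)"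
      and y: "ennreal y = ennreal x + ennreal (y - x)"
      using that by (simp_all flip: ennreal_plus)
    have "ennreal (on_simplex X x) = X (ennreal x) (ennreal (1 - y) + ennreal (y - x))"
      unfolding ennreal_on_simplex[OF fin] x ..
    also have "\<dots> \<le> X (ennreal x) (ennreal (1 - y)) + q1 * ennreal (y - x)" by (rule lipschitz1)
    also have "\<dots> \<le> ennreal (on_simplex X y) + q1 * ennreal (y - x)"
      unfolding ennreal_on_simplex[OF fin] by (intro add_right_mono) (unfold y, rule mono0)
    also have "ennreal (on_simplex X y) + q1 * ennreal (y - x) = ennreal (on_simplex X y + c1 * (y - x))"
      using that c1 nn by (simp add: ennreal_plus ennreal_mult)
    finally show "on_simplex X x \<le> on_simplex X y + c1 * (y - x)"
      using that c1 nn by (subst (asm) ennreal_le_iff) auto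
    have "ennreal (on_simplex X y) = X (ennreal x + ennreal (y - x)) (ennreal (1 - y))"
      unfolding ennreal_on_simplex[OF fin] y ..
    also have "\<dots> \<le> X (ennreal x) (ennreal (1 - y)) + q0 * ennreal (y - x)" by (rule lipschitz0)
    also have "\<dots> \<le> ennreal (on_simplex X x) + q0 * ennreal (y - x)"
      unfolding ennreal_on_simplex[OF fin] by (intro add_right_mono) (unfold x, rule mono1)
    also have "ennreal (on_simplex X x) + q0 * ennreal (y - x) = ennreal (on_simplex X x + c0 * (y - x))"
      using that c0 nn by (simp add: ennreal_plus ennreal_mult)
    finally show "on_simplex X y \<le> on_simplex X x + c0 * (y - x)"
      using that c0 nn by (subst (asm) ennreal_le_iff) auto
  qed
  have bound': "\<bar>on_simplex X y - on_simplex X x\<bar> \<le> (c0 + c1) * (y - x)"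
    if "0 \<le> x" "x \<le> y" "y \<le> 1" for x y
  proof -
    have "0 \<le> c0 * (y - x)" "0 \<le> c1 * (y - x)" using that c0 c1 by auto
    then show ?thesis using bound[OF that] unfolding distrib_right by linarith
  qed
  have "(c0 + c1)-lipschitz_on {0..1} (on_simplex X)"
  proof (rule lipschitz_onI)
    fix x y :: real assume "x \<in> {0..1}" "y \<in> {0..1}"
    then show "dist (on_simplex X x) (on_simplex X y) \<le> (c0 + c1) * dist x y"
      using bound'[of x y] bound'[of y x] by (cases "x \<le> y") (auto simp: dist_real_def abs_minus_commute)
  qed (use c0 c1 in auto)
  then show ?thesis by (rule lipschitz_on_continuous_on)
qed

end

text \<open>Both values carry the same finite positive factor \<open>a + b\<close>, which
  cancels.\<close>

lemma on_simplex_cmp: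
  assumes "value_function q0 q1 X" "value_function r0 r1 Z"
    and fin: "q0 < top" "q1 < top" "r0 < top" "r1 < top"
    and ab: "a < top" "b < top" "a + b \<noteq> 0"
  shows "X a b \<le> Z a b \<longleftrightarrow>
    on_simplex X (enn2real (a / (a + b))) \<le> on_simplex Z (enn2real (a / (a + b)))"
proof -
  let ?p = "enn2real (a / (a + b))"
  have "X a b \<le> Z a b \<longleftrightarrow> (a + b) * ennreal (on_simplex X ?p) \<le> (a + b) * ennreal (on_simplex Z ?p)"
    using value_function.eq_on_simplex[OF assms(1) fin(1,2) ab]
      value_function.eq_on_simplex[OF assms(2) fin(3,4) ab] by simp
  also have "\<dots> \<longleftrightarrow> ennreal (on_simplex X ?p) \<le> ennreal (on_simplex Z ?p)"
    using ab by (intro ennreal_mult_le_mult_iff) auto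
  also have "\<dots> \<longleftrightarrow> on_simplex X ?p \<le> on_simplex Z ?p"
    by (subst ennreal_le_iff) (auto simp: on_simplex_def)
  finally show ?thesis .
qed

lemma affine_on_simplex:
  assumes "c0 < top" "c1 < top"
  shows "affine01 (on_simplex (\<lambda>a b. a * c0 + b * c1))"
proof -
  have "on_simplex (\<lambda>a b. a * c0 + b * c1) p = p * enn2real c0 + (1 - p) * enn2real c1"
    if "p \<in> {0..1}" for p
    using assms that by (simp add: on_simplex_def enn2real_plus ennreal_mult_less_top enn2real_mult)
  then show ?thesis by (simp add: affine01_def)
qed

section \<open>Paths of decisions\<close>

lemma UNIV_hyp: "UNIV = {H0, H1}"
proof -
  have "h \<in> {H0, H1}" for h by (cases h) auto
  then show ?thesis by blast
qed

lemma UNIV_decision: "UNIV = {Blank, Decide H0, Decide H1}"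
proof -
  have "x \<in> {Blank, Decide H0, Decide H1}" for x
  proof (cases x)
    case (Decide h)
    then show ?thesis by (cases h) auto
  qed simp
  then show ?thesis by blast
qed

instance hyp :: finite by standard (simp add: UNIV_hyp)
instance decision :: finite by standard (simp add: UNIV_decision)

lemma sum_hyp: "(\<Sum>h\<in>UNIV. g h) = g H0 + g H1"
  by (simp add: UNIV_hyp)

text \<open>Not an admissible policy, since it never decides; it only generates the path of observer
  1 against a silent partner.\<close>

definition silent :: "'y policy" where
  "silent = (\<lambda>_ _. Blank)"

text \<open>The path \<open>u\<close> of observer 1 is a free argument and the own past is fixed to
  blanks. So this is what \<open>G\<close> prescribes given its own silence, whether or not it would
  have been silent.\<close>

definition dec :: "'b policy \<Rightarrow> (nat \<Rightarrow> 'b) \<Rightarrow> (nat \<Rightarrow> decision) \<Rightarrow> nat \<Rightarrow> decision" where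
  "dec G y u t = G t (history y u (\<lambda>_. Blank) t)"

definition still :: "'b policy \<Rightarrow> (nat \<Rightarrow> 'b) \<Rightarrow> (nat \<Rightarrow> decision) \<Rightarrow> nat \<Rightarrow> bool" where
  "still G y u t \<longleftrightarrow> (\<forall>s\<in>{1..<t}. dec G y u s = Blank)"

definition silent_path :: "'a policy \<Rightarrow> (nat \<Rightarrow> 'a) \<Rightarrow> nat \<Rightarrow> decision" where
  "silent_path G1 y1 s = fst (run G1 silent y1 (\<lambda>_. ()) s) s"

definition stop_path :: "'a policy \<Rightarrow> nat \<Rightarrow> hyp \<Rightarrow> (nat \<Rightarrow> 'a) \<Rightarrow> nat \<Rightarrow> decision" where
  "stop_path G1 t d y1 s = fst (run G1 (stop_at t d) y1 (\<lambda>_. ()) s) s"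

lemma run_Suc:
  "fst (run G1 G2 y1 y2 (Suc n)) = (fst (run G1 G2 y1 y2 n))(Suc n :=
     move G1 y1 (fst (run G1 G2 y1 y2 n)) (fst (run G1 G2 y1 y2 n)) (snd (run G1 G2 y1 y2 n)) (Suc n))"
  "snd (run G1 G2 y1 y2 (Suc n)) = (snd (run G1 G2 y1 y2 n))(Suc n :=
     move G2 y2 (snd (run G1 G2 y1 y2 n)) (fst (run G1 G2 y1 y2 n)) (snd (run G1 G2 y1 y2 n)) (Suc n))"
  by (simp_all add: Let_def split: prod.splits)

declare run.simps(2) [simp del]

lemma run_stable:
  "fst (run G1 G2 y1 y2 n) s = (if s \<le> n then fst (run G1 G2 y1 y2 s) s else Blank)"
  "snd (run G1 G2 y1 y2 n) s = (if s \<le> n then snd (run G1 G2 y1 y2 s) s else Blank)"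
  by (induction n) (auto simp: run_Suc le_Suc_eq)

text \<open>Only the moves along the actual run matter, so observer 2 may be exchanged for another
  policy, even one with another type of observations. The counterfactual comparisons rest on
  this.\<close>

lemma run_cong:
  assumes "\<And>m. m < n \<Longrightarrow>
    move G2 y2 (snd (run G1 G2 y1 y2 m)) (fst (run G1 G2 y1 y2 m)) (snd (run G1 G2 y1 y2 m)) (Suc m) =
    move G2' y2' (snd (run G1 G2 y1 y2 m)) (fst (run G1 G2 y1 y2 m)) (snd (run G1 G2 y1 y2 m)) (Suc m)"
  shows "run G1 G2' y1 y2' n = run G1 G2 y1 y2 n"
  using assms by (induction n) (auto simp: run_Suc prod_eq_iff)

lemma run_restrict: "run G1 G2 (restrict y1 {1..}) y2 n = run G1 G2 y1 y2 n"
proof (induction n)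
  case (Suc n)
  have "restrict (restrict y1 {1..}) {1..Suc n} = restrict y1 {1..Suc n}"
    by (auto simp: restrict_def)
  then have eq: "move G1 (restrict y1 {1..}) own u1 u2 (Suc n) = move G1 y1 own u1 u2 (Suc n)" for own u1 u2
    unfolding move_def history_def by simp
  show ?case unfolding prod_eq_iff run_Suc eq Suc by simp
qed simp

lemma silent_path_restrict: "silent_path G1 (restrict y1 {1..}) = silent_path G1 y1"
  by (intro ext) (simp only: silent_path_def run_restrict)

lemma stop_path_restrict: "stop_path G1 t d (restrict y1 {1..}) = stop_path G1 t d y1"
  by (intro ext) (simp only: stop_path_def run_restrict)

lemma silent_run:
  assumes "snd (run G1 G2 y1 y2 n) = (\<lambda>_. Blank)"
  shows "run G1 silent y1 y2' n = run G1 G2 y1 y2 n"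
proof (rule run_cong)
  fix m assume "m < n"
  have *: "snd (run G1 G2 y1 y2 (Suc m)) (Suc m) = Blank"
    using run_stable(2)[of G1 G2 y1 y2 n "Suc m"] assms \<open>m < n\<close> by simp
  show "move G2 y2 (snd (run G1 G2 y1 y2 m)) (fst (run G1 G2 y1 y2 m)) (snd (run G1 G2 y1 y2 m)) (Suc m) =
    move silent y2' (snd (run G1 G2 y1 y2 m)) (fst (run G1 G2 y1 y2 m)) (snd (run G1 G2 y1 y2 m)) (Suc m)"
    using * unfolding run_Suc by (simp add: move_def silent_def)
qed

lemma fst_silent_run:
  assumes "snd (run G1 G2 y1 y2 n) = (\<lambda>_. Blank)" "s \<le> n"
  shows "fst (run G1 G2 y1 y2 n) s = silent_path G1 y1 s"
  using silent_run[OF assms(1), of "\<lambda>_. ()"] run_stable(1)[of G1 silent y1 "\<lambda>_. ()" n s] assms(2)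
  by (simp add: silent_path_def)

lemma move_silent:
  assumes "snd (run G1 G2 y1 y2 n) = (\<lambda>_. Blank)"
  shows "move G2 y2 (\<lambda>_. Blank) (fst (run G1 G2 y1 y2 n)) (\<lambda>_. Blank) (Suc n) =
    dec G2 y2 (silent_path G1 y1) (Suc n)"
proof -
  have "restrict (fst (run G1 G2 y1 y2 n)) {1..<Suc n} = restrict (silent_path G1 y1) {1..<Suc n}"
    using fst_silent_run[OF assms] by (auto simp: restrict_def)
  then show ?thesis by (simp add: move_def dec_def history_def)
qed

lemma still_Suc: "still G y u (Suc n) \<longleftrightarrow> still G y u n \<and> (n = 0 \<or> dec G y u n = Blank)"
  by (cases n) (auto simp: still_def atLeastLessThanSuc)

text \<open>Removes the mutual recursion: the run on the left depends on both policies at once,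
  whereas \<open>still\<close> tests \<open>G2\<close> against the fixed path
  \<open>silent_path G1 y1\<close>. The induction uses that observer 1 has followed exactly this
  path so far.\<close>

lemma silent_iff_still:
  "snd (run G1 G2 y1 y2 n) = (\<lambda>_. Blank) \<longleftrightarrow> still G2 y2 (silent_path G1 y1) (Suc n)"
proof (induction n)
  case 0
  then show ?case by (simp add: still_def)
next
  case (Suc n)
  have "snd (run G1 G2 y1 y2 (Suc n)) = (\<lambda>_. Blank) \<longleftrightarrow>
    snd (run G1 G2 y1 y2 n) = (\<lambda>_. Blank) \<and>
    move G2 y2 (\<lambda>_. Blank) (fst (run G1 G2 y1 y2 n)) (\<lambda>_. Blank) (Suc n) = Blank"
  proof -
    let ?u = "snd (run G1 G2 y1 y2 n)"
    have beyond: "?u (Suc n) = Blank" by (subst run_stable) simp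
    show ?thesis
    proof (intro iffI conjI)
      assume a: "snd (run G1 G2 y1 y2 (Suc n)) = (\<lambda>_. Blank)"
      show u: "?u = (\<lambda>_. Blank)"
      proof
        fix s
        show "?u s = Blank"
          using fun_cong[OF a, of s] beyond unfolding run_Suc by (cases "s = Suc n") auto
      qed
      show "move G2 y2 (\<lambda>_. Blank) (fst (run G1 G2 y1 y2 n)) (\<lambda>_. Blank) (Suc n) = Blank"
        using fun_cong[OF a, of "Suc n"] unfolding run_Suc u by simp
    next
      assume "?u = (\<lambda>_. Blank) \<and>
        move G2 y2 (\<lambda>_. Blank) (fst (run G1 G2 y1 y2 n)) (\<lambda>_. Blank) (Suc n) = Blank"
      then show "snd (run G1 G2 y1 y2 (Suc n)) = (\<lambda>_. Blank)"
        unfolding run_Suc by (simp add: fun_upd_idem)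
    qed
  qed
  also have "\<dots> \<longleftrightarrow> still G2 y2 (silent_path G1 y1) (Suc (Suc n))"
    using move_silent[of G1 G2 y1 y2 n] Suc by (auto simp: still_Suc[of _ _ _ "Suc n"])
  finally show ?case .
qed

lemma active_iff_silent:
  assumes "1 \<le> t"
  shows "active (U2 G1 G2 Y1 Y2 \<omega>) t \<longleftrightarrow>
    snd (run G1 G2 (\<lambda>s. Y1 s \<omega>) (\<lambda>s. Y2 s \<omega>) (t - 1)) = (\<lambda>_. Blank)"
proof -
  obtain n where t: "t = Suc n" using assms by (cases t) auto
  let ?r = "run G1 G2 (\<lambda>s. Y1 s \<omega>) (\<lambda>s. Y2 s \<omega>)"
  have eq: "snd (?r n) s = (if s \<in> {1..<t} then snd (?r s) s else Blank)" for s
    using run_stable(2)[of G1 G2 "\<lambda>s. Y1 s \<omega>" "\<lambda>s. Y2 s \<omega>" n s] by (cases s) (auto simp: t)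
  have "snd (?r n) = (\<lambda>_. Blank) \<longleftrightarrow> (\<forall>s\<in>{1..<t}. snd (?r s) s = Blank)"
    unfolding fun_eq_iff eq by auto
  then show ?thesis by (simp add: active_def U2_def t)
qed

lemma active_iff_still:
  assumes "1 \<le> t"
  shows "active (U2 G1 G2 Y1 Y2 \<omega>) t \<longleftrightarrow> still G2 (\<lambda>s. Y2 s \<omega>) (silent_path G1 (\<lambda>s. Y1 s \<omega>)) t"
  using assms by (simp add: active_iff_silent silent_iff_still)

lemma U2_of_active:
  assumes "1 \<le> t" "active (U2 G1 G2 Y1 Y2 \<omega>) t"
  shows "U2 G1 G2 Y1 Y2 \<omega> t = dec G2 (\<lambda>s. Y2 s \<omega>) (silent_path G1 (\<lambda>s. Y1 s \<omega>)) t"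
proof -
  obtain n where t: "t = Suc n" using assms(1) by (cases t) auto
  then have s: "snd (run G1 G2 (\<lambda>s. Y1 s \<omega>) (\<lambda>s. Y2 s \<omega>) n) = (\<lambda>_. Blank)"
    using assms active_iff_silent[of t G1 G2 Y1 Y2 \<omega>] by simp
  show ?thesis using move_silent[OF s] s by (simp add: U2_def t run_Suc)
qed

lemma U1_of_active:
  assumes "1 \<le> t" "active (U2 G1 G2 Y1 Y2 \<omega>) t" "s < t"
  shows "U1 G1 G2 Y1 Y2 \<omega> s = silent_path G1 (\<lambda>s. Y1 s \<omega>) s"
  using fst_silent_run[of G1 G2 "\<lambda>s. Y1 s \<omega>" "\<lambda>s. Y2 s \<omega>" "t - 1" s]
    active_iff_silent[of t G1 G2 Y1 Y2 \<omega>] assms run_stable(1)[of G1 G2 "\<lambda>s. Y1 s \<omega>" "\<lambda>s. Y2 s \<omega>" "t - 1" s]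
  by (cases t) (auto simp: U1_def)

lemma snd_run_stop_at:
  assumes "1 \<le> t"
  shows "snd (run G1 (stop_at t d) y1 y2 n) = (if t \<le> n then (\<lambda>_. Blank)(t := Decide d) else (\<lambda>_. Blank))"
proof (induction n)
  case (Suc n)
  show ?case unfolding run_Suc Suc using assms
    by (auto simp: move_def stop_at_def fun_eq_iff)
qed (use assms in auto)

lemma U2_stop_at:
  assumes "1 \<le> t"
  shows "U2 G1 (stop_at t d) Y1 Y2 \<omega> = (\<lambda>_. Blank)(t := Decide d)"
  using assms by (auto simp: U2_def snd_run_stop_at fun_eq_iff)

lemma run_stop_at_independent: "run G1 (stop_at t d) y1 y2 n = run G1 (stop_at t d) y1 y2' n"
  by (rule run_cong) (simp add: move_def stop_at_def)

lemma U1_stop_at: "U1 G1 (stop_at t d) Y1 Y2 \<omega> = stop_path G1 t d (\<lambda>s. Y1 s \<omega>)"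
  unfolding U1_def stop_path_def
    run_stop_at_independent[of G1 t d "\<lambda>s. Y1 s \<omega>" "\<lambda>s. Y2 s \<omega>" _ "\<lambda>_. ()"] ..

lemma stop_path_before:
  assumes "1 \<le> t" "s < t"
  shows "stop_path G1 t d y1 s = silent_path G1 y1 s"
  using fst_silent_run[of G1 "stop_at t d" y1 "\<lambda>_. ()" s s] assms
  by (simp add: snd_run_stop_at stop_path_def)

text \<open>Both \<open>G2\<close> and \<open>stop_at t d\<close> play blanks before
  \<open>t\<close> and \<open>d\<close> at \<open>t\<close>; afterwards \<open>move\<close> yields
  blanks for anyone who has stopped. Observer 1 therefore sees the same in both runs.\<close>

lemma run_of_stop:
  assumes t: "1 \<le> t" and st: "still G2 y2 (silent_path G1 y1) t"
    and d: "dec G2 y2 (silent_path G1 y1) t = Decide d"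
  shows "run G1 G2 y1 y2 n = run G1 (stop_at t d) y1 y2 n"
proof (induction n)
  case (Suc n)
  let ?r = "run G1 (stop_at t d) y1 y2 n"
  have "move G2 y2 (snd ?r) (fst ?r) (snd ?r) (Suc n) = move (stop_at t d) y2 (snd ?r) (fst ?r) (snd ?r) (Suc n)"
  proof (cases "t \<le> n")
    case True
    then show ?thesis using t by (auto simp: snd_run_stop_at[OF t] move_def)
  next
    case False
    then have s: "snd (run G1 G2 y1 y2 n) = (\<lambda>_. Blank)" "snd ?r = (\<lambda>_. Blank)"
      by (auto simp: snd_run_stop_at[OF t] Suc)
    then have "move G2 y2 (snd ?r) (fst ?r) (snd ?r) (Suc n) = dec G2 y2 (silent_path G1 y1) (Suc n)"
      using move_silent[of G1 G2 y1 y2 n] Suc by simp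
    also have "\<dots> = (if Suc n = t then Decide d else Blank)"
      using st d False by (auto simp: still_def)
    also have "\<dots> = move (stop_at t d) y2 (snd ?r) (fst ?r) (snd ?r) (Suc n)"
      using False s by (auto simp: move_def stop_at_def)
    finally show ?thesis .
  qed
  then show ?case using Suc by (simp add: run_Suc prod_eq_iff)
qed simp

lemma paths_of_stop:
  assumes "1 \<le> t" "still G2 (\<lambda>s. Y2 s \<omega>) (silent_path G1 (\<lambda>s. Y1 s \<omega>)) t"
    "dec G2 (\<lambda>s. Y2 s \<omega>) (silent_path G1 (\<lambda>s. Y1 s \<omega>)) t = Decide d"
  shows "U1 G1 G2 Y1 Y2 \<omega> = stop_path G1 t d (\<lambda>s. Y1 s \<omega>)"
    "U2 G1 G2 Y1 Y2 \<omega> = (\<lambda>_. Blank)(t := Decide d)"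
proof -
  have "U1 G1 G2 Y1 Y2 \<omega> = U1 G1 (stop_at t d) Y1 Y2 \<omega>"
    unfolding U1_def run_of_stop[OF assms] ..
  then show "U1 G1 G2 Y1 Y2 \<omega> = stop_path G1 t d (\<lambda>s. Y1 s \<omega>)" by (simp add: U1_stop_at)
  have "U2 G1 G2 Y1 Y2 \<omega> = U2 G1 (stop_at t d) Y1 Y2 \<omega>"
    unfolding U2_def run_of_stop[OF assms] ..
  then show "U2 G1 G2 Y1 Y2 \<omega> = (\<lambda>_. Blank)(t := Decide d)" using assms by (simp add: U2_stop_at)
qed

section \<open>Stopping within the horizon\<close>

lemma history_in_space:
  assumes "\<And>s. s \<in> {1..t} \<Longrightarrow> y s \<in> space N"
  shows "history y u1 u2 t \<in> space (history_space N t)"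
  using assms by (auto simp: history_def history_space_def space_pair_measure space_PiM)

lemma fst_run_stops:
  assumes "is_policy T N G1" "1 \<le> T" "\<And>s. s \<in> {1..T} \<Longrightarrow> y1 s \<in> space N"
  shows "\<exists>s\<in>{1..T}. fst (run G1 G2 y1 y2 T) s \<noteq> Blank"
proof -
  obtain n where T: "T = Suc n" using assms(2) by (cases T) auto
  let ?u = "fst (run G1 G2 y1 y2 n)"
  show ?thesis
  proof (cases "\<exists>s\<in>{1..<T}. ?u s \<noteq> Blank")
    case True
    then obtain s where "s \<in> {1..<T}" "?u s \<noteq> Blank" by blast
    then show ?thesis by (intro bexI[of _ s]) (auto simp: T run_Suc)
  next
    case False
    then have "fst (run G1 G2 y1 y2 T) T = G1 T (history y1 ?u (snd (run G1 G2 y1 y2 n)) T)"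
      by (simp add: T run_Suc move_def)
    also have "\<dots> \<noteq> Blank"
      using assms(1,3) history_in_space[of T y1 N] by (auto simp: is_policy_def)
    finally show ?thesis using assms(2) by (intro bexI[of _ T]) auto
  qed
qed

lemma snd_run_stops:
  assumes "is_policy T N G2" "1 \<le> T" "\<And>s. s \<in> {1..T} \<Longrightarrow> y2 s \<in> space N"
  shows "\<exists>s\<in>{1..T}. dec G2 y2 u s \<noteq> Blank"
  using assms history_in_space[of T y2 N] unfolding dec_def is_policy_def by (intro bexI[of _ T]) auto

lemma path_stops:
  assumes "is_policy T N G1" "1 \<le> T" "\<And>s. s \<in> {1..T} \<Longrightarrow> y1 s \<in> space N"
  shows "\<exists>s\<in>{1..T}. stop_path G1 t d y1 s \<noteq> Blank" "\<exists>s\<in>{1..T}. silent_path G1 y1 s \<noteq> Blank"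
proof -
  have *: "\<exists>s\<in>{1..T}. fst (run G1 G2 y1 y2 s) s \<noteq> Blank" for G2 :: "unit policy" and y2
  proof -
    obtain s where "s \<in> {1..T}" "fst (run G1 G2 y1 y2 T) s \<noteq> Blank"
      using fst_run_stops[of T N G1 y1 G2 y2] assms by blast
    then show ?thesis using run_stable(1)[of G1 G2 y1 y2 T s] by (intro bexI[of _ s]) auto
  qed
  show "\<exists>s\<in>{1..T}. stop_path G1 t d y1 s \<noteq> Blank" "\<exists>s\<in>{1..T}. silent_path G1 y1 s \<noteq> Blank"
    unfolding stop_path_def silent_path_def by (rule *)+
qed

lemma fst_run_after_stop:
  assumes "s \<in> {1..<t}" "fst (run G1 G2 y1 y2 s) s \<noteq> Blank"
  shows "fst (run G1 G2 y1 y2 t) t = Blank"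
proof -
  obtain n where t: "t = Suc n" using assms(1) by (cases t) auto
  have "fst (run G1 G2 y1 y2 n) s \<noteq> Blank" using assms t by (subst run_stable) auto
  then show ?thesis using assms unfolding t run_Suc by (auto simp: move_def)
qed

lemma silent_path_after_stop:
  "s \<in> {1..<t} \<Longrightarrow> silent_path G1 y1 s \<noteq> Blank \<Longrightarrow> silent_path G1 y1 t = Blank"
  unfolding silent_path_def by (rule fst_run_after_stop)

text \<open>Beyond \<open>T\<close> the run is blank by construction, and the path is blank because
  observer 1 has stopped by then. A single run of length \<open>T\<close> thus carries the whole
  path, which later gives its measurability.\<close>

lemma stop_path_eq_run:
  assumes "is_policy T N G1" "1 \<le> T" "\<And>s. s \<in> {1..T} \<Longrightarrow> y1 s \<in> space N"
  shows "stop_path G1 t d y1 = fst (run G1 (stop_at t d) y1 (\<lambda>_. ()) T)"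
proof
  fix s
  obtain r where r: "r \<in> {1..T}" "stop_path G1 t d y1 r \<noteq> Blank" using path_stops(1)[of T N G1 y1 t d] assms by blast
  show "stop_path G1 t d y1 s = fst (run G1 (stop_at t d) y1 (\<lambda>_. ()) T) s"
    using fst_run_after_stop[of r s G1 "stop_at t d" y1 "\<lambda>_. ()"] r
    by (subst run_stable) (auto simp: stop_path_def)
qed

section \<open>Stopping times and bounds on the path cost\<close>

lemma stop_time_props:
  assumes "\<exists>s\<in>{1..T}. u s \<noteq> Blank"
  shows "1 \<le> stop_time u" "stop_time u \<le> T" "u (stop_time u) \<noteq> Blank"
    "\<And>s. 1 \<le> s \<Longrightarrow> u s \<noteq> Blank \<Longrightarrow> stop_time u \<le> s"
proof -
  obtain s where "s \<in> {1..T}" "u s \<noteq> Blank" using assms by blast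
  then have *: "s \<ge> 1 \<and> u s \<noteq> Blank" by auto
  show "1 \<le> stop_time u" "u (stop_time u) \<noteq> Blank"
    using LeastI[of "\<lambda>t. t \<ge> 1 \<and> u t \<noteq> Blank", OF *] by (auto simp: stop_time_def)
  show le: "\<And>s. 1 \<le> s \<Longrightarrow> u s \<noteq> Blank \<Longrightarrow> stop_time u \<le> s"
    unfolding stop_time_def by (rule Least_le) auto
  then show "stop_time u \<le> T" using \<open>s \<in> {1..T}\<close> \<open>u s \<noteq> Blank\<close> by fastforce
qed

lemma stop_time_eqI:
  assumes "1 \<le> t" "u t \<noteq> Blank" "\<And>s. s \<in> {1..<t} \<Longrightarrow> u s = Blank"
  shows "stop_time u = t"
  unfolding stop_time_def using assms
  by (intro Least_equality) (auto simp: not_le[symmetric])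

lemma stop_time_single: "1 \<le> t \<Longrightarrow> stop_time ((\<lambda>_. Blank)(t := Decide d)) = t"
  by (rule stop_time_eqI) auto

lemma stop_time_cong:
  assumes "\<exists>s\<in>{1..<t}. u s \<noteq> Blank" "\<And>s. s \<in> {1..<t} \<Longrightarrow> u' s = u s"
  shows "stop_time u' = stop_time u"
proof -
  have *: "\<exists>s\<in>{1..t - 1}. u s \<noteq> Blank" using assms(1) by force
  show ?thesis
  proof (rule stop_time_eqI)
    show "1 \<le> stop_time u" by (rule stop_time_props[OF *])
    have "stop_time u \<in> {1..<t}" using stop_time_props(1,2)[OF *] assms(1) by fastforce
    then show "u' (stop_time u) \<noteq> Blank" using stop_time_props(3)[OF *] assms(2) by simp
    show "u' s = Blank" if "s \<in> {1..<stop_time u}" for s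
      using stop_time_props(4)[OF *, of s] that assms(2)[of s] \<open>stop_time u \<in> {1..<t}\<close> by fastforce
  qed
qed

lemma stop_time_less:
  assumes "\<exists>s\<in>{1..<t}. u s \<noteq> Blank"
  shows "stop_time u \<in> {1..<t}"
proof -
  have *: "\<exists>s\<in>{1..t - 1}. u s \<noteq> Blank" using assms(1) by force
  show ?thesis using stop_time_props(1,2)[OF *] assms by fastforce
qed

lemma stop_time_less_iff:
  assumes "\<exists>s\<in>{1..T}. u s \<noteq> Blank"
  shows "stop_time u < t \<longleftrightarrow> (\<exists>s\<in>{1..<t}. u s \<noteq> Blank)"
  using stop_time_props[OF assms] stop_time_less[of t u] by auto

lemma path_cost_nonneg:
  assumes "0 < k" "k < K" "\<And>u h. J u h \<ge> 0"
    "\<exists>s\<in>{1..T}. u1 s \<noteq> Blank" "\<exists>s\<in>{1..T}. u2 s \<noteq> Blank"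
  shows "0 \<le> path_cost K k J u1 u2 h"
  using assms(1-3) stop_time_props(1)[OF assms(4)] stop_time_props(1)[OF assms(5)]
  unfolding path_cost_def Let_def
  by (intro add_nonneg_nonneg mult_nonneg_nonneg) (auto simp: min_def max_def)

text \<open>Deliberately crude: it has to be finite and uniform over all paths that stop by
  \<open>T\<close>. It becomes the constant \<open>D\<close> of the Lipschitz bounds.\<close>

definition cost_bound :: "nat \<Rightarrow> real \<Rightarrow> real \<Rightarrow> (hyp \<Rightarrow> hyp \<Rightarrow> real) \<Rightarrow> real" where
  "cost_bound T K k J = K * real T + k * real T + (\<Sum>u\<in>UNIV. \<Sum>h\<in>UNIV. J u h)"

lemma path_cost_le:
  assumes "0 < k" "k < K" "\<And>u h. J u h \<ge> 0"
    "\<exists>s\<in>{1..T}. u1 s \<noteq> Blank" "\<exists>s\<in>{1..T}. u2 s \<noteq> Blank"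
  shows "path_cost K k J u1 u2 h \<le> cost_bound T K k J"
proof -
  have J: "J u h \<le> (\<Sum>u\<in>UNIV. \<Sum>h\<in>UNIV. J u h)" for u h
  proof -
    have "J u h \<le> (\<Sum>h\<in>UNIV. J u h)" using assms(3) by (intro member_le_sum) auto
    also have "\<dots> \<le> (\<Sum>u\<in>UNIV. \<Sum>h\<in>UNIV. J u h)"
      using assms(3) by (intro member_le_sum[where f="\<lambda>u. \<Sum>h\<in>UNIV. J u h"] sum_nonneg) auto
    finally show ?thesis .
  qed
  have "real (min (stop_time u1) (stop_time u2)) - 1 \<le> real T"
    "real (max (stop_time u1) (stop_time u2)) - real (min (stop_time u1) (stop_time u2)) \<le> real T"
    using stop_time_props(2)[OF assms(4)] stop_time_props(2)[OF assms(5)] by (auto simp: min_def max_def)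
  then show ?thesis
    using assms(1,2) unfolding path_cost_def Let_def cost_bound_def
    by (intro add_mono mult_left_mono J) auto
qed

text \<open>If observer 1 stops no later than \<open>t\<close>, ties included, the final decision is
  that of observer 2, so its verdict \<open>d\<close> is judged against the truth.\<close>

lemma path_cost_second_last:
  assumes "1 \<le> stop_time u1" "stop_time u1 \<le> t"
  shows "path_cost K k J u1 ((\<lambda>_. Blank)(t := Decide d)) h =
    K * (real (stop_time u1) - 1) + k * (real t - real (stop_time u1)) + J d h"
  using assms by (simp add: path_cost_def stop_time_single Let_def)

section \<open>Factorization of the observations\<close>

declare One_nat_def [simp del]

text \<open>It suffices to compare both measures on boxes, where the integral of the product splits
  into factors.\<close>

lemma PiM_density:
  fixes f :: "'i \<Rightarrow> 'a \<Rightarrow> ennreal"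
  assumes "sigma_finite_measure N" and I: "finite I"
    and f [measurable]: "\<And>i. f i \<in> borel_measurable N"
    and "\<And>i. sigma_finite_measure (density N (f i))"
  shows "PiM I (\<lambda>i. density N (f i)) = density (PiM I (\<lambda>_. N)) (\<lambda>x. \<Prod>i\<in>I. f i (x i))"
proof -
  interpret N: product_sigma_finite "\<lambda>_::'i. N" using assms by (simp add: product_sigma_finite_def)
  interpret D: product_sigma_finite "\<lambda>i. density N (f i)" using assms by (simp add: product_sigma_finite_def)
  show ?thesis
  proof (rule D.PiM_eqI[OF I, symmetric])
    show "sets (density (PiM I (\<lambda>_. N)) (\<lambda>x. \<Prod>i\<in>I. f i (x i))) = sets (PiM I (\<lambda>i. density N (f i)))"
      by (simp cong: sets_PiM_cong)
  next
    fix A assume A: "\<And>i. i \<in> I \<Longrightarrow> A i \<in> sets (density N (f i))"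
    then have [measurable]: "\<And>i. i \<in> I \<Longrightarrow> A i \<in> sets N" by simp
    have box: "Pi\<^sub>E I A \<in> sets (PiM I (\<lambda>_. N))" using A I by (intro sets_PiM_I_finite) auto
    have "emeasure (density (PiM I (\<lambda>_. N)) (\<lambda>x. \<Prod>i\<in>I. f i (x i))) (Pi\<^sub>E I A) =
        (\<integral>\<^sup>+x. (\<Prod>i\<in>I. f i (x i)) * indicator (Pi\<^sub>E I A) x \<partial>PiM I (\<lambda>_. N))"
      using box by (intro emeasure_density) auto
    also have "\<dots> = (\<integral>\<^sup>+x. (\<Prod>i\<in>I. f i (x i) * indicator (A i) (x i)) \<partial>PiM I (\<lambda>_. N))"
    proof (intro nn_integral_cong)
      fix x assume "x \<in> space (PiM I (\<lambda>_. N))"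
      then have "x \<in> Pi\<^sub>E I A \<longleftrightarrow> (\<forall>i\<in>I. x i \<in> A i)" by (auto simp: space_PiM PiE_iff)
      then have "indicator (Pi\<^sub>E I A) x = (\<Prod>i\<in>I. indicator (A i) (x i) :: ennreal)"
        using I by (auto simp: indicator_def)
      then show "(\<Prod>i\<in>I. f i (x i)) * indicator (Pi\<^sub>E I A) x = (\<Prod>i\<in>I. f i (x i) * indicator (A i) (x i))"
        by (simp add: prod.distrib)
    qed
    also have "\<dots> = (\<Prod>i\<in>I. \<integral>\<^sup>+y. f i y * indicator (A i) y \<partial>N)"
      using I by (intro N.product_nn_integral_prod) auto
    also have "\<dots> = (\<Prod>i\<in>I. emeasure (density N (f i)) (A i))"
      by (intro prod.cong refl) (simp add: emeasure_density)
    finally show "emeasure (density (PiM I (\<lambda>_. N)) (\<lambda>x. \<Prod>i\<in>I. f i (x i))) (Pi\<^sub>E I A) =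
      (\<Prod>i\<in>I. emeasure (density N (f i)) (A i))" .
  qed
qed

fun other :: "hyp \<Rightarrow> hyp" where
  "other H0 = H1" | "other H1 = H0"

context detection_model
begin

definition event :: "hyp \<Rightarrow> 'w set" where
  "event h = {\<omega> \<in> space M. H \<omega> = h}"

definition cond :: "hyp \<Rightarrow> 'w measure" where
  "cond h = uniform_measure M (event h)"

lemma event_measurable [measurable]: "event h \<in> sets M"
  using H_measurable unfolding event_def by measurable

lemma positive_event: "\<exists>h. prob (event h) > 0"
proof (rule ccontr)
  assume "\<not> ?thesis"
  then have *: "prob (event h) = 0" for h using measure_nonneg[of M "event h"] by (auto simp: less_le)
  have "space M = event H0 \<union> event H1" by (auto simp: event_def intro: hyp.exhaust)
  then have "1 \<le> prob (event H0) + prob (event H1)"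
    using measure_Un_le[of "event H0" M "event H1"] prob_space by simp
  then show False using * by simp
qed

lemma positive_other: "prob (event h) = 0 \<Longrightarrow> prob (event (other h)) > 0"
proof -
  assume 0: "prob (event h) = 0"
  obtain h' where "prob (event h') > 0" using positive_event by blast
  moreover from this 0 have "h' = other h" by (cases h; cases h') auto
  ultimately show ?thesis by simp
qed

lemma cond_simps [simp, measurable_cong]: "space (cond h) = space M" "sets (cond h) = sets M"
  by (simp_all add: cond_def)

lemma prob_space_cond: "prob (event h) > 0 \<Longrightarrow> prob_space (cond h)"
  unfolding cond_def by (intro prob_space_uniform_measure) (auto simp: emeasure_eq_measure)

lemma Y1_measurable: "t \<ge> 1 \<Longrightarrow> Y1 t \<in> measurable M N1"
proof -
  assume t: "t \<ge> 1"
  obtain h where "prob (event h) > 0" using positive_event by blast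
  then have "Y1 t \<in> measurable (uniform_measure M {\<omega> \<in> space M. H \<omega> = h}) N1"
    using density1[of h t] t unfolding distributed_def event_def by blast
  then show ?thesis by (simp cong: measurable_cong_sets)
qed

lemma Y2_measurable: "t \<ge> 1 \<Longrightarrow> Y2 t \<in> measurable M N2"
proof -
  assume t: "t \<ge> 1"
  obtain h where "prob (event h) > 0" using positive_event by blast
  then have "Y2 t \<in> measurable (uniform_measure M {\<omega> \<in> space M. H \<omega> = h}) N2"
    using density2[of h t] t unfolding distributed_def event_def by blast
  then show ?thesis by (simp cong: measurable_cong_sets)
qed

text \<open>
  A version of the conditional density of \<open>Y2 t\<close> that is finite everywhere and has integral 1. Under a
  null hypothesis nothing is known about \<open>f2\<close>, so the density under the other one is used. Index
  \<open>0\<close> carries no observation and only serves to make the family total.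
\<close>

definition dens :: "nat \<Rightarrow> hyp \<Rightarrow> 'b \<Rightarrow> ennreal" where
  "dens t h y = (let d = f2 (max 1 t) (if prob (event h) > 0 then h else other h) y
     in if d = top then 0 else d)"

lemma dens_props:
  shows dens_measurable [measurable]: "dens t h \<in> borel_measurable N2"
    and dens_integral: "(\<integral>\<^sup>+y. dens t h y \<partial>N2) = 1"
    and dens_law: "prob (event h) > 0 \<Longrightarrow> t \<ge> 1 \<Longrightarrow> distr (cond h) N2 (Y2 t) = density N2 (dens t h)"
proof -
  define s where "s = max 1 t"
  define h' where "h' = (if prob (event h) > 0 then h else other h)"
  have pos: "prob (event h') > 0" unfolding h'_def using positive_other[of h]
    by (auto simp: not_less measure_le_0_iff)
  interpret C: prob_space "cond h'" using pos by (rule prob_space_cond)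
  have s: "s \<ge> 1" by (simp add: s_def)
  have D: "distr (cond h') N2 (Y2 s) = density N2 (f2 s h')"
    and f [measurable]: "f2 s h' \<in> borel_measurable N2"
    and Y: "Y2 s \<in> measurable (cond h') N2"
    using density2[OF pos[unfolded event_def] s] by (auto simp: distributed_def cond_def event_def)
  have dens: "dens t h = (\<lambda>y. if f2 s h' y = top then 0 else f2 s h' y)"
    by (auto simp: dens_def s_def h'_def Let_def)
  show m: "dens t h \<in> borel_measurable N2" unfolding dens by measurable
  have "(\<integral>\<^sup>+y. f2 s h' y \<partial>N2) = emeasure (density N2 (f2 s h')) (space N2)"
    by (simp add: emeasure_density)
  also have "\<dots> = 1" unfolding D[symmetric]
    using prob_space.emeasure_space_1[OF C.prob_space_distr[OF Y]] by simp
  finally have int: "(\<integral>\<^sup>+y. f2 s h' y \<partial>N2) = 1" .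
  \<comment> \<open>A function with integral 1 is finite almost everywhere, so replacing the value
    top by 0 changes neither the integral nor the law.\<close>
  have "AE y in N2. f2 s h' y \<noteq> \<infinity>" by (rule nn_integral_PInf_AE) (auto simp: int)
  then have ae: "AE y in N2. f2 s h' y = dens t h y" by eventually_elim (simp add: dens)
  show "(\<integral>\<^sup>+y. dens t h y \<partial>N2) = 1"
    using nn_integral_cong_AE[OF ae] int by simp
  show "distr (cond h) N2 (Y2 t) = density N2 (dens t h)" if "prob (event h) > 0" "t \<ge> 1"
  proof -
    have "h' = h" "s = t" using that by (auto simp: h'_def s_def)
    then show ?thesis using D density_cong[OF f m ae] by simp
  qed
qed

lemma dens_finite: "dens t h y < top"
  by (simp add: dens_def Let_def less_top)

definition lik :: "nat \<Rightarrow> hyp \<Rightarrow> (nat \<Rightarrow> 'b) \<Rightarrow> ennreal" where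
  "lik t h y = (\<Prod>s\<in>{1..t}. dens s h (y s))"

abbreviation at_lik :: "nat \<Rightarrow> (nat \<Rightarrow> 'b) \<Rightarrow> (ennreal \<Rightarrow> ennreal \<Rightarrow> 'c) \<Rightarrow> 'c" where
  "at_lik t y X \<equiv> X (lik t H0 y) (lik t H1 y)"

abbreviation obs_space :: "nat \<Rightarrow> (nat \<Rightarrow> 'b) measure" where
  "obs_space t \<equiv> PiM {1..t} (\<lambda>_. N2)"

lemma lik_measurable [measurable]: "lik t h \<in> borel_measurable (obs_space t)"
  unfolding lik_def by measurable

lemma lik_finite: "lik t h y < top"
proof -
  have "(\<Prod>s\<in>S. dens s h (y s)) < top" if "finite S" for S
    using that by (induction S) (simp_all add: ennreal_mult_less_top dens_finite)
  then show ?thesis by (simp add: lik_def)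
qed

lemma obs2_law:
  assumes pos: "prob (event h) > 0" and t: "t \<ge> 1"
  shows "distr (cond h) (obs_space t) (\<lambda>\<omega>. restrict (\<lambda>s. Y2 s \<omega>) {1..t}) = density (obs_space t) (lik t h)"
proof -
  interpret C: prob_space "cond h" using pos by (rule prob_space_cond)
  have "C.indep_vars (\<lambda>_. N2) Y2 {1..}"
    using indep2[OF pos[unfolded event_def]] by (simp add: cond_def event_def)
  then have "C.indep_vars (\<lambda>_. N2) Y2 {1..t}" by (rule C.indep_vars_subset) auto
  moreover have "Y2 i \<in> measurable (cond h) N2" if "i \<in> {1..t}" for i
    using Y2_measurable[of i] that by simp
  ultimately have "distr (cond h) (obs_space t) (\<lambda>\<omega>. \<lambda>i\<in>{1..t}. Y2 i \<omega>) =
      (\<Pi>\<^sub>M i\<in>{1..t}. distr (cond h) N2 (Y2 i))"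
    using t by (subst (asm) C.indep_vars_iff_distr_eq_PiM') auto
  also have "\<dots> = (\<Pi>\<^sub>M i\<in>{1..t}. density N2 (dens i h))"
    by (intro PiM_cong refl dens_law[OF pos]) auto
  also have "\<dots> = density (obs_space t) (lik t h)"
    unfolding lik_def
  proof (rule PiM_density[OF ref2])
    show "sigma_finite_measure (density N2 (dens i h))" for i
    proof -
      have "finite_measure (density N2 (dens i h))"
        by (rule finite_measureI) (simp add: emeasure_density dens_integral cong: nn_integral_cong)
      then show ?thesis by (rule finite_measure.axioms)
    qed
  qed auto
  finally show ?thesis .
qed

text \<open>The whole sequence rather than a prefix: after a stop of observer 2, observer 1 may go
  on observing.\<close>

definition obs1 :: "'w \<Rightarrow> nat \<Rightarrow> 'a" where
  "obs1 \<omega> = restrict (\<lambda>t. Y1 t \<omega>) {1..}"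

definition obs2 :: "nat \<Rightarrow> 'w \<Rightarrow> nat \<Rightarrow> 'b" where
  "obs2 t \<omega> = restrict (\<lambda>s. Y2 s \<omega>) {1..t}"

lemma obs1_measurable [measurable]: "obs1 \<in> measurable M (PiM {1..} (\<lambda>_. N1))"
  unfolding obs1_def by (intro measurable_restrict Y1_measurable) auto

lemma obs2_measurable [measurable]: "obs2 t \<in> measurable M (obs_space t)"
  unfolding obs2_def by (intro measurable_restrict Y2_measurable) auto

text \<open>Conditional independence makes the joint law given \<open>H = h\<close> a product. Only
  the factor of observer 2 is written with densities; that of observer 1 stays an integral over
  \<open>M\<close>. Under a null hypothesis both sides vanish.\<close>

lemma factorize:
  assumes F [measurable]: "F \<in> borel_measurable (obs_space t)"
    and G [measurable]: "G \<in> borel_measurable (PiM {1..} (\<lambda>_. N1))" and t: "t \<ge> 1"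
  shows "(\<integral>\<^sup>+\<omega>. indicator (event h) \<omega> * F (obs2 t \<omega>) * G (obs1 \<omega>) \<partial>M) =
    (\<integral>\<^sup>+y. F y * lik t h y \<partial>obs_space t) * (\<integral>\<^sup>+\<omega>. indicator (event h) \<omega> * G (obs1 \<omega>) \<partial>M)"
proof (cases "prob (event h) > 0")
  case False
  then have "prob (event h) = 0" by (simp add: not_less measure_le_0_iff)
  then have "emeasure M (event h) = 0" by (simp add: emeasure_eq_measure)
  then have "event h \<in> null_sets M" by (simp add: null_setsI)
  then have ae: "AE \<omega> in M. \<omega> \<notin> event h" by (rule AE_not_in)
  have "(\<integral>\<^sup>+\<omega>. indicator (event h) \<omega> * Z \<omega> \<partial>M) = 0" for Z
    using ae by (subst nn_integral_cong_AE[where v="\<lambda>_. 0"]) auto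
  from this[of "\<lambda>\<omega>. F (obs2 t \<omega>) * G (obs1 \<omega>)"] this[of "\<lambda>\<omega>. G (obs1 \<omega>)"]
  show ?thesis by (simp add: mult.assoc)
next
  case pos: True
  interpret C: prob_space "cond h" using pos by (rule prob_space_cond)
  \<comment> \<open>Independence is assumed for the complete sequences; the prefix
    \<open>obs2 t\<close> is recovered from \<open>Z2\<close> by the projection
    \<open>R\<close>.\<close>
  define Z2 where "Z2 \<omega> = restrict (\<lambda>t. Y2 t \<omega>) {1..}" for \<omega>
  let ?S1 = "PiM {1..} (\<lambda>_::nat. N1)" and ?S2 = "PiM {1..} (\<lambda>_::nat. N2)"
  have m1 [measurable]: "obs1 \<in> measurable (cond h) ?S1"
    unfolding measurable_cong_sets[OF cond_simps(2) refl] by (rule obs1_measurable)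
  have m2 [measurable]: "Z2 \<in> measurable (cond h) ?S2"
    unfolding Z2_def using Y2_measurable by (intro measurable_restrict) simp
  define R where "R y = restrict y {1..t}" for y :: "nat \<Rightarrow> 'b"
  have R [measurable]: "R \<in> measurable ?S2 (obs_space t)"
    unfolding R_def by (rule measurable_restrict_subset) auto
  have RZ: "R (Z2 \<omega>) = obs2 t \<omega>" for \<omega>
    by (auto simp: R_def Z2_def obs2_def restrict_def)
  have indep: "C.indep_set (sets (vimage_algebra (space M) obs1 ?S1)) (sets (vimage_algebra (space M) Z2 ?S2))"
    using indep12[OF pos[unfolded event_def]]
    by (simp add: Z2_def[abs_def] obs1_def[abs_def] cond_def event_def)
  have joint: "distr (cond h) ?S1 obs1 \<Otimes>\<^sub>M distr (cond h) ?S2 Z2 =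
      distr (cond h) (?S1 \<Otimes>\<^sub>M ?S2) (\<lambda>\<omega>. (obs1 \<omega>, Z2 \<omega>))"
  proof (rule pair_measure_eqI)
    show "sigma_finite_measure (distr (cond h) ?S1 obs1)" "sigma_finite_measure (distr (cond h) ?S2 Z2)"
      by (intro prob_space_imp_sigma_finite C.prob_space_distr m1 m2)+
    fix X Z assume "X \<in> sets (distr (cond h) ?S1 obs1)" "Z \<in> sets (distr (cond h) ?S2 Z2)"
    then have X [measurable]: "X \<in> sets ?S1" and Z [measurable]: "Z \<in> sets ?S2" by auto
    have "C.prob ((obs1 -` X \<inter> space M) \<inter> (Z2 -` Z \<inter> space M)) =
        C.prob (obs1 -` X \<inter> space M) * C.prob (Z2 -` Z \<inter> space M)"
      using indep in_vimage_algebra[OF X, of obs1 "space M"] in_vimage_algebra[OF Z, of Z2 "space M"]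
      unfolding C.indep_sets2_eq by blast
    moreover have "(\<lambda>\<omega>. (obs1 \<omega>, Z2 \<omega>)) -` (X \<times> Z) \<inter> space M =
        (obs1 -` X \<inter> space M) \<inter> (Z2 -` Z \<inter> space M)" by auto
    ultimately show "emeasure (distr (cond h) ?S1 obs1) X * emeasure (distr (cond h) ?S2 Z2) Z =
        emeasure (distr (cond h) (?S1 \<Otimes>\<^sub>M ?S2) (\<lambda>\<omega>. (obs1 \<omega>, Z2 \<omega>))) (X \<times> Z)"
      unfolding emeasure_distr[OF m1 X] emeasure_distr[OF m2 Z]
        emeasure_distr[OF measurable_Pair[OF m1 m2] pair_measureI[OF X Z]] cond_simps C.emeasure_eq_measure
      by (simp add: ennreal_mult)
  qed simp
  interpret D2: prob_space "distr (cond h) ?S2 Z2" by (rule C.prob_space_distr[OF m2])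
  have "(\<integral>\<^sup>+\<omega>. F (obs2 t \<omega>) * G (obs1 \<omega>) \<partial>cond h) =
      (\<integral>\<^sup>+p. F (R (snd p)) * G (fst p) \<partial>distr (cond h) (?S1 \<Otimes>\<^sub>M ?S2) (\<lambda>\<omega>. (obs1 \<omega>, Z2 \<omega>)))"
    by (subst nn_integral_distr) (auto simp: RZ)
  also have "\<dots> = (\<integral>\<^sup>+x. \<integral>\<^sup>+y. F (R y) * G x \<partial>distr (cond h) ?S2 Z2 \<partial>distr (cond h) ?S1 obs1)"
    unfolding joint[symmetric] by (subst D2.nn_integral_fst[symmetric]) auto
  also have "\<dots> = (\<integral>\<^sup>+x. (\<integral>\<^sup>+y. F (R y) \<partial>distr (cond h) ?S2 Z2) * G x \<partial>distr (cond h) ?S1 obs1)"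
    by (intro nn_integral_cong nn_integral_multc) auto
  also have "\<dots> = (\<integral>\<^sup>+y. F (R y) \<partial>distr (cond h) ?S2 Z2) * (\<integral>\<^sup>+x. G x \<partial>distr (cond h) ?S1 obs1)"
    by (rule nn_integral_cmult) auto
  also have "(\<integral>\<^sup>+x. G x \<partial>distr (cond h) ?S1 obs1) = (\<integral>\<^sup>+\<omega>. G (obs1 \<omega>) \<partial>cond h)"
    by (subst nn_integral_distr) auto
  also have "(\<integral>\<^sup>+y. F (R y) \<partial>distr (cond h) ?S2 Z2) = (\<integral>\<^sup>+\<omega>. F (obs2 t \<omega>) \<partial>cond h)"
    by (subst nn_integral_distr) (auto simp: RZ)
  also have "\<dots> = (\<integral>\<^sup>+y. F y \<partial>density (obs_space t) (lik t h))"
    unfolding obs2_law[OF pos t, symmetric] by (subst nn_integral_distr) (auto simp flip: obs2_def)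
  also have "\<dots> = (\<integral>\<^sup>+y. F y * lik t h y \<partial>obs_space t)"
    by (subst nn_integral_density) (auto simp: mult.commute)
  finally have main: "(\<integral>\<^sup>+\<omega>. F (obs2 t \<omega>) * G (obs1 \<omega>) \<partial>cond h) =
      (\<integral>\<^sup>+y. F y * lik t h y \<partial>obs_space t) * (\<integral>\<^sup>+\<omega>. G (obs1 \<omega>) \<partial>cond h)" .
  \<comment> \<open>The probability of \<open>H = h\<close>, by which \<open>cond h\<close> is
    normalised, occurs exactly once on each side.\<close>
  let ?w = "emeasure M (event h)"
  have w: "?w \<noteq> 0" "?w \<noteq> top" using pos by (auto simp: emeasure_eq_measure)
  have scale: "(\<integral>\<^sup>+\<omega>. indicator (event h) \<omega> * X \<omega> \<partial>M) = ?w * (\<integral>\<^sup>+\<omega>. X \<omega> \<partial>cond h)"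
    if [measurable]: "X \<in> borel_measurable M" for X
  proof -
    have "?w * (I / ?w) = I" for I
      using w by (simp add: ennreal_times_divide mult.commute[of ?w] mult_divide_eq_ennreal)
    then show ?thesis
      unfolding cond_def by (subst nn_integral_uniform_measure) (auto simp: mult.commute)
  qed
  show ?thesis
    using scale[of "\<lambda>\<omega>. F (obs2 t \<omega>) * G (obs1 \<omega>)"] scale[of "\<lambda>\<omega>. G (obs1 \<omega>)"] main
    by (simp add: mult.assoc mult.left_commute)
qed

end

section \<open>Value functions of observer 2\<close>

lemma finite_blank_paths: "finite {u :: nat \<Rightarrow> decision. \<forall>s. s \<notin> {1..n} \<longrightarrow> u s = Blank}"
proof (rule finite_subset)
  show "finite {u :: nat \<Rightarrow> decision. \<forall>s. (s \<in> {1..n} \<longrightarrow> u s \<in> UNIV) \<and> (s \<notin> {1..n} \<longrightarrow> u s = Blank)}"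
    by (rule finite_set_of_finite_funs) auto
qed auto

text \<open>A finite set containing all runs of length \<open>n\<close>, so that measurability of a
  run reduces to finitely many cases.\<close>

definition run_range :: "nat \<Rightarrow> ((nat \<Rightarrow> decision) \<times> (nat \<Rightarrow> decision)) set" where
  "run_range n = {u. \<forall>s. s \<notin> {1..n} \<longrightarrow> u s = Blank} \<times> {u. \<forall>s. s \<notin> {1..n} \<longrightarrow> u s = Blank}"

lemma finite_run_range: "finite (run_range n)"
  unfolding run_range_def by (intro finite_cartesian_product finite_blank_paths)

lemma policy_measurable:
  assumes "is_policy T N G" "t \<in> {1..T}" and y: "y \<in> measurable X (PiM {1..t} (\<lambda>_. N))"
  shows "(\<lambda>x. G t (y x, restrict u1 {1..<t}, restrict u2 {1..<t})) \<in> measurable X (count_space UNIV)"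
proof -
  have "G t \<in> measurable (history_space N t) (count_space UNIV)"
    using assms by (auto simp: is_policy_def)
  moreover have "(\<lambda>x. (y x, restrict u1 {1..<t}, restrict u2 {1..<t})) \<in> measurable X (history_space N t)"
    unfolding history_space_def using y by (intro measurable_Pair measurable_const) (auto simp: space_PiM)
  ultimately show ?thesis by (rule measurable_compose[rotated])
qed

lemma move_measurable:
  assumes "is_policy T N G" "t \<in> {1..T}"
    and "(\<lambda>x. restrict (y x) {1..t}) \<in> measurable X (PiM {1..t} (\<lambda>_. N))"
  shows "(\<lambda>x. move G (y x) own u1 u2 t) \<in> measurable X (count_space UNIV)"
  using policy_measurable[OF assms] unfolding move_def history_def
  by (cases "\<exists>s\<in>{1..<t}. own s \<noteq> Blank") simp_all

text \<open>For each of the finitely many possible past runs the next pair of moves is measurable,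
  and countable composition glues these cases.\<close>

lemma run_measurable:
  assumes m1: "\<And>t own u1 u2. t \<in> {1..n} \<Longrightarrow> (\<lambda>x. move G1 (y1 x) own u1 u2 t) \<in> measurable X (count_space UNIV)"
    and m2: "\<And>t own u1 u2. t \<in> {1..n} \<Longrightarrow> (\<lambda>x. move G2 (y2 x) own u1 u2 t) \<in> measurable X (count_space UNIV)"
  shows "(\<lambda>x. run G1 G2 (y1 x) (y2 x) n) \<in> measurable X (count_space (run_range n))"
  using m1 m2
proof (induction n)
  case 0
  then show ?case by (auto simp: run_range_def)
next
  case (Suc n)
  let ?m = "Suc n"
  define step where "step r x = ((fst r)(?m := move G1 (y1 x) (fst r) (fst r) (snd r) ?m),
    (snd r)(?m := move G2 (y2 x) (snd r) (fst r) (snd r) ?m))" for r x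
  have run: "run G1 G2 (y1 x) (y2 x) ?m = step (run G1 G2 (y1 x) (y2 x) n) x" for x
    by (simp add: prod_eq_iff run_Suc step_def)
  show ?case
    unfolding run
  proof (rule measurable_compose_countable'[where f = step and g = "\<lambda>x. run G1 G2 (y1 x) (y2 x) n"])
    show "countable (run_range n)" using finite_run_range by (rule countable_finite)
    show "(\<lambda>x. run G1 G2 (y1 x) (y2 x) n) \<in> measurable X (count_space (run_range n))"
      using Suc by simp
    fix r assume r: "r \<in> run_range n"
    show "step r \<in> measurable X (count_space (run_range ?m))"
      unfolding step_def
    proof (rule measurable_compose_countable'[where I = UNIV and g = "\<lambda>x. move G1 (y1 x) (fst r) (fst r) (snd r) ?m"
        and f = "\<lambda>v x. ((fst r)(?m := v), (snd r)(?m := move G2 (y2 x) (snd r) (fst r) (snd r) ?m))"])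
      fix v
      have "(\<lambda>w. ((fst r)(?m := v), (snd r)(?m := w))) \<in> measurable (count_space UNIV) (count_space (run_range ?m))"
        using r by (auto simp: run_range_def)
      then show "(\<lambda>x. ((fst r)(?m := v), (snd r)(?m := move G2 (y2 x) (snd r) (fst r) (snd r) ?m)))
          \<in> measurable X (count_space (run_range ?m))"
        by (rule measurable_compose[rotated]) (rule Suc.prems(2), simp)
    qed (auto intro: Suc.prems(1) countable_finite)
  qed
qed

locale detection_problem = detection_model M H p0 N1 f1 Y1 N2 f2 Y2
  for M :: "'w measure" and H :: "'w \<Rightarrow> hyp" and p0 :: real
    and N1 :: "'a measure" and f1 :: "nat \<Rightarrow> hyp \<Rightarrow> 'a \<Rightarrow> ennreal" and Y1 :: "nat \<Rightarrow> 'w \<Rightarrow> 'a"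
    and N2 :: "'b measure" and f2 :: "nat \<Rightarrow> hyp \<Rightarrow> 'b \<Rightarrow> ennreal" and Y2 :: "nat \<Rightarrow> 'w \<Rightarrow> 'b" +
  fixes T :: nat and K k :: real and J :: "hyp \<Rightarrow> hyp \<Rightarrow> real" and G1 :: "'a policy"
  assumes horizon: "T \<ge> 1"
    and costs: "0 < k" "k < K"
    and J_nonneg: "\<And>u h. J u h \<ge> 0"
    and J_diag: "\<And>h. J h h = 0"
    and policy1: "is_policy T N1 G1"
begin

section \<open>Observer 1 as a function of its own observations\<close>

abbreviation seq_space :: "(nat \<Rightarrow> 'a) measure" where
  "seq_space \<equiv> PiM {1..} (\<lambda>_. N1)"

definition B :: "'w \<Rightarrow> nat \<Rightarrow> decision" where
  "B \<omega> = silent_path G1 (obs1 \<omega>)"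

lemma B_eq: "B \<omega> = silent_path G1 (\<lambda>s. Y1 s \<omega>)"
  unfolding B_def obs1_def by (rule silent_path_restrict)

definition HS :: "nat \<Rightarrow> (nat \<Rightarrow> decision) set" where
  "HS t = ({1..<t} \<rightarrow>\<^sub>E UNIV)"

lemma finite_HS [simp]: "finite (HS t)"
  unfolding HS_def by (intro finite_PiE) auto

lemma restrict_HS [simp]: "restrict u {1..<t} \<in> HS t"
  by (auto simp: HS_def)

lemma silent_path_eq_run:
  "s \<le> T \<Longrightarrow> silent_path G1 x s = fst (run G1 silent x (\<lambda>_. ()) T) s"
  by (subst run_stable) (simp add: silent_path_def)

lemma hist_measurable:
  assumes "t \<le> Suc T"
  shows "(\<lambda>x. restrict (silent_path G1 x) {1..<t}) \<in> measurable seq_space (count_space (HS t))"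
proof -
  have eq: "restrict (silent_path G1 x) {1..<t} = restrict (fst (run G1 silent x (\<lambda>_. ()) T)) {1..<t}" for x
    using assms by (intro restrict_ext silent_path_eq_run) auto
  have "(\<lambda>x. run G1 silent x (\<lambda>_. ()) T) \<in> measurable seq_space (count_space (run_range T))"
    by (intro run_measurable move_measurable[OF policy1] measurable_restrict_subset) (auto simp: move_def[of silent] silent_def)
  moreover have "(\<lambda>r. restrict (fst r) {1..<t}) \<in> measurable (count_space (run_range T)) (count_space (HS t))"
    by (auto simp: HS_def)
  ultimately show ?thesis unfolding eq by (rule measurable_compose)
qed

definition hist_ind :: "nat \<Rightarrow> (nat \<Rightarrow> decision) \<Rightarrow> (nat \<Rightarrow> 'a) \<Rightarrow> ennreal" where
  "hist_ind t u x = (if restrict (silent_path G1 x) {1..<t} = u then 1 else 0)"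

lemma hist_ind_measurable:
  assumes "t \<le> Suc T"
  shows "hist_ind t u \<in> borel_measurable seq_space"
  unfolding hist_ind_def
  by (rule measurable_compose[OF hist_measurable[OF assms], of "\<lambda>v. if v = u then 1 else 0"]) simp

text \<open>Cost of the counterfactual in which observer 2 stops at \<open>t\<close> with
  \<open>d\<close>. It involves the observations of observer 1 only, including its reaction to the
  message.\<close>

definition stop_cost :: "nat \<Rightarrow> hyp \<Rightarrow> hyp \<Rightarrow> (nat \<Rightarrow> 'a) \<Rightarrow> ennreal" where
  "stop_cost t d h x = ennreal (path_cost K k J (stop_path G1 t d x) ((\<lambda>_. Blank)(t := Decide d)) h)"

lemma seq_space_in: "x \<in> space seq_space \<Longrightarrow> s \<in> {1..n} \<Longrightarrow> x s \<in> space N1"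
  by (auto simp: space_PiM PiE_iff)

lemma stop_cost_measurable: "stop_cost t d h \<in> borel_measurable seq_space"
proof -
  have "(\<lambda>x. run G1 (stop_at t d) x (\<lambda>_. ()) T) \<in> measurable seq_space (count_space (run_range T))"
    by (intro run_measurable move_measurable[OF policy1] measurable_restrict_subset)
      (auto simp: move_def[of "stop_at t d"] stop_at_def)
  then have "(\<lambda>x. ennreal (path_cost K k J (fst (run G1 (stop_at t d) x (\<lambda>_. ()) T)) ((\<lambda>_. Blank)(t := Decide d)) h))
      \<in> borel_measurable seq_space"
    by (rule measurable_compose) simp
  moreover have "stop_path G1 t d x = fst (run G1 (stop_at t d) x (\<lambda>_. ()) T)"
    if "x \<in> space seq_space" for x
    by (rule stop_path_eq_run[OF policy1 horizon]) (rule seq_space_in[OF that])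
  ultimately show ?thesis
    by (subst measurable_cong) (auto simp: stop_cost_def)
qed

lemma obs1_in: "\<omega> \<in> space M \<Longrightarrow> obs1 \<omega> \<in> space seq_space"
  by (rule measurable_space[OF obs1_measurable])

lemma Y1_in: "\<omega> \<in> space M \<Longrightarrow> s \<in> {1..n} \<Longrightarrow> Y1 s \<omega> \<in> space N1"
  using measurable_space[OF Y1_measurable, of s \<omega>] by auto

lemma Y2_in: "\<omega> \<in> space M \<Longrightarrow> s \<in> {1..n} \<Longrightarrow> Y2 s \<omega> \<in> space N2"
  using measurable_space[OF Y2_measurable, of s \<omega>] by auto

lemma stop_cost_le:
  assumes "x \<in> space seq_space" "t \<in> {1..T}"
  shows "stop_cost t d h x \<le> ennreal (cost_bound T K k J)"
  unfolding stop_cost_def using assms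
  by (intro ennreal_leI path_cost_le[OF costs J_nonneg] path_stops(1)[OF policy1 horizon seq_space_in])
     (auto intro!: bexI[of _ t])

text \<open>Joint probability of \<open>H = h\<close> and of \<open>u\<close> as the history of
  observer 1 against a silent observer 2.\<close>

definition Q :: "nat \<Rightarrow> (nat \<Rightarrow> decision) \<Rightarrow> hyp \<Rightarrow> ennreal" where
  "Q t u h = (\<integral>\<^sup>+\<omega>. indicator (event h) \<omega> * hist_ind t u (obs1 \<omega>) \<partial>M)"

text \<open>Expected stopping cost over the same event, not divided by its probability. The law of
  observer 1 enters the recursion of \<open>val_to_go\<close> through these numbers only.\<close>

definition C :: "nat \<Rightarrow> (nat \<Rightarrow> decision) \<Rightarrow> hyp \<Rightarrow> hyp \<Rightarrow> ennreal" where
  "C t u d h = (\<integral>\<^sup>+\<omega>. indicator (event h) \<omega> * (hist_ind t u (obs1 \<omega>) * stop_cost t d h (obs1 \<omega>)) \<partial>M)"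

definition D :: ennreal where
  "D = ennreal (cost_bound T K k J)"

lemma D_finite: "D < top"
  by (simp add: D_def)

lemma hist_ind_obs1_measurable [measurable]:
  "t \<le> Suc T \<Longrightarrow> (\<lambda>\<omega>. hist_ind t u (obs1 \<omega>)) \<in> borel_measurable M"
  by (rule measurable_compose[OF obs1_measurable hist_ind_measurable])

lemma stop_cost_obs1_measurable [measurable]: "(\<lambda>\<omega>. stop_cost t d h (obs1 \<omega>)) \<in> borel_measurable M"
  by (rule measurable_compose[OF obs1_measurable stop_cost_measurable])

lemma Q_finite: "Q t u h < top"
proof -
  have "Q t u h \<le> (\<integral>\<^sup>+\<omega>. 1 \<partial>M)"
    unfolding Q_def by (intro nn_integral_mono) (auto simp: hist_ind_def indicator_def)
  then show ?thesis by (simp add: emeasure_space_1 le_less_trans)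
qed

text \<open>Keeping the factor \<open>Q\<close> in the bound yields the Lipschitz constants
  \<open>D * Q\<close> and makes \<open>C\<close> vanish on null histories.\<close>

lemma C_le: "t \<in> {1..T} \<Longrightarrow> C t u d h \<le> D * Q t u h"
proof -
  assume t: "t \<in> {1..T}"
  have "C t u d h \<le> (\<integral>\<^sup>+\<omega>. D * (indicator (event h) \<omega> * hist_ind t u (obs1 \<omega>)) \<partial>M)"
    unfolding C_def
  proof (rule nn_integral_mono)
    fix \<omega> assume "\<omega> \<in> space M"
    then have "indicator (event h) \<omega> * (hist_ind t u (obs1 \<omega>) * stop_cost t d h (obs1 \<omega>)) \<le>
        indicator (event h) \<omega> * (hist_ind t u (obs1 \<omega>) * D)"
      unfolding D_def using t by (intro mult_left_mono stop_cost_le obs1_in) auto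
    then show "indicator (event h) \<omega> * (hist_ind t u (obs1 \<omega>) * stop_cost t d h (obs1 \<omega>)) \<le>
        D * (indicator (event h) \<omega> * hist_ind t u (obs1 \<omega>))"
      by (simp add: mult_ac)
  qed
  also have "\<dots> = D * Q t u h"
    unfolding Q_def using t by (intro nn_integral_cmult) auto
  finally show ?thesis .
qed

lemma C_finite: "t \<in> {1..T} \<Longrightarrow> C t u d h < top"
  using C_le[of t u d h] D_finite Q_finite by (auto simp: ennreal_mult_less_top intro: le_less_trans)

lemma extend_HS: "1 \<le> t \<Longrightarrow> u \<in> HS t \<Longrightarrow> u(t := x) \<in> HS (Suc t)"
  by (auto simp: HS_def PiE_iff extensional_def)

lemma restrict_Suc_eq_iff:
  assumes "1 \<le> t" "u \<in> HS t"
  shows "restrict v {1..<Suc t} = u(t := x) \<longleftrightarrow> restrict v {1..<t} = u \<and> v t = x"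
proof
  assume *: "restrict v {1..<Suc t} = u(t := x)"
  have "restrict v {1..<t} s = u s" for s
    using fun_cong[OF *, of s] assms by (auto simp: HS_def PiE_iff extensional_def restrict_def split: if_splits)
  moreover have "v t = x" using fun_cong[OF *, of t] assms by simp
  ultimately show "restrict v {1..<t} = u \<and> v t = x" by blast
next
  assume "restrict v {1..<t} = u \<and> v t = x"
  then have u: "u = restrict v {1..<t}" "x = v t" by auto
  show "restrict v {1..<Suc t} = u(t := x)"
    unfolding u using assms(1) by (auto simp: restrict_def fun_eq_iff)
qed

lemma hist_ind_Suc:
  assumes "1 \<le> t" "u \<in> HS t"
  shows "hist_ind (Suc t) (u(t := x)) y = (if silent_path G1 y t = x then hist_ind t u y else 0)"
  using restrict_Suc_eq_iff[OF assms] by (simp add: hist_ind_def)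

text \<open>The one-step extensions of \<open>u\<close> partition the event of \<open>u\<close>.
  Hence the Lipschitz constants of the extensions add up to \<open>D * Q\<close> one step
  earlier.\<close>

lemma Q_Suc:
  assumes "1 \<le> t" "t \<le> T" "u \<in> HS t"
  shows "(\<Sum>x\<in>UNIV. Q (Suc t) (u(t := x)) h) = Q t u h"
proof -
  have "(\<Sum>x\<in>UNIV. Q (Suc t) (u(t := x)) h) =
      (\<integral>\<^sup>+\<omega>. (\<Sum>x\<in>UNIV. indicator (event h) \<omega> * hist_ind (Suc t) (u(t := x)) (obs1 \<omega>)) \<partial>M)"
    unfolding Q_def using assms by (subst nn_integral_sum) auto
  also have "\<dots> = Q t u h"
    unfolding Q_def
    by (intro nn_integral_cong) (simp add: hist_ind_Suc[OF assms(1,3)] sum_distrib_left[symmetric])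
  finally show ?thesis .
qed

text \<open>\<open>a\<close> and \<open>b\<close> are the likelihoods of the observations of
  observer 2 under \<open>H0\<close> and \<open>H1\<close>; the prior and observer 1 are already
  inside \<open>C\<close>.\<close>

definition stop_val :: "nat \<Rightarrow> (nat \<Rightarrow> decision) \<Rightarrow> hyp \<Rightarrow> ennreal \<Rightarrow> ennreal \<Rightarrow> ennreal" where
  "stop_val t u d a b = a * C t u d H0 + b * C t u d H1"

text \<open>Recursion on the number of remaining steps: the current time is
  \<open>T - Suc n\<close>, the next one \<open>T - n\<close>. Both observers move simultaneously,
  so the current decision \<open>x\<close> of observer 1 becomes known only at the next time, hence
  the sum. It carries no transition probabilities, since \<open>C\<close> of the longer history
  contains them.\<close>

primrec val_to_go :: "nat \<Rightarrow> (nat \<Rightarrow> decision) \<Rightarrow> ennreal \<Rightarrow> ennreal \<Rightarrow> ennreal" where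
  "val_to_go 0 u a b = min (stop_val T u H0 a b) (stop_val T u H1 a b)"
| "val_to_go (Suc n) u a b = min (min (stop_val (T - Suc n) u H0 a b) (stop_val (T - Suc n) u H1 a b))
     (\<Sum>x\<in>UNIV. \<integral>\<^sup>+y. val_to_go n (u(T - Suc n := x)) (a * dens (T - n) H0 y) (b * dens (T - n) H1 y) \<partial>N2)"

definition V :: "nat \<Rightarrow> (nat \<Rightarrow> decision) \<Rightarrow> ennreal \<Rightarrow> ennreal \<Rightarrow> ennreal" where
  "V t = val_to_go (T - t)"

definition W :: "nat \<Rightarrow> (nat \<Rightarrow> decision) \<Rightarrow> ennreal \<Rightarrow> ennreal \<Rightarrow> ennreal" where
  "W t u a b = (\<Sum>x\<in>UNIV. \<integral>\<^sup>+y. V (Suc t) (u(t := x)) (a * dens (Suc t) H0 y) (b * dens (Suc t) H1 y) \<partial>N2)"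

lemma V_T: "V T u a b = min (stop_val T u H0 a b) (stop_val T u H1 a b)"
  by (simp add: V_def)

lemma V_less:
  assumes "t < T"
  shows "V t u a b = min (min (stop_val t u H0 a b) (stop_val t u H1 a b)) (W t u a b)"
proof -
  define n where "n = T - Suc t"
  have n: "T - t = Suc n" "T - Suc n = t" "T - n = Suc t" "T - Suc t = n" using assms by (auto simp: n_def)
  show ?thesis unfolding V_def W_def n by (simp add: n)
qed

lemma value_function_stop_val:
  assumes "t \<in> {1..T}"
  shows "value_function (D * Q t u H0) (D * Q t u H1) (stop_val t u d)"
  unfolding stop_val_def[abs_def] by (intro value_function_affine C_le assms)

text \<open>The property of the next value function is an assumption here, so that the lemma serves
  inside the induction for \<open>V\<close> and again after it.\<close>

lemma value_function_W_step:
  assumes "1 \<le> t" "t < T" "u \<in> HS t"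
    and IH: "\<And>u. u \<in> HS (Suc t) \<Longrightarrow> value_function (D * Q (Suc t) u H0) (D * Q (Suc t) u H1) (V (Suc t) u)"
  shows "value_function (D * Q t u H0) (D * Q t u H1) (W t u)"
proof -
  have "value_function (\<Sum>x\<in>UNIV. D * Q (Suc t) (u(t := x)) H0) (\<Sum>x\<in>UNIV. D * Q (Suc t) (u(t := x)) H1)
    (\<lambda>a b. \<Sum>x\<in>UNIV. \<integral>\<^sup>+y. V (Suc t) (u(t := x)) (a * dens (Suc t) H0 y) (b * dens (Suc t) H1 y) \<partial>N2)"
    using assms by (intro value_function_sum value_function_integral IH extend_HS ref2 dens_integral dens_measurable) auto
  then show ?thesis
    using assms unfolding W_def[abs_def] sum_distrib_left[symmetric] by (simp add: Q_Suc)
qed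

lemma value_function_V:
  assumes "1 \<le> t" "t \<le> T" "u \<in> HS t"
  shows "value_function (D * Q t u H0) (D * Q t u H1) (V t u)"
  using assms(2,1,3)
proof (induction arbitrary: u rule: inc_induct)
  case base
  show ?case unfolding V_T[abs_def] using base
    by (intro value_function_min value_function_stop_val) auto
next
  case (step n)
  have "V n u = (\<lambda>a b. min (min (stop_val n u H0 a b) (stop_val n u H1 a b)) (W n u a b))"
    using V_less[OF step.hyps(2)] by (simp add: fun_eq_iff)
  then show ?case using step
    by (auto intro!: value_function_min value_function_stop_val value_function_W_step)
qed

lemma value_function_W:
  assumes "1 \<le> t" "t < T" "u \<in> HS t"
  shows "value_function (D * Q t u H0) (D * Q t u H1) (W t u)"
  using assms by (intro value_function_W_step value_function_V) auto

end

section \<open>Dynamic programming\<close>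

context detection_problem
begin

definition hist :: "nat \<Rightarrow> 'w \<Rightarrow> nat \<Rightarrow> decision" where
  "hist t \<omega> = restrict (B \<omega>) {1..<t}"

lemma hist_measurable_M: "t \<le> Suc T \<Longrightarrow> hist t \<in> measurable M (count_space (HS t))"
  unfolding hist_def[abs_def] B_def by (rule measurable_compose[OF obs1_measurable hist_measurable])

lemma hist_ind_obs1: "hist_ind t u (obs1 \<omega>) = (if hist t \<omega> = u then 1 else 0)"
  by (simp add: hist_ind_def hist_def B_def)

lemma hist_HS [simp]: "hist t \<omega> \<in> HS t"
  by (simp add: hist_def)

text \<open>Splits by the finitely many pairs of history and hypothesis. On each piece
  \<open>F\<close> depends on observer 2 only and \<open>G\<close> on observer 1 only, so
  \<open>factorize\<close> applies.\<close>

lemma disintegration: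
  assumes t: "1 \<le> t" "t \<le> T"
    and F [measurable]: "\<And>u h. F u h \<in> borel_measurable (obs_space t)"
    and G [measurable]: "\<And>h. G h \<in> borel_measurable seq_space"
  shows "(\<integral>\<^sup>+\<omega>. F (hist t \<omega>) (H \<omega>) (obs2 t \<omega>) * G (H \<omega>) (obs1 \<omega>) \<partial>M) =
    (\<Sum>u\<in>HS t. \<Sum>h\<in>UNIV. (\<integral>\<^sup>+y. F u h y * lik t h y \<partial>obs_space t) *
      (\<integral>\<^sup>+\<omega>. indicator (event h) \<omega> * (hist_ind t u (obs1 \<omega>) * G h (obs1 \<omega>)) \<partial>M))"
proof -
  have [measurable]: "hist_ind t u \<in> borel_measurable seq_space" for u
    using t by (intro hist_ind_measurable) auto
  have "(\<integral>\<^sup>+\<omega>. F (hist t \<omega>) (H \<omega>) (obs2 t \<omega>) * G (H \<omega>) (obs1 \<omega>) \<partial>M) =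
      (\<integral>\<^sup>+\<omega>. (\<Sum>u\<in>HS t. \<Sum>h\<in>UNIV. indicator (event h) \<omega> * F u h (obs2 t \<omega>) *
        (hist_ind t u (obs1 \<omega>) * G h (obs1 \<omega>))) \<partial>M)"
  proof (rule nn_integral_cong)
    fix \<omega> assume \<omega>: "\<omega> \<in> space M"
    have "(\<Sum>u\<in>HS t. \<Sum>h\<in>UNIV. indicator (event h) \<omega> * F u h (obs2 t \<omega>) * (hist_ind t u (obs1 \<omega>) * G h (obs1 \<omega>)))
        = (\<Sum>u\<in>HS t. \<Sum>h\<in>UNIV. if h = H \<omega> then
            (if u = hist t \<omega> then F u h (obs2 t \<omega>) * G h (obs1 \<omega>) else 0) else 0)"
      using \<omega> by (intro sum.cong refl) (auto simp: event_def hist_ind_obs1)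
    also have "\<dots> = F (hist t \<omega>) (H \<omega>) (obs2 t \<omega>) * G (H \<omega>) (obs1 \<omega>)"
      by (simp add: sum.delta)
    finally show "F (hist t \<omega>) (H \<omega>) (obs2 t \<omega>) * G (H \<omega>) (obs1 \<omega>) =
      (\<Sum>u\<in>HS t. \<Sum>h\<in>UNIV. indicator (event h) \<omega> * F u h (obs2 t \<omega>) * (hist_ind t u (obs1 \<omega>) * G h (obs1 \<omega>)))" ..
  qed
  also have "\<dots> = (\<Sum>u\<in>HS t. \<Sum>h\<in>UNIV. \<integral>\<^sup>+\<omega>. indicator (event h) \<omega> * F u h (obs2 t \<omega>) *
        (hist_ind t u (obs1 \<omega>) * G h (obs1 \<omega>)) \<partial>M)"
    by (subst nn_integral_sum, measurable, subst nn_integral_sum, measurable)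
  also have "\<dots> = (\<Sum>u\<in>HS t. \<Sum>h\<in>UNIV. (\<integral>\<^sup>+y. F u h y * lik t h y \<partial>obs_space t) *
      (\<integral>\<^sup>+\<omega>. indicator (event h) \<omega> * (hist_ind t u (obs1 \<omega>) * G h (obs1 \<omega>)) \<partial>M))"
    by (intro sum.cong refl factorize[OF _ _ t(1), of _ "\<lambda>x. hist_ind t _ x * G _ x"]) measurable
  finally show ?thesis .
qed

lemma dec_cong:
  assumes "\<And>r. r \<in> {1..s} \<Longrightarrow> y r = y' r" "\<And>r. r \<in> {1..<s} \<Longrightarrow> u r = u' r"
  shows "dec G y u s = dec G y' u' s"
proof -
  have "restrict y {1..s} = restrict y' {1..s}" "restrict u {1..<s} = restrict u' {1..<s}"
    using assms by (auto intro!: restrict_ext)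
  then show ?thesis by (simp add: dec_def history_def)
qed

lemma still_cong:
  assumes "\<And>r. r \<in> {1..<t} \<Longrightarrow> y r = y' r" "\<And>r. r \<in> {1..<t} \<Longrightarrow> u r = u' r"
  shows "still G y u t = still G y' u' t"
proof -
  have "dec G y u s = dec G y' u' s" if "s \<in> {1..<t}" for s
    using that assms by (intro dec_cong) auto
  then show ?thesis by (simp add: still_def)
qed

lemma dec_obs: "dec G (obs2 t \<omega>) (hist t \<omega>) t = dec G (\<lambda>s. Y2 s \<omega>) (B \<omega>) t"
  by (rule dec_cong) (auto simp: obs2_def hist_def)

lemma still_obs: "still G (obs2 t \<omega>) (hist t \<omega>) t = still G (\<lambda>s. Y2 s \<omega>) (B \<omega>) t"
  by (rule still_cong) (auto simp: obs2_def hist_def)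

lemma dec_measurable:
  assumes "is_policy T N2 G" "1 \<le> s" "s \<le> t" "t \<le> T"
  shows "(\<lambda>y. dec G y u s) \<in> measurable (obs_space t) (count_space UNIV)"
  unfolding dec_def history_def using assms(2-4)
  by (intro policy_measurable[OF assms(1)] measurable_restrict_subset) auto

lemma still_measurable:
  assumes "is_policy T N2 G" "t \<le> T"
  shows "Measurable.pred (obs_space t) (\<lambda>y. still G y u t)"
proof -
  have "Measurable.pred (obs_space t) (\<lambda>y. dec G y u s = Blank)" if "s \<in> {1..<t}" for s
  proof -
    have [measurable]: "(\<lambda>y. dec G y u s) \<in> measurable (obs_space t) (count_space UNIV)"
      using that assms(2) by (intro dec_measurable[OF assms(1)]) auto
    show ?thesis by measurable
  qed
  then show ?thesis
    unfolding still_def by (intro pred_intros_finite) auto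
qed

definition chosen :: "'b policy \<Rightarrow> nat \<Rightarrow> (nat \<Rightarrow> decision) \<Rightarrow> decision \<Rightarrow> (nat \<Rightarrow> 'b) \<Rightarrow> ennreal" where
  "chosen G t u v y = (if still G y u t \<and> dec G y u t = v then 1 else 0)"

lemma chosen_measurable:
  assumes "is_policy T N2 G" "1 \<le> t" "t \<le> T"
  shows "chosen G t u v \<in> borel_measurable (obs_space t)"
proof -
  have [measurable]: "(\<lambda>y. dec G y u t) \<in> measurable (obs_space t) (count_space UNIV)"
    "Measurable.pred (obs_space t) (\<lambda>y. still G y u t)"
    using assms by (auto intro: dec_measurable still_measurable)
  show ?thesis unfolding chosen_def by measurable
qed

text \<open>The whole path cost is charged at the time when observer 2 stops. This is possible
  because \<open>stop_cost\<close> covers what observer 1 does later.\<close>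

definition stage_cost :: "'b policy \<Rightarrow> nat \<Rightarrow> 'w \<Rightarrow> ennreal" where
  "stage_cost G t \<omega> = (\<Sum>d\<in>UNIV. chosen G t (hist t \<omega>) (Decide d) (obs2 t \<omega>) * stop_cost t d (H \<omega>) (obs1 \<omega>))"

text \<open>At most one summand is nonzero, the one at the first time \<open>t\<close> where
  \<open>G\<close> prescribes a verdict; there \<open>paths_of_stop\<close> replaces the actual
  paths by the counterfactual ones.\<close>

lemma cost_eq_sum_stage_cost:
  assumes pol: "is_policy T N2 G" and \<omega>: "\<omega> \<in> space M"
  shows "ennreal (path_cost K k J (U1 G1 G Y1 Y2 \<omega>) (U2 G1 G Y1 Y2 \<omega>) (H \<omega>)) = (\<Sum>t\<in>{1..T}. stage_cost G t \<omega>)"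
proof -
  let ?y = "\<lambda>s. Y2 s \<omega>"
  have ex: "\<exists>s. s \<in> {1..T} \<and> dec G ?y (B \<omega>) s \<noteq> Blank"
    using snd_run_stops[OF pol horizon, of ?y "B \<omega>"] Y2_in[OF \<omega>] by blast
  define t where "t = (LEAST s. s \<in> {1..T} \<and> dec G ?y (B \<omega>) s \<noteq> Blank)"
  have t: "t \<in> {1..T}" "dec G ?y (B \<omega>) t \<noteq> Blank"
    using LeastI_ex[OF ex] by (auto simp: t_def)
  have before: "dec G ?y (B \<omega>) s = Blank" if "s \<in> {1..<t}" for s
    using not_less_Least[of s "\<lambda>s. s \<in> {1..T} \<and> dec G ?y (B \<omega>) s \<noteq> Blank", folded t_def]
      that t(1) by auto
  obtain d where d: "dec G ?y (B \<omega>) t = Decide d" using t(2) by (cases "dec G ?y (B \<omega>) t") auto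
  have still_t: "still G ?y (B \<omega>) t" using before by (simp add: still_def)
  have chosen: "chosen G s (hist s \<omega>) (Decide e) (obs2 s \<omega>) = (if s = t \<and> e = d then 1 else 0)"
    if s: "s \<in> {1..T}" for s e
  proof -
    have "still G ?y (B \<omega>) s \<and> dec G ?y (B \<omega>) s = Decide e \<longleftrightarrow> s = t \<and> e = d"
    proof
      assume a: "still G ?y (B \<omega>) s \<and> dec G ?y (B \<omega>) s = Decide e"
      have "\<not> s < t" using a before[of s] s by auto
      moreover have "\<not> t < s" using a t d by (auto simp: still_def)
      ultimately show "s = t \<and> e = d" using a d by simp
    qed (use d still_t in auto)
    then show ?thesis unfolding chosen_def dec_obs still_obs by simp
  qed
  have "(\<Sum>s\<in>{1..T}. stage_cost G s \<omega>) =
      (\<Sum>s\<in>{1..T}. \<Sum>e\<in>UNIV. if s = t then (if e = d then stop_cost s e (H \<omega>) (obs1 \<omega>) else 0) else 0)"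
    unfolding stage_cost_def by (intro sum.cong refl) (simp add: chosen)
  also have "\<dots> = (\<Sum>s\<in>{1..T}. if s = t then stop_cost s d (H \<omega>) (obs1 \<omega>) else 0)"
    by (intro sum.cong refl) (simp add: sum.delta)
  also have "\<dots> = stop_cost t d (H \<omega>) (obs1 \<omega>)" using t(1) by (simp add: sum.delta)
  also have "\<dots> = ennreal (path_cost K k J (U1 G1 G Y1 Y2 \<omega>) (U2 G1 G Y1 Y2 \<omega>) (H \<omega>))"
    using paths_of_stop[of t G Y2 \<omega> G1 Y1 d] t d still_t
    by (simp add: stop_cost_def B_eq obs1_def stop_path_restrict)
  finally show ?thesis ..
qed

lemma stop_val_lik_measurable [measurable]:
  "(\<lambda>y. at_lik t y (stop_val t u d)) \<in> borel_measurable (obs_space t)"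
  unfolding stop_val_def by measurable

lemma V_lik_measurable:
  assumes "1 \<le> t" "t \<le> T" "u \<in> HS t"
  shows "(\<lambda>y. at_lik t y (V t u)) \<in> borel_measurable (obs_space t)"
  by (rule value_function.measurable_value[OF value_function_V[OF assms]]) auto

lemma W_lik_measurable:
  assumes "1 \<le> t" "t < T" "u \<in> HS t"
  shows "(\<lambda>y. at_lik t y (W t u)) \<in> borel_measurable (obs_space t)"
  by (rule value_function.measurable_value[OF value_function_W[OF assms]]) auto

lemma stage_cost_measurable:
  assumes pol: "is_policy T N2 G" and t: "1 \<le> t" "t \<le> T"
  shows "(\<lambda>\<omega>. chosen G t (hist t \<omega>) (Decide d) (obs2 t \<omega>) * stop_cost t d (H \<omega>) (obs1 \<omega>)) \<in> borel_measurable M"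
proof -
  have [measurable]: "(\<lambda>\<omega>. chosen G t (hist t \<omega>) (Decide d) (obs2 t \<omega>)) \<in> borel_measurable M"
    by (rule measurable_compose_countable'[where I = "HS t" and f = "\<lambda>u \<omega>. chosen G t u (Decide d) (obs2 t \<omega>)"])
       (use t in \<open>auto intro!: measurable_compose[OF obs2_measurable chosen_measurable] pol hist_measurable_M countable_finite\<close>)
  have [measurable]: "(\<lambda>\<omega>. stop_cost t d (H \<omega>) (obs1 \<omega>)) \<in> borel_measurable M"
    by (rule measurable_compose_countable'[OF _ H_measurable]) auto
  show ?thesis by measurable
qed

text \<open>By \<open>disintegration\<close> the observations of observer 1 integrate to
  \<open>C\<close>, while those of observer 2 leave the likelihoods; together they form
  \<open>stop_val\<close>.\<close>

lemma integral_stage_cost: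
  assumes pol: "is_policy T N2 G" and t: "1 \<le> t" "t \<le> T"
  shows "(\<integral>\<^sup>+\<omega>. stage_cost G t \<omega> \<partial>M) =
    (\<Sum>u\<in>HS t. \<integral>\<^sup>+y. (\<Sum>d\<in>UNIV. chosen G t u (Decide d) y * at_lik t y (stop_val t u d)) \<partial>obs_space t)"
proof -
  have [measurable]: "chosen G t u v \<in> borel_measurable (obs_space t)" for u v
    using chosen_measurable[OF assms] .
  have "(\<integral>\<^sup>+\<omega>. stage_cost G t \<omega> \<partial>M) =
      (\<Sum>d\<in>UNIV. \<integral>\<^sup>+\<omega>. chosen G t (hist t \<omega>) (Decide d) (obs2 t \<omega>) * stop_cost t d (H \<omega>) (obs1 \<omega>) \<partial>M)"
    unfolding stage_cost_def using stage_cost_measurable[OF assms] by (intro nn_integral_sum) auto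
  also have "\<dots> = (\<Sum>d\<in>UNIV. \<Sum>u\<in>HS t. \<Sum>h\<in>UNIV. (\<integral>\<^sup>+y. chosen G t u (Decide d) y * lik t h y \<partial>obs_space t) * C t u d h)"
    unfolding C_def
    by (intro sum.cong refl disintegration[OF t, of "\<lambda>u h. chosen G t u (Decide _)" "\<lambda>h. stop_cost t _ h"])
       (auto intro: stop_cost_measurable)
  also have "\<dots> = (\<Sum>u\<in>HS t. \<Sum>d\<in>UNIV. \<Sum>h\<in>UNIV. (\<integral>\<^sup>+y. chosen G t u (Decide d) y * lik t h y \<partial>obs_space t) * C t u d h)"
    by (rule sum.swap)
  also have "\<dots> = (\<Sum>u\<in>HS t. \<Sum>d\<in>UNIV. \<integral>\<^sup>+y. chosen G t u (Decide d) y * at_lik t y (stop_val t u d) \<partial>obs_space t)"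
  proof (intro sum.cong refl)
    fix u d
    have "(\<integral>\<^sup>+y. chosen G t u (Decide d) y * at_lik t y (stop_val t u d) \<partial>obs_space t) =
      (\<integral>\<^sup>+y. chosen G t u (Decide d) y * lik t H0 y * C t u d H0 + chosen G t u (Decide d) y * lik t H1 y * C t u d H1 \<partial>obs_space t)"
      by (intro nn_integral_cong) (simp add: stop_val_def distrib_left mult.assoc)
    also have "\<dots> = (\<Sum>h\<in>UNIV. (\<integral>\<^sup>+y. chosen G t u (Decide d) y * lik t h y \<partial>obs_space t) * C t u d h)"
      by (subst nn_integral_add) (auto simp: sum_hyp nn_integral_multc)
    finally show "(\<Sum>h\<in>UNIV. (\<integral>\<^sup>+y. chosen G t u (Decide d) y * lik t h y \<partial>obs_space t) * C t u d h) =
      (\<integral>\<^sup>+y. chosen G t u (Decide d) y * at_lik t y (stop_val t u d) \<partial>obs_space t)" ..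
  qed
  also have "\<dots> = (\<Sum>u\<in>HS t. \<integral>\<^sup>+y. (\<Sum>d\<in>UNIV. chosen G t u (Decide d) y * at_lik t y (stop_val t u d)) \<partial>obs_space t)"
    by (intro sum.cong refl nn_integral_sum[symmetric]) measurable
  finally show ?thesis .
qed

text \<open>Optimal cost from \<open>t\<close> on, over the event that \<open>G\<close> has been
  silent so far. Only the past of \<open>G\<close> enters, its future being replaced by the optimal
  value.\<close>

definition remaining :: "'b policy \<Rightarrow> nat \<Rightarrow> ennreal" where
  "remaining G t = (\<Sum>u\<in>HS t. \<integral>\<^sup>+y. (if still G y u t then 1 else 0) * at_lik t y (V t u) \<partial>obs_space t)"

lemma sum_HS_Suc:
  assumes "1 \<le> t"
  shows "(\<Sum>u\<in>HS (Suc t). g u) = (\<Sum>u\<in>HS t. \<Sum>x\<in>UNIV. g (u(t := x)))"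
proof -
  have "(\<Sum>u\<in>HS t. \<Sum>x\<in>UNIV. g (u(t := x))) = (\<Sum>p\<in>HS t \<times> UNIV. g ((fst p)(t := snd p)))"
    by (simp add: sum.cartesian_product case_prod_beta)
  also have "\<dots> = (\<Sum>u\<in>HS (Suc t). g u)"
  proof (rule sum.reindex_bij_betw[of "\<lambda>p. (fst p)(t := snd p)"])
    show "bij_betw (\<lambda>p. (fst p)(t := snd p)) (HS t \<times> UNIV) (HS (Suc t))"
    proof (rule bij_betw_byWitness[where f' = "\<lambda>u. (restrict u {1..<t}, u t)"])
      show "\<forall>p\<in>HS t \<times> UNIV. (restrict ((fst p)(t := snd p)) {1..<t}, ((fst p)(t := snd p)) t) = p"
      proof
        fix p assume "p \<in> HS t \<times> (UNIV :: decision set)"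
        then have "restrict (fst p) {1..<t} = fst p" by (auto simp: HS_def PiE_iff extensional_restrict)
        moreover have "restrict ((fst p)(t := snd p)) {1..<t} = restrict (fst p) {1..<t}"
          by (rule restrict_ext) auto
        ultimately show "(restrict ((fst p)(t := snd p)) {1..<t}, ((fst p)(t := snd p)) t) = p" by simp
      qed
      show "\<forall>u\<in>HS (Suc t). (fst (restrict u {1..<t}, u t))(t := snd (restrict u {1..<t}, u t)) = u"
        using assms by (auto simp: HS_def PiE_iff extensional_def restrict_def fun_eq_iff)
      show "(\<lambda>p. (fst p)(t := snd p)) ` (HS t \<times> UNIV) \<subseteq> HS (Suc t)"
        using extend_HS[OF assms] by auto
    qed auto
  qed
  finally show ?thesis ..
qed

lemma lik_Suc: "lik (Suc t) h (y(Suc t := z)) = lik t h y * dens (Suc t) h z"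
proof -
  have "(\<Prod>s\<in>{1..t}. dens s h ((y(Suc t := z)) s)) = (\<Prod>s\<in>{1..t}. dens s h (y s))"
    by (intro prod.cong) auto
  then show ?thesis by (simp add: lik_def atLeastAtMostSuc_conv mult.commute)
qed

text \<open>The newest observation can be integrated out first, because \<open>still\<close> at
  \<open>Suc t\<close> concerns only the first \<open>t\<close> observations and the decisions of
  observer 1 before \<open>t\<close>. Summing over the decision of observer 1 at \<open>t\<close>
  then produces \<open>W\<close>.\<close>

lemma remaining_Suc:
  assumes pol: "is_policy T N2 G" and t: "1 \<le> t" "t < T"
  shows "remaining G (Suc t) = (\<Sum>u\<in>HS t. \<integral>\<^sup>+y. chosen G t u Blank y * at_lik t y (W t u) \<partial>obs_space t)"
proof -
  interpret P: product_sigma_finite "\<lambda>_::nat. N2" using ref2 by (simp add: product_sigma_finite_def)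
  have one: "(\<integral>\<^sup>+y. (if still G y (u(t := x)) (Suc t) then 1 else 0) *
        V (Suc t) (u(t := x)) (lik (Suc t) H0 y) (lik (Suc t) H1 y) \<partial>obs_space (Suc t)) =
      (\<integral>\<^sup>+y. chosen G t u Blank y * (\<integral>\<^sup>+z. V (Suc t) (u(t := x)) (lik t H0 y * dens (Suc t) H0 z)
         (lik t H1 y * dens (Suc t) H1 z) \<partial>N2) \<partial>obs_space t)"
    if u: "u \<in> HS t" for u x
  proof -
    have u': "u(t := x) \<in> HS (Suc t)" using t(1) u by (rule extend_HS)
    have vf: "value_function (D * Q (Suc t) (u(t := x)) H0) (D * Q (Suc t) (u(t := x)) H1) (V (Suc t) (u(t := x)))"
      using t u' by (intro value_function_V) auto
    have [measurable]: "Measurable.pred (obs_space (Suc t)) (\<lambda>y. still G y (u(t := x)) (Suc t))"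
      using t by (intro still_measurable pol) auto
    have [measurable]: "(\<lambda>y. V (Suc t) (u(t := x)) (lik (Suc t) H0 y) (lik (Suc t) H1 y)) \<in> borel_measurable (obs_space (Suc t))"
      using t u' by (intro V_lik_measurable) auto
    have [measurable]: "(\<lambda>z. V (Suc t) (u(t := x)) (a * dens (Suc t) H0 z) (b * dens (Suc t) H1 z)) \<in> borel_measurable N2" for a b
      by (rule value_function.measurable_value[OF vf]) auto
    have ins: "{1..Suc t} = insert (Suc t) {1..t}" by auto
    have meas: "(\<lambda>y. (if still G y (u(t := x)) (Suc t) then 1 else 0) *
        V (Suc t) (u(t := x)) (lik (Suc t) H0 y) (lik (Suc t) H1 y)) \<in> borel_measurable (PiM (insert (Suc t) {1..t}) (\<lambda>_. N2))"
      unfolding ins[symmetric] by measurable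
    have "(\<integral>\<^sup>+y. (if still G y (u(t := x)) (Suc t) then 1 else 0) *
        V (Suc t) (u(t := x)) (lik (Suc t) H0 y) (lik (Suc t) H1 y) \<partial>obs_space (Suc t)) =
      (\<integral>\<^sup>+y. \<integral>\<^sup>+z. (if still G (y(Suc t := z)) (u(t := x)) (Suc t) then 1 else 0) *
        V (Suc t) (u(t := x)) (lik (Suc t) H0 (y(Suc t := z))) (lik (Suc t) H1 (y(Suc t := z))) \<partial>N2 \<partial>obs_space t)"
      unfolding ins by (rule P.product_nn_integral_insert[OF _ _ meas]) auto
    also have "\<dots> = (\<integral>\<^sup>+y. \<integral>\<^sup>+z. chosen G t u Blank y *
        V (Suc t) (u(t := x)) (lik t H0 y * dens (Suc t) H0 z) (lik t H1 y * dens (Suc t) H1 z) \<partial>N2 \<partial>obs_space t)"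
    proof (intro nn_integral_cong)
      fix y z
      have "still G (y(Suc t := z)) (u(t := x)) (Suc t) \<longleftrightarrow> still G y u (Suc t)"
        unfolding still_def
      proof (intro ball_cong refl)
        fix s assume "s \<in> {1..<Suc t}"
        then have "dec G (y(Suc t := z)) (u(t := x)) s = dec G y u s" by (intro dec_cong) auto
        then show "(dec G (y(Suc t := z)) (u(t := x)) s = Blank) = (dec G y u s = Blank)" by simp
      qed
      also have "\<dots> \<longleftrightarrow> still G y u t \<and> dec G y u t = Blank" using t by (simp add: still_Suc)
      finally show "(if still G (y(Suc t := z)) (u(t := x)) (Suc t) then 1 else 0) *
        V (Suc t) (u(t := x)) (lik (Suc t) H0 (y(Suc t := z))) (lik (Suc t) H1 (y(Suc t := z))) =
        chosen G t u Blank y * V (Suc t) (u(t := x)) (lik t H0 y * dens (Suc t) H0 z) (lik t H1 y * dens (Suc t) H1 z)"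
        by (simp add: chosen_def lik_Suc)
    qed
    also have "\<dots> = (\<integral>\<^sup>+y. chosen G t u Blank y * (\<integral>\<^sup>+z. V (Suc t) (u(t := x)) (lik t H0 y * dens (Suc t) H0 z)
         (lik t H1 y * dens (Suc t) H1 z) \<partial>N2) \<partial>obs_space t)"
      by (intro nn_integral_cong nn_integral_cmult) measurable
    finally show ?thesis .
  qed
  have "remaining G (Suc t) = (\<Sum>u\<in>HS t. \<Sum>x\<in>UNIV. \<integral>\<^sup>+y. chosen G t u Blank y *
      (\<integral>\<^sup>+z. V (Suc t) (u(t := x)) (lik t H0 y * dens (Suc t) H0 z) (lik t H1 y * dens (Suc t) H1 z) \<partial>N2) \<partial>obs_space t)"
    unfolding remaining_def sum_HS_Suc[OF t(1)] by (intro sum.cong refl one)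
  also have "\<dots> = (\<Sum>u\<in>HS t. \<integral>\<^sup>+y. chosen G t u Blank y * at_lik t y (W t u) \<partial>obs_space t)"
  proof (intro sum.cong refl)
    fix u assume u: "u \<in> HS t"
    have [measurable]: "chosen G t u Blank \<in> borel_measurable (obs_space t)"
      using t by (intro chosen_measurable pol) auto
    have [measurable]: "(\<lambda>y. \<integral>\<^sup>+z. V (Suc t) (u(t := x)) (lik t H0 y * dens (Suc t) H0 z)
        (lik t H1 y * dens (Suc t) H1 z) \<partial>N2) \<in> borel_measurable (obs_space t)" for x
    proof (rule sigma_finite_measure.borel_measurable_nn_integral[OF ref2])
      have vf: "value_function (D * Q (Suc t) (u(t := x)) H0) (D * Q (Suc t) (u(t := x)) H1) (V (Suc t) (u(t := x)))"
        using t u by (intro value_function_V extend_HS) auto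
      show "(\<lambda>(y, z). V (Suc t) (u(t := x)) (lik t H0 y * dens (Suc t) H0 z) (lik t H1 y * dens (Suc t) H1 z))
          \<in> borel_measurable (obs_space t \<Otimes>\<^sub>M N2)"
        unfolding case_prod_beta by (rule value_function.measurable_value[OF vf]) measurable
    qed
    show "(\<Sum>x\<in>UNIV. \<integral>\<^sup>+y. chosen G t u Blank y *
        (\<integral>\<^sup>+z. V (Suc t) (u(t := x)) (lik t H0 y * dens (Suc t) H0 z) (lik t H1 y * dens (Suc t) H1 z) \<partial>N2) \<partial>obs_space t) =
      (\<integral>\<^sup>+y. chosen G t u Blank y * at_lik t y (W t u) \<partial>obs_space t)"
      unfolding W_def sum_distrib_left by (rule nn_integral_sum[symmetric]) measurable
  qed
  finally show ?thesis .
qed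

text \<open>At the horizon a blank is not admissible; the value \<open>0\<close> assigned to it is junk.\<close>

definition choice_val :: "nat \<Rightarrow> (nat \<Rightarrow> decision) \<Rightarrow> decision \<Rightarrow> ennreal \<Rightarrow> ennreal \<Rightarrow> ennreal" where
  "choice_val t u v a b = (case v of Decide d \<Rightarrow> stop_val t u d a b | Blank \<Rightarrow> if t < T then W t u a b else 0)"

text \<open>Splitting by what \<open>G\<close> plays at \<open>t\<close>: a verdict contributes to
  \<open>stage_cost\<close>, a blank passes its mass on to \<open>remaining\<close> at
  \<open>Suc t\<close>.\<close>

lemma stage_decomposition:
  assumes pol: "is_policy T N2 G" and t: "1 \<le> t" "t \<le> T"
  shows "(\<Sum>u\<in>HS t. \<integral>\<^sup>+y. (if still G y u t then 1 else 0) *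
      at_lik t y (choice_val t u (dec G y u t)) \<partial>obs_space t) =
    (\<integral>\<^sup>+\<omega>. stage_cost G t \<omega> \<partial>M) + (if t < T then remaining G (Suc t) else 0)"
proof -
  have [measurable]: "chosen G t u v \<in> borel_measurable (obs_space t)" for u v
    using chosen_measurable[OF assms] .
  let ?W = "\<lambda>u y. if t < T then at_lik t y (W t u) else 0"
  have "(\<Sum>u\<in>HS t. \<integral>\<^sup>+y. (if still G y u t then 1 else 0) *
      at_lik t y (choice_val t u (dec G y u t)) \<partial>obs_space t) =
    (\<Sum>u\<in>HS t. \<integral>\<^sup>+y. (\<Sum>d\<in>UNIV. chosen G t u (Decide d) y * at_lik t y (stop_val t u d)) +
      chosen G t u Blank y * ?W u y \<partial>obs_space t)"
  proof (intro sum.cong refl nn_integral_cong)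
    fix u y
    show "(if still G y u t then 1 else 0) * at_lik t y (choice_val t u (dec G y u t)) =
      (\<Sum>d\<in>UNIV. chosen G t u (Decide d) y * at_lik t y (stop_val t u d)) + chosen G t u Blank y * ?W u y"
    proof (cases "dec G y u t")
      case (Decide d)
      then show ?thesis by (cases d) (auto simp: chosen_def choice_val_def sum_hyp)
    qed (auto simp: chosen_def choice_val_def sum_hyp)
  qed
  also have "\<dots> = (\<Sum>u\<in>HS t. (\<integral>\<^sup>+y. (\<Sum>d\<in>UNIV. chosen G t u (Decide d) y * at_lik t y (stop_val t u d)) \<partial>obs_space t) +
      (\<integral>\<^sup>+y. chosen G t u Blank y * ?W u y \<partial>obs_space t))"
  proof (intro sum.cong refl nn_integral_add)
    fix u assume "u \<in> HS t"
    then show "(\<lambda>y. chosen G t u Blank y * ?W u y) \<in> borel_measurable (obs_space t)"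
      using W_lik_measurable[OF t(1)] by (cases "t < T") auto
  qed measurable
  also have "\<dots> = (\<integral>\<^sup>+\<omega>. stage_cost G t \<omega> \<partial>M) + (if t < T then remaining G (Suc t) else 0)"
    unfolding sum.distrib integral_stage_cost[OF assms]
    by (cases "t < T") (simp_all add: remaining_Suc[OF pol t(1)])
  finally show ?thesis .
qed

lemma V_le_choice_val:
  assumes "t < T \<or> (t = T \<and> v \<noteq> Blank)"
  shows "V t u a b \<le> choice_val t u v a b"
proof (cases v)
  case Blank
  then show ?thesis using assms by (auto simp: V_less choice_val_def)
next
  case (Decide d)
  then show ?thesis using assms
    by (cases d) (auto simp: V_less V_T choice_val_def min.coboundedI1 min.coboundedI2)
qed

lemma dec_final:
  assumes "is_policy T N2 G" "y \<in> space (obs_space T)"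
  shows "dec G y u T \<noteq> Blank"
  using assms history_in_space[of T y N2] by (auto simp: is_policy_def dec_def space_PiM PiE_iff)

section \<open>Verification: no policy beats the recursion\<close>

definition total_cost :: "'b policy \<Rightarrow> ennreal" where
  "total_cost G = (\<Sum>t\<in>{1..T}. \<integral>\<^sup>+\<omega>. stage_cost G t \<omega> \<partial>M)"

lemma telescope:
  fixes R c :: "nat \<Rightarrow> ennreal"
  assumes "\<And>t. 1 \<le> t \<Longrightarrow> t \<le> n \<Longrightarrow> R t \<le> c t + (if t < n then R (Suc t) else 0)" "1 \<le> t" "t \<le> n"
  shows "R t \<le> (\<Sum>s\<in>{t..n}. c s)"
  using assms(3,2)
proof (induction rule: inc_induct)
  case base
  then show ?case using assms(1)[of n] by simp
next
  case (step m)
  have "R m \<le> c m + R (Suc m)" using assms(1)[of m] step by simp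
  also have "\<dots> \<le> c m + (\<Sum>s\<in>{Suc m..n}. c s)" using step by (intro add_left_mono) auto
  also have "\<dots> = (\<Sum>s\<in>{m..n}. c s)" using step.hyps by (simp add: sum.atLeast_Suc_atMost)
  finally show ?case .
qed

lemma telescope_eq:
  fixes R c :: "nat \<Rightarrow> ennreal"
  assumes "\<And>t. 1 \<le> t \<Longrightarrow> t \<le> n \<Longrightarrow> R t = c t + (if t < n then R (Suc t) else 0)" "1 \<le> t" "t \<le> n"
  shows "R t = (\<Sum>s\<in>{t..n}. c s)"
  using assms(3,2)
proof (induction rule: inc_induct)
  case base
  then show ?case using assms(1)[of n] by simp
next
  case (step m)
  then show ?case using assms(1)[of m] by (simp add: sum.atLeast_Suc_atMost[of m n])
qed

text \<open>Before time 1 every policy is silent, so the right-hand side does not mention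
  \<open>G\<close>: it is the common optimal value.\<close>

lemma remaining_1: "remaining G 1 = (\<Sum>u\<in>HS 1. \<integral>\<^sup>+y. V 1 u (lik 1 H0 y) (lik 1 H1 y) \<partial>obs_space 1)"
  unfolding remaining_def by (simp add: still_def)

text \<open>\<open>V\<close> is a minimum over the choices, so putting it in place of the choice of
  \<open>G\<close> can only lower each stage. At the horizon \<open>dec_final\<close> excludes the
  blank with its junk value.\<close>

lemma total_cost_lower_bound:
  assumes pol: "is_policy T N2 G"
  shows "remaining G 1 \<le> total_cost G"
  unfolding total_cost_def
proof (rule telescope)
  fix t assume t: "1 \<le> t" "t \<le> T"
  show "remaining G t \<le> (\<integral>\<^sup>+\<omega>. stage_cost G t \<omega> \<partial>M) + (if t < T then remaining G (Suc t) else 0)"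
    unfolding remaining_def[of _ t] stage_decomposition[OF pol t, symmetric]
  proof (intro sum_mono nn_integral_mono mult_left_mono V_le_choice_val)
    fix u y assume "y \<in> space (obs_space t)"
    then show "t < T \<or> (t = T \<and> dec G y u t \<noteq> Blank)"
      using t dec_final[OF pol] by (cases "t < T") auto
  qed auto
qed (use horizon in auto)

lemma total_cost_attained:
  assumes pol: "is_policy T N2 G"
    and opt: "\<And>t u y. 1 \<le> t \<Longrightarrow> t \<le> T \<Longrightarrow> u \<in> HS t \<Longrightarrow> y \<in> space (obs_space t) \<Longrightarrow>
      at_lik t y (choice_val t u (dec G y u t)) = at_lik t y (V t u)"
  shows "total_cost G = remaining G 1"
  unfolding total_cost_def
proof (rule telescope_eq[symmetric])
  fix t assume t: "1 \<le> t" "t \<le> T"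
  show "remaining G t = (\<integral>\<^sup>+\<omega>. stage_cost G t \<omega> \<partial>M) + (if t < T then remaining G (Suc t) else 0)"
    unfolding remaining_def[of _ t] stage_decomposition[OF pol t, symmetric]
    by (intro sum.cong refl nn_integral_cong) (simp add: opt[OF t])
qed (use horizon in auto)

lemma U_stops:
  assumes pol: "is_policy T N2 G" and \<omega>: "\<omega> \<in> space M"
  shows "\<exists>s\<in>{1..T}. U1 G1 G Y1 Y2 \<omega> s \<noteq> Blank" "\<exists>s\<in>{1..T}. U2 G1 G Y1 Y2 \<omega> s \<noteq> Blank"
proof -
  have "\<exists>s\<in>{1..T}. fst (run G1 G (\<lambda>s. Y1 s \<omega>) (\<lambda>s. Y2 s \<omega>) T) s \<noteq> Blank"
    using Y1_in[OF \<omega>] by (intro fst_run_stops[OF policy1 horizon])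
  then show "\<exists>s\<in>{1..T}. U1 G1 G Y1 Y2 \<omega> s \<noteq> Blank"
    unfolding U1_def using run_stable(1)[of G1 G "\<lambda>s. Y1 s \<omega>" "\<lambda>s. Y2 s \<omega>" T] by auto
  show "\<exists>s\<in>{1..T}. U2 G1 G Y1 Y2 \<omega> s \<noteq> Blank"
  proof (rule ccontr)
    assume "\<not> ?thesis"
    then have "active (U2 G1 G Y1 Y2 \<omega>) (Suc T)" by (auto simp: active_def)
    then have "still G (\<lambda>s. Y2 s \<omega>) (silent_path G1 (\<lambda>s. Y1 s \<omega>)) (Suc T)"
      using active_iff_still[of "Suc T" G1 G Y1 Y2 \<omega>] by simp
    then show False
      using snd_run_stops[OF pol horizon, of "\<lambda>s. Y2 s \<omega>"] Y2_in[OF \<omega>] by (fastforce simp: still_def)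
  qed
qed

text \<open>Finiteness matters for comparing policies, as \<open>enn2real\<close> sends top to 0.
  Measurability of the path cost is inherited from its decomposition into stage costs.\<close>

lemma exp_cost_eq:
  assumes pol: "is_policy T N2 G"
  shows "exp_cost M H Y1 Y2 K k J G1 G = enn2real (total_cost G)" "total_cost G < top"
proof -
  let ?c = "\<lambda>\<omega>. path_cost K k J (U1 G1 G Y1 Y2 \<omega>) (U2 G1 G Y1 Y2 \<omega>) (H \<omega>)"
  have meas_t: "stage_cost G t \<in> borel_measurable M" if "t \<in> {1..T}" for t
    unfolding stage_cost_def[abs_def] using stage_cost_measurable[OF pol] that by (intro borel_measurable_sum) auto
  note stops = U_stops[OF pol]
  have c_sum: "ennreal (?c \<omega>) = (\<Sum>t\<in>{1..T}. stage_cost G t \<omega>)" if "\<omega> \<in> space M" for \<omega>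
    using cost_eq_sum_stage_cost[OF pol that] .
  have c0: "0 \<le> ?c \<omega>" if "\<omega> \<in> space M" for \<omega>
    using path_cost_nonneg[OF costs J_nonneg stops[OF that]] .
  have total: "total_cost G = (\<integral>\<^sup>+\<omega>. ennreal (?c \<omega>) \<partial>M)"
    unfolding total_cost_def
    by (subst nn_integral_sum[symmetric]) (auto simp: meas_t c_sum intro!: nn_integral_cong)
  have "(\<lambda>\<omega>. \<Sum>t\<in>{1..T}. stage_cost G t \<omega>) \<in> borel_measurable M"
    using meas_t by (intro borel_measurable_sum)
  then have "(\<lambda>\<omega>. enn2real (\<Sum>t\<in>{1..T}. stage_cost G t \<omega>)) \<in> borel_measurable M" by measurable
  moreover have "?c \<omega> = enn2real (\<Sum>t\<in>{1..T}. stage_cost G t \<omega>)" if "\<omega> \<in> space M" for \<omega>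
    using c0[OF that] c_sum[OF that] by (metis enn2real_ennreal)
  ultimately have meas: "?c \<in> borel_measurable M" by (simp cong: measurable_cong)
  show "exp_cost M H Y1 Y2 K k J G1 G = enn2real (total_cost G)"
    unfolding exp_cost_def total using c0 meas by (intro integral_eq_nn_integral) auto
  have "total_cost G \<le> (\<integral>\<^sup>+\<omega>. D \<partial>M)"
    unfolding total D_def
    by (intro nn_integral_mono ennreal_leI path_cost_le[OF costs J_nonneg stops])
  also have "\<dots> < top" using D_finite by (simp add: emeasure_space_1)
  finally show "total_cost G < top" .
qed

theorem optimality:
  assumes pol: "is_policy T N2 G"
    and opt: "\<And>t u y. 1 \<le> t \<Longrightarrow> t \<le> T \<Longrightarrow> u \<in> HS t \<Longrightarrow> y \<in> space (obs_space t) \<Longrightarrow>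
      at_lik t y (choice_val t u (dec G y u t)) = at_lik t y (V t u)"
    and pol': "is_policy T N2 G'"
  shows "exp_cost M H Y1 Y2 K k J G1 G \<le> exp_cost M H Y1 Y2 K k J G1 G'"
proof -
  have "total_cost G = remaining G' 1"
    using total_cost_attained[OF pol opt] by (simp add: remaining_1[of G] remaining_1[of G'])
  also have "\<dots> \<le> total_cost G'" by (rule total_cost_lower_bound[OF pol'])
  finally show ?thesis
    unfolding exp_cost_eq(1)[OF pol] exp_cost_eq(1)[OF pol'] using exp_cost_eq(2)[OF pol'] by (intro enn2real_mono)
qed

end

section \<open>The optimal policy\<close>

lemma ennreal_add_min: "(c::ennreal) + min a b = min (c + a) (c + b)"
  by (cases "a \<le> b") (auto simp: min_def add_left_mono intro!: antisym)

lemma accept_rule_optimal: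
  "(case accept_rule (s H1) (s H0) w of Decide d \<Rightarrow> s d | Blank \<Rightarrow> w) = min (min (s H0) (s H1)) w"
  for s :: "hyp \<Rightarrow> ennreal"
  by (auto simp: accept_rule_def min_def)

lemma message_rule_optimal:
  "(case message_rule H1 H0 (s H1) (s H0) w of Decide d \<Rightarrow> s d | Blank \<Rightarrow> w) = min (min (s H0) (s H1)) w"
  "(case message_rule H0 H1 (s H0) (s H1) w of Decide d \<Rightarrow> s d | Blank \<Rightarrow> w) = min (min (s H0) (s H1)) w"
  for s :: "hyp \<Rightarrow> ennreal"
  by (auto simp: message_rule_def min_def)

lemma accept_rule_measurable:
  fixes f g w :: "'c \<Rightarrow> ennreal"
  assumes [measurable]: "f \<in> borel_measurable N" "g \<in> borel_measurable N" "w \<in> borel_measurable N"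
  shows "(\<lambda>y. accept_rule (f y) (g y) (w y)) \<in> measurable N (count_space UNIV)"
  unfolding accept_rule_def by measurable

lemma message_rule_measurable:
  fixes f g w :: "'c \<Rightarrow> ennreal"
  assumes [measurable]: "f \<in> borel_measurable N" "g \<in> borel_measurable N" "w \<in> borel_measurable N"
  shows "(\<lambda>y. message_rule lo hi (f y) (g y) (w y)) \<in> measurable N (count_space UNIV)"
  unfolding message_rule_def by measurable

context detection_problem
begin

section \<open>After the stop of observer 1: detection by observer 2 alone\<close>

definition stopped :: "nat \<Rightarrow> (nat \<Rightarrow> decision) \<Rightarrow> bool" where
  "stopped t u \<longleftrightarrow> (\<exists>s\<in>{1..<t}. u s \<noteq> Blank)"

text \<open>The default \<open>t\<close> is meant for \<open>t = T\<close>: an observer 1 that has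
  not stopped earlier must stop then.\<close>

definition first_stop :: "nat \<Rightarrow> (nat \<Rightarrow> decision) \<Rightarrow> nat" where
  "first_stop t u = (if stopped t u then stop_time u else t)"

text \<open>Waiting cost accrued up to \<open>t\<close>: rate \<open>K\<close> until the first stop,
  rate \<open>k\<close> from then on.\<close>

definition sunk :: "nat \<Rightarrow> (nat \<Rightarrow> decision) \<Rightarrow> ennreal" where
  "sunk t u = ennreal (K * (real (first_stop t u) - 1) + k * (real t - real (first_stop t u)))"

lemma first_stop_bounds: "1 \<le> t \<Longrightarrow> 1 \<le> first_stop t u \<and> first_stop t u \<le> t"
  using stop_time_less[of t u] by (cases "stopped t u") (auto simp: first_stop_def stopped_def[symmetric])

text \<open>Before \<open>t\<close> the path agrees with the silent one, so an earlier stop is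
  unaffected by the message. If there is none and \<open>t = T\<close>, observer 1 is forced to stop
  at \<open>T\<close>, simultaneously with observer 2.\<close>

lemma stop_time_stop_path:
  assumes x: "x \<in> space seq_space" and t: "t \<in> {1..T}"
    and u: "restrict (silent_path G1 x) {1..<t} = u" and "stopped t u \<or> t = T"
  shows "stop_time (stop_path G1 t d x) = first_stop t u"
proof -
  have before: "stop_path G1 t d x s = u s" if "s \<in> {1..<t}" for s
    using stop_path_before[of t s G1 d x] that t unfolding u[symmetric] by auto
  show ?thesis
  proof (cases "stopped t u")
    case True
    then show ?thesis
      using stop_time_cong[of t u "stop_path G1 t d x"] before by (simp add: first_stop_def stopped_def)
  next
    case False
    with assms have "t = T" by simp
    obtain s where s: "s \<in> {1..T}" "stop_path G1 t d x s \<noteq> Blank"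
      using path_stops(1)[of T N1 G1 x t d] policy1 horizon seq_space_in[OF x] by blast
    have "s = T" using s before[of s] False \<open>t = T\<close> by (force simp: stopped_def)
    have "stop_time (stop_path G1 t d x) = t"
    proof (rule stop_time_eqI)
      show "stop_path G1 t d x r = Blank" if "r \<in> {1..<t}" for r
        using before[OF that] False that by (auto simp: stopped_def)
    qed (use s t \<open>s = T\<close> \<open>t = T\<close> in auto)
    then show ?thesis using False by (simp add: first_stop_def)
  qed
qed

lemma stop_cost_stopped:
  assumes x: "x \<in> space seq_space" and t: "t \<in> {1..T}"
    and u: "restrict (silent_path G1 x) {1..<t} = u" and "stopped t u \<or> t = T"
  shows "stop_cost t d h x = sunk t u + ennreal (J d h)"
proof -
  have fs: "1 \<le> first_stop t u" "first_stop t u \<le> t" using first_stop_bounds[of t u] t by auto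
  have st: "stop_time (stop_path G1 t d x) = first_stop t u" by (rule stop_time_stop_path[OF assms])
  have "stop_cost t d h x =
      ennreal (K * (real (first_stop t u) - 1) + k * (real t - real (first_stop t u)) + J d h)"
    unfolding stop_cost_def using fs st by (subst path_cost_second_last) auto
  also have "\<dots> = sunk t u + ennreal (J d h)"
    unfolding sunk_def using fs costs J_nonneg by (intro ennreal_plus add_nonneg_nonneg mult_nonneg_nonneg) auto
  finally show ?thesis .
qed

text \<open>Observer 1 has no reaction left, so the cost is constant on the event of
  \<open>u\<close> and its integral is a product with \<open>Q\<close>.\<close>

lemma C_stopped:
  assumes t: "t \<in> {1..T}" and "stopped t u \<or> t = T"
  shows "C t u d h = Q t u h * (sunk t u + ennreal (J d h))"
proof -
  have "C t u d h = (\<integral>\<^sup>+\<omega>. indicator (event h) \<omega> * hist_ind t u (obs1 \<omega>) * (sunk t u + ennreal (J d h)) \<partial>M)"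
    unfolding C_def
  proof (rule nn_integral_cong)
    fix \<omega> assume "\<omega> \<in> space M"
    then show "indicator (event h) \<omega> * (hist_ind t u (obs1 \<omega>) * stop_cost t d h (obs1 \<omega>)) =
        indicator (event h) \<omega> * hist_ind t u (obs1 \<omega>) * (sunk t u + ennreal (J d h))"
      using stop_cost_stopped[OF obs1_in t _ assms(2)] by (simp add: hist_ind_def)
  qed
  also have "\<dots> = Q t u h * (sunk t u + ennreal (J d h))"
    unfolding Q_def using t by (intro nn_integral_multc) auto
  finally show ?thesis .
qed

definition final_val :: "hyp \<Rightarrow> ennreal \<Rightarrow> ennreal \<Rightarrow> ennreal" where
  "final_val d a b = a * ennreal (J d H0) + b * ennreal (J d H1)"

lemma stop_val_stopped:
  assumes "t \<in> {1..T}" and "stopped t u \<or> t = T"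
  shows "stop_val t u d a b =
    sunk t u * (Q t u H0 * a + Q t u H1 * b) + final_val d (Q t u H0 * a) (Q t u H1 * b)"
  unfolding stop_val_def final_val_def C_stopped[OF assms] by (simp add: distrib_left mult_ac add_ac)

text \<open>The classical one-observer sequential problem with cost \<open>k\<close> per step,
  charged on the total weight \<open>a + b\<close>. Unlike in \<open>val_to_go\<close>, the
  arguments are joint weights with \<open>Q\<close> already included.\<close>

primrec solo_val_to_go :: "nat \<Rightarrow> ennreal \<Rightarrow> ennreal \<Rightarrow> ennreal" where
  "solo_val_to_go 0 a b = min (final_val H0 a b) (final_val H1 a b)"
| "solo_val_to_go (Suc n) a b = min (min (final_val H0 a b) (final_val H1 a b))
     (a * ennreal k + b * ennreal k + (\<integral>\<^sup>+y. solo_val_to_go n (a * dens (T - n) H0 y) (b * dens (T - n) H1 y) \<partial>N2))"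

definition solo_V :: "nat \<Rightarrow> ennreal \<Rightarrow> ennreal \<Rightarrow> ennreal" where
  "solo_V t = solo_val_to_go (T - t)"

definition solo_W :: "nat \<Rightarrow> ennreal \<Rightarrow> ennreal \<Rightarrow> ennreal" where
  "solo_W t a b = a * ennreal k + b * ennreal k +
     (\<integral>\<^sup>+y. solo_V (Suc t) (a * dens (Suc t) H0 y) (b * dens (Suc t) H1 y) \<partial>N2)"

lemma solo_V_T: "solo_V T a b = min (final_val H0 a b) (final_val H1 a b)"
  by (simp add: solo_V_def)

lemma solo_V_less:
  assumes "t < T"
  shows "solo_V t a b = min (min (final_val H0 a b) (final_val H1 a b)) (solo_W t a b)"
proof -
  define n where "n = T - Suc t"
  have n: "T - t = Suc n" "T - n = Suc t" "T - Suc t = n" using assms by (auto simp: n_def)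
  show ?thesis unfolding solo_V_def solo_W_def n by (simp add: n)
qed

lemma J_le: "J u h \<le> (\<Sum>u\<in>UNIV. \<Sum>h\<in>UNIV. J u h)"
  using J_nonneg by (cases u; cases h) (auto simp: sum_hyp)

lemma value_function_final_val:
  assumes "ennreal (\<Sum>u\<in>UNIV. \<Sum>h\<in>UNIV. J u h) \<le> c"
  shows "value_function c c (final_val d)"
  unfolding final_val_def[abs_def]
  by (intro value_function_affine order_trans[OF _ assms] ennreal_leI J_le)

lemma value_function_solo_W_step:
  assumes "value_function c c (solo_V (Suc t))"
  shows "value_function (ennreal k + c) (ennreal k + c) (solo_W t)"
  unfolding solo_W_def[abs_def]
  by (intro value_function_add value_function_affine value_function_integral assms ref2
    dens_measurable dens_integral order_refl)

text \<open>The constant grows by \<open>k\<close> with each step back. Keeping it above the sum of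
  the entries of \<open>J\<close> lets it serve also for the two stopping costs in the
  minimum.\<close>

lemma value_function_solo_V_ex:
  assumes "t \<le> T"
  shows "\<exists>c. c < top \<and> ennreal (\<Sum>u\<in>UNIV. \<Sum>h\<in>UNIV. J u h) \<le> c \<and> value_function c c (solo_V t)"
  using assms
proof (induction rule: inc_induct)
  case base
  show ?case
    unfolding solo_V_T[abs_def]
    by (intro exI[of _ "ennreal (\<Sum>u\<in>UNIV. \<Sum>h\<in>UNIV. J u h)"] conjI value_function_min value_function_final_val) auto
next
  case (step n)
  then obtain c where c: "c < top" "ennreal (\<Sum>u\<in>UNIV. \<Sum>h\<in>UNIV. J u h) \<le> c" "value_function c c (solo_V (Suc n))"
    by blast
  have le: "ennreal (\<Sum>u\<in>UNIV. \<Sum>h\<in>UNIV. J u h) \<le> ennreal k + c"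
    using c(2) by (rule order_trans) simp
  have "solo_V n = (\<lambda>a b. min (min (final_val H0 a b) (final_val H1 a b)) (solo_W n a b))"
    using solo_V_less[OF step.hyps(2)] by (simp add: fun_eq_iff)
  then have "value_function (ennreal k + c) (ennreal k + c) (solo_V n)"
    using value_function_solo_W_step[OF c(3)] le by (auto intro!: value_function_min value_function_final_val)
  then show ?case using c le by (intro exI[of _ "ennreal k + c"]) auto
qed

lemma value_function_solo_W_ex:
  assumes "t < T"
  obtains c where "c < top" "ennreal (\<Sum>u\<in>UNIV. \<Sum>h\<in>UNIV. J u h) \<le> c" "value_function c c (solo_W t)"
proof -
  obtain c where c: "c < top" "ennreal (\<Sum>u\<in>UNIV. \<Sum>h\<in>UNIV. J u h) \<le> c" "value_function c c (solo_V (Suc t))"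
    using value_function_solo_V_ex[of "Suc t"] assms by auto
  show ?thesis
    using c by (intro that[of "ennreal k + c"] value_function_solo_W_step)
      (auto intro: order_trans[OF c(2)])
qed

lemma stopped_extend: "stopped t u \<Longrightarrow> stopped (Suc t) (u(t := x))"
  by (force simp: stopped_def)

lemma sunk_extend:
  assumes "stopped t u"
  shows "sunk (Suc t) (u(t := x)) = sunk t u + ennreal k"
proof -
  have "stop_time (u(t := x)) = stop_time u"
    using assms by (intro stop_time_cong[of t]) (auto simp: stopped_def)
  then have fs: "first_stop (Suc t) (u(t := x)) = first_stop t u"
    using assms stopped_extend[OF assms] by (simp add: first_stop_def)
  have "1 \<le> t" using assms by (auto simp: stopped_def)
  then have b: "1 \<le> first_stop t u" "first_stop t u \<le> t" using first_stop_bounds[of t u] by auto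
  have "0 \<le> K * (real (first_stop t u) - 1) + k * (real t - real (first_stop t u))"
    using b costs by (intro add_nonneg_nonneg mult_nonneg_nonneg) auto
  then show ?thesis
    unfolding sunk_def fs using costs by (subst ennreal_plus[symmetric]) (auto simp: algebra_simps)
qed

text \<open>A stopped observer is recorded as blank, so at most the blank extension of
  \<open>u\<close> has positive mass.\<close>

lemma Q_extend_stopped:
  assumes "stopped t u" "u \<in> HS t"
  shows "Q (Suc t) (u(t := x)) h = (if x = Blank then Q t u h else 0)"
proof -
  have "1 \<le> t" using assms by (auto simp: stopped_def)
  have "hist_ind (Suc t) (u(t := x)) y = (if x = Blank then hist_ind t u y else 0)" for y
  proof (cases "restrict (silent_path G1 y) {1..<t} = u")
    case True
    obtain s where s: "s \<in> {1..<t}" "u s \<noteq> Blank" using assms(1) by (auto simp: stopped_def)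
    then have "silent_path G1 y s \<noteq> Blank" using True by auto
    then have "silent_path G1 y t = Blank" using s(1) silent_path_after_stop by blast
    then show ?thesis using hist_ind_Suc[OF \<open>1 \<le> t\<close> assms(2), of x y] by auto
  next
    case False
    then have "hist_ind t u y = 0" by (simp add: hist_ind_def)
    then show ?thesis by (simp add: hist_ind_Suc[OF \<open>1 \<le> t\<close> assms(2)])
  qed
  then show ?thesis by (simp add: Q_def)
qed

text \<open>Only the blank extension survives in the sum. It raises the sunk cost by
  \<open>k\<close> on the whole mass, which the densities preserve; this extra term is the waiting
  cost inside \<open>solo_W\<close>.\<close>

lemma W_stopped_step:
  assumes t: "1 \<le> t" "t < T" and u: "u \<in> HS t" "stopped t u"
    and IH: "\<And>u a b. u \<in> HS (Suc t) \<Longrightarrow> stopped (Suc t) u \<Longrightarrow>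
      V (Suc t) u a b = sunk (Suc t) u * (Q (Suc t) u H0 * a + Q (Suc t) u H1 * b) +
        solo_V (Suc t) (Q (Suc t) u H0 * a) (Q (Suc t) u H1 * b)"
  shows "W t u a b = sunk t u * (Q t u H0 * a + Q t u H1 * b) + solo_W t (Q t u H0 * a) (Q t u H1 * b)"
proof -
  obtain c where vf: "value_function c c (solo_V (Suc t))"
    using value_function_solo_V_ex[of "Suc t"] t by auto
  let ?q0 = "Q t u H0" and ?q1 = "Q t u H1" and ?f0 = "dens (Suc t) H0" and ?f1 = "dens (Suc t) H1"
  have [measurable]: "(\<lambda>y. solo_V (Suc t) (p * ?f0 y) (q * ?f1 y)) \<in> borel_measurable N2" for p q
    by (rule value_function.measurable_value[OF vf]) auto
  have V: "V (Suc t) (u(t := x)) (a * ?f0 y) (b * ?f1 y) = (if x = Blank then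
      (sunk t u + ennreal k) * (?q0 * a * ?f0 y + ?q1 * b * ?f1 y) + solo_V (Suc t) (?q0 * a * ?f0 y) (?q1 * b * ?f1 y)
      else 0)" for x y
    by (subst IH[OF extend_HS[OF t(1) u(1)] stopped_extend[OF u(2)]])
      (simp add: Q_extend_stopped[OF u(2,1)] sunk_extend[OF u(2)] mult.assoc value_function.zero[OF vf])
  have "W t u a b = (\<Sum>x\<in>UNIV. if x = Blank then (\<integral>\<^sup>+y.
      (sunk t u + ennreal k) * (?q0 * a * ?f0 y + ?q1 * b * ?f1 y) + solo_V (Suc t) (?q0 * a * ?f0 y) (?q1 * b * ?f1 y) \<partial>N2) else 0)"
    unfolding W_def V by (intro sum.cong refl) simp
  also have "\<dots> = (\<integral>\<^sup>+y. (sunk t u + ennreal k) * (?q0 * a * ?f0 y + ?q1 * b * ?f1 y) +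
      solo_V (Suc t) (?q0 * a * ?f0 y) (?q1 * b * ?f1 y) \<partial>N2)"
    by (simp add: sum.delta)
  also have "\<dots> = (sunk t u + ennreal k) * (?q0 * a + ?q1 * b) +
      (\<integral>\<^sup>+y. solo_V (Suc t) (?q0 * a * ?f0 y) (?q1 * b * ?f1 y) \<partial>N2)"
    by (simp add: nn_integral_add nn_integral_cmult dens_integral)
  also have "\<dots> = sunk t u * (?q0 * a + ?q1 * b) + solo_W t (?q0 * a) (?q1 * b)"
    unfolding solo_W_def by (simp add: distrib_right distrib_left add_ac mult_ac)
  finally show ?thesis .
qed

text \<open>Separates past and future: apart from the sunk term, the value is a function of
  \<open>t\<close> and of the joint weights alone, so the history \<open>u\<close> matters only
  through them.\<close>

lemma V_stopped:
  assumes "1 \<le> t" "t \<le> T" "u \<in> HS t" "stopped t u"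
  shows "V t u a b = sunk t u * (Q t u H0 * a + Q t u H1 * b) + solo_V t (Q t u H0 * a) (Q t u H1 * b)"
  using assms(2,1,3,4)
proof (induction arbitrary: u a b rule: inc_induct)
  case base
  then show ?case
    by (simp add: V_T solo_V_T stop_val_stopped ennreal_add_min)
next
  case (step n)
  have "W n u a b = sunk n u * (Q n u H0 * a + Q n u H1 * b) + solo_W n (Q n u H0 * a) (Q n u H1 * b)"
    using step by (intro W_stopped_step) auto
  then show ?case using step
    by (simp add: V_less solo_V_less stop_val_stopped ennreal_add_min)
qed

lemma W_stopped:
  assumes "1 \<le> t" "t < T" "u \<in> HS t" "stopped t u"
  shows "W t u a b = sunk t u * (Q t u H0 * a + Q t u H1 * b) + solo_W t (Q t u H0 * a) (Q t u H1 * b)"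
  using assms by (intro W_stopped_step V_stopped) auto

section \<open>The optimal rule and the order of its labels\<close>

abbreviation swapped :: "nat \<Rightarrow> bool" where
  "swapped \<equiv> swaps_labels M H Y1 Y2 K k J G1"

text \<open>Every branch picks a minimiser. The first label of \<open>message_rule\<close> is chosen
  to be no dearer than the other one when \<open>H1\<close> is certain.\<close>

definition opt_rule :: "nat \<Rightarrow> (nat \<Rightarrow> decision) \<Rightarrow> ennreal \<Rightarrow> ennreal \<Rightarrow> decision" where
  "opt_rule t u a b =
    (if T \<le> t then if stop_val t u H1 a b \<le> stop_val t u H0 a b then Decide H1 else Decide H0
     else if stopped t u then accept_rule (stop_val t u H1 a b) (stop_val t u H0 a b) (W t u a b)
     else if swapped t then message_rule H0 H1 (stop_val t u H0 a b) (stop_val t u H1 a b) (W t u a b)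
     else message_rule H1 H0 (stop_val t u H1 a b) (stop_val t u H0 a b) (W t u a b))"

definition opt :: "'b policy" where
  "opt t = (\<lambda>x. opt_rule t (fst (snd x)) (lik t H0 (fst x)) (lik t H1 (fst x)))"

lemma opt_rule_optimal:
  assumes "t \<le> T"
  shows "choice_val t u (opt_rule t u a b) a b = V t u a b"
proof (cases "t = T")
  case True
  then show ?thesis by (auto simp: opt_rule_def choice_val_def V_T min_def)
next
  case False
  then have "t < T" using assms by simp
  then have cv: "choice_val t u v a b = (case v of Decide d \<Rightarrow> stop_val t u d a b | Blank \<Rightarrow> W t u a b)" for v
    by (simp add: choice_val_def split: decision.split)
  show ?thesis
    unfolding cv V_less[OF \<open>t < T\<close>] opt_rule_def
    using \<open>t < T\<close> accept_rule_optimal[where s = "\<lambda>d. stop_val t u d a b"] message_rule_optimal[where s = "\<lambda>d. stop_val t u d a b"]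
    by simp
qed

lemma lik_restrict: "lik t h (restrict y {1..t}) = lik t h y"
  by (simp add: lik_def)

lemma restrict_HS_id: "u \<in> HS t \<Longrightarrow> restrict u {1..<t} = u"
  by (auto simp: HS_def PiE_iff extensional_restrict)

lemma dec_opt: "u \<in> HS t \<Longrightarrow> dec opt y u t = at_lik t y (opt_rule t u)"
  by (simp add: dec_def opt_def history_def lik_restrict restrict_HS_id)

text \<open>For fixed \<open>u\<close> the rule compares measurable functions of the likelihoods,
  and \<open>u\<close> ranges over a finite set.\<close>

lemma is_policy_opt: "is_policy T N2 opt"
  unfolding is_policy_def
proof (intro conjI ballI)
  show "opt T x \<noteq> Blank" for x by (simp add: opt_def opt_rule_def)
next
  fix t assume t: "t \<in> {1..T}"
  have space_eq: "PiM {1..<t} (\<lambda>_. count_space (UNIV :: decision set)) = count_space (HS t)"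
    unfolding HS_def by (rule count_space_PiM_finite) auto
  have fst_m [measurable]: "fst \<in> measurable (history_space N2 t) (obs_space t)"
    unfolding history_space_def by measurable
  have u_m: "(\<lambda>x. fst (snd x)) \<in> measurable (history_space N2 t) (count_space (HS t))"
    unfolding space_eq[symmetric] history_space_def by measurable
  show "opt t \<in> measurable (history_space N2 t) (count_space UNIV)"
    unfolding opt_def
  proof (rule measurable_compose_countable'[OF _ u_m,
      where f = "\<lambda>u x. opt_rule t u (lik t H0 (fst x)) (lik t H1 (fst x))"])
    show "countable (HS t)" by (rule countable_finite) simp
    fix u assume u: "u \<in> HS t"
    have S: "(\<lambda>y. at_lik t y (stop_val t u d)) \<in> borel_measurable (obs_space t)" for d
      by (rule stop_val_lik_measurable)
    have "(\<lambda>y. at_lik t y (opt_rule t u)) \<in> measurable (obs_space t) (count_space UNIV)"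
    proof (cases "T \<le> t")
      case True
      have "{y \<in> space (obs_space t). at_lik t y (stop_val t u H1)
          \<le> at_lik t y (stop_val t u H0)} \<in> sets (obs_space t)"
        by (intro borel_measurable_le S)
      then show ?thesis
        using True unfolding opt_rule_def by (simp add: measurable_If)
    next
      case False
      then have Wm: "(\<lambda>y. at_lik t y (W t u)) \<in> borel_measurable (obs_space t)"
        using t u by (intro W_lik_measurable) auto
      show ?thesis
        using False accept_rule_measurable[OF S S Wm] message_rule_measurable[OF S S Wm]
        unfolding opt_rule_def by (cases "stopped t u"; cases "swapped t") simp_all
    qed
    then show "(\<lambda>x. opt_rule t u (lik t H0 (fst x)) (lik t H1 (fst x))) \<in> measurable (history_space N2 t) (count_space UNIV)"
      by (rule measurable_compose[OF fst_m])
  qed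
qed

lemma opt_is_optimal:
  "is_policy T N2 G \<Longrightarrow> exp_cost M H Y1 Y2 K k J G1 opt \<le> exp_cost M H Y1 Y2 K k J G1 G"
  by (rule optimality[OF is_policy_opt]) (simp add: dec_opt opt_rule_optimal)

definition blanks :: "nat \<Rightarrow> nat \<Rightarrow> decision" where
  "blanks t = restrict (\<lambda>_. Blank) {1..<t}"

lemma blanks_HS [simp]: "blanks t \<in> HS t"
  by (simp add: blanks_def)

lemma not_stopped_iff: "u \<in> HS t \<Longrightarrow> \<not> stopped t u \<longleftrightarrow> u = blanks t"
  by (auto simp: stopped_def blanks_def HS_def PiE_iff extensional_def restrict_def fun_eq_iff)

text \<open>The set integral in \<open>swaps_labels\<close> is the integral defining
  \<open>C\<close> for the all-blank history. Since \<open>C\<close> is finite, the strict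
  inequality passes between \<open>real\<close> and \<open>ennreal\<close>.\<close>

lemma swapped_iff:
  assumes t: "t \<in> {1..T}"
  shows "swapped t \<longleftrightarrow> C t (blanks t) H0 H1 < C t (blanks t) H1 H1"
proof -
  have "(LINT \<omega>:{\<omega> \<in> space M. H \<omega> = H1 \<and> active (U1 G1 (stop_at t h) Y1 Y2 \<omega>) t}|M.
      path_cost K k J (U1 G1 (stop_at t h) Y1 Y2 \<omega>) (U2 G1 (stop_at t h) Y1 Y2 \<omega>) H1) =
      enn2real (C t (blanks t) h H1)" (is "(LINT \<omega>:?A|M. ?c \<omega>) = _") for h
  proof -
    let ?g = "\<lambda>\<omega>. indicator (event H1) \<omega> * (hist_ind t (blanks t) (obs1 \<omega>) * stop_cost t h H1 (obs1 \<omega>))"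
    have [measurable]: "(\<lambda>\<omega>. hist_ind t (blanks t) (obs1 \<omega>)) \<in> borel_measurable M"
      using t by (intro hist_ind_obs1_measurable) auto
    have [measurable]: "(\<lambda>\<omega>. stop_cost t h H1 (obs1 \<omega>)) \<in> borel_measurable M"
      by (rule stop_cost_obs1_measurable)
    have [measurable]: "?g \<in> borel_measurable M" by measurable
    have eq: "indicator ?A \<omega> *\<^sub>R ?c \<omega> = enn2real (?g \<omega>)" "?g \<omega> < top" if \<omega>: "\<omega> \<in> space M" for \<omega>
    proof -
      have c: "?c \<omega> = path_cost K k J (stop_path G1 t h (obs1 \<omega>)) ((\<lambda>_. Blank)(t := Decide h)) H1"
        using t by (simp add: U1_stop_at U2_stop_at obs1_def stop_path_restrict)
      have c0: "0 \<le> ?c \<omega>"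
        unfolding c
      proof (rule path_cost_nonneg[OF costs J_nonneg])
        show "\<exists>s\<in>{1..T}. stop_path G1 t h (obs1 \<omega>) s \<noteq> Blank"
          by (rule path_stops(1)[OF policy1 horizon]) (rule seq_space_in[OF obs1_in[OF \<omega>]])
        show "\<exists>s\<in>{1..T}. ((\<lambda>_. Blank)(t := Decide h)) s \<noteq> Blank" using t by auto
      qed
      \<comment> \<open>Before \<open>t\<close> the message has no effect, so activity at
        \<open>t\<close> can be read off the silent history.\<close>
      have "active (U1 G1 (stop_at t h) Y1 Y2 \<omega>) t \<longleftrightarrow> \<not> stopped t (hist t \<omega>)"
        using stop_path_before[of t _ G1 h "obs1 \<omega>"] t
        by (auto simp: active_def stopped_def U1_stop_at hist_def B_def obs1_def stop_path_restrict silent_path_restrict)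
      also have "\<dots> \<longleftrightarrow> hist t \<omega> = blanks t" by (rule not_stopped_iff) simp
      finally have act: "active (U1 G1 (stop_at t h) Y1 Y2 \<omega>) t \<longleftrightarrow> hist t \<omega> = blanks t" .
      show "indicator ?A \<omega> *\<^sub>R ?c \<omega> = enn2real (?g \<omega>)"
        using \<omega> c0 act by (auto simp: indicator_def event_def hist_ind_obs1 stop_cost_def c)
      show "?g \<omega> < top" by (auto simp: indicator_def hist_ind_obs1 stop_cost_def)
    qed
    have "(LINT \<omega>:?A|M. ?c \<omega>) = (LINT \<omega>|M. enn2real (?g \<omega>))"
      unfolding set_lebesgue_integral_def by (intro Bochner_Integration.integral_cong refl eq)
    also have "\<dots> = enn2real (\<integral>\<^sup>+\<omega>. ennreal (enn2real (?g \<omega>)) \<partial>M)"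
      by (intro integral_eq_nn_integral) auto
    also have "(\<integral>\<^sup>+\<omega>. ennreal (enn2real (?g \<omega>)) \<partial>M) = (\<integral>\<^sup>+\<omega>. ?g \<omega> \<partial>M)"
      using eq(2) by (intro nn_integral_cong) simp
    finally show ?thesis by (simp add: C_def)
  qed
  then have "swapped t \<longleftrightarrow> enn2real (C t (blanks t) H0 H1) < enn2real (C t (blanks t) H1 H1)"
    by (simp add: swaps_labels_def)
  also have "\<dots> \<longleftrightarrow> ennreal (enn2real (C t (blanks t) H0 H1)) < ennreal (enn2real (C t (blanks t) H1 H1))"
    by (subst ennreal_less_iff) auto
  also have "\<dots> \<longleftrightarrow> C t (blanks t) H0 H1 < C t (blanks t) H1 H1"
    using C_finite[OF t] by simp
  finally show ?thesis .
qed

end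

section \<open>The belief of observer 2\<close>

context detection_problem
begin

text \<open>Bayes' formula with joint weights. If both weights are 0, the quotient evaluates to
  0.\<close>

definition posterior :: "nat \<Rightarrow> (nat \<Rightarrow> decision) \<Rightarrow> (nat \<Rightarrow> 'b) \<Rightarrow> real" where
  "posterior t u y = enn2real (Q t u H0 * lik t H0 y / (Q t u H0 * lik t H0 y + Q t u H1 * lik t H1 y))"

lemma weight_finite: "Q t u h * lik t h y < top"
  by (simp add: ennreal_mult_less_top Q_finite lik_finite)

text \<open>Undoing the division works even for total weight 0, because both summands are then 0.
  The computation of the belief thus avoids a case distinction.\<close>

lemma ennreal_share:
  fixes a b :: ennreal
  assumes "a < top" "b < top"
  shows "ennreal (enn2real (a / (a + b))) * (a + b) = a" "enn2real (a / (a + b)) \<in> {0..1}"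
proof -
  obtain x where x: "a = ennreal x" "0 \<le> x" using assms by (cases a) auto
  obtain y where y: "b = ennreal y" "0 \<le> y" using assms by (cases b) auto
  have *: "ennreal (enn2real (a / (a + b))) * (a + b) = a \<and> enn2real (a / (a + b)) \<in> {0..1}"
  proof (cases "x + y = 0")
    case True
    then show ?thesis using x y by (simp add: add_nonneg_eq_0_iff)
  next
    case False
    then have pos: "0 < x + y" using x y by simp
    then have "a / (a + b) = ennreal (x / (x + y))"
      using x y by (simp add: divide_ennreal flip: ennreal_plus)
    moreover have "ennreal (x / (x + y)) * ennreal (x + y) = ennreal x"
      using x y pos by (subst ennreal_mult[symmetric]) auto
    ultimately show ?thesis using x y pos by (simp add: field_simps)
  qed
  then show "ennreal (enn2real (a / (a + b))) * (a + b) = a" "enn2real (a / (a + b)) \<in> {0..1}" by auto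
qed

lemma posterior_in_01: "posterior t u y \<in> {0..1}"
  unfolding posterior_def by (rule ennreal_share(2)[OF weight_finite weight_finite])

lemma posterior_measurable [measurable]: "posterior t u \<in> borel_measurable (obs_space t)"
  unfolding posterior_def[abs_def] by measurable

lemma integral_hist_obs:
  assumes t: "1 \<le> t" "t \<le> T" and F: "\<And>u h. F u h \<in> borel_measurable (obs_space t)"
  shows "(\<integral>\<^sup>+\<omega>. F (hist t \<omega>) (H \<omega>) (obs2 t \<omega>) \<partial>M) =
    (\<Sum>u\<in>HS t. \<integral>\<^sup>+y. F u H0 y * (Q t u H0 * lik t H0 y) + F u H1 y * (Q t u H1 * lik t H1 y) \<partial>obs_space t)"
proof -
  note F[measurable]
  have "(\<integral>\<^sup>+\<omega>. F (hist t \<omega>) (H \<omega>) (obs2 t \<omega>) \<partial>M) =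
      (\<Sum>u\<in>HS t. \<Sum>h\<in>UNIV. (\<integral>\<^sup>+y. F u h y * lik t h y \<partial>obs_space t) * Q t u h)"
    using disintegration[OF t F, of "\<lambda>_ _. 1"] by (simp add: Q_def)
  also have "\<dots> = (\<Sum>u\<in>HS t. \<integral>\<^sup>+y. F u H0 y * (Q t u H0 * lik t H0 y) + F u H1 y * (Q t u H1 * lik t H1 y) \<partial>obs_space t)"
  proof (intro sum.cong refl)
    fix u
    have "(\<integral>\<^sup>+y. F u h y * lik t h y \<partial>obs_space t) * Q t u h =
        (\<integral>\<^sup>+y. F u h y * (Q t u h * lik t h y) \<partial>obs_space t)" for h
      by (subst nn_integral_multc[symmetric]) (auto intro!: nn_integral_cong simp: mult_ac)
    then show "(\<Sum>h\<in>UNIV. (\<integral>\<^sup>+y. F u h y * lik t h y \<partial>obs_space t) * Q t u h) =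
      (\<integral>\<^sup>+y. F u H0 y * (Q t u H0 * lik t H0 y) + F u H1 y * (Q t u H1 * lik t H1 y) \<partial>obs_space t)"
      by (simp add: sum_hyp nn_integral_add)
  qed
  finally show ?thesis .
qed

text \<open>The probability of zero mass is an integral of the indicator of zero mass times the mass
  itself, which is identically 0.\<close>

lemma weight_positive:
  assumes t: "1 \<le> t" "t \<le> T"
  shows "AE \<omega> in M. Q t (hist t \<omega>) H0 * lik t H0 (obs2 t \<omega>) + Q t (hist t \<omega>) H1 * lik t H1 (obs2 t \<omega>) \<noteq> 0"
proof -
  let ?z = "\<lambda>u y. if Q t u H0 * lik t H0 y + Q t u H1 * lik t H1 y = 0 then 1 else 0 :: ennreal"
  have "(\<integral>\<^sup>+\<omega>. ?z (hist t \<omega>) (obs2 t \<omega>) \<partial>M) =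
      (\<Sum>u\<in>HS t. \<integral>\<^sup>+y. ?z u y * (Q t u H0 * lik t H0 y) + ?z u y * (Q t u H1 * lik t H1 y) \<partial>obs_space t)"
    by (rule integral_hist_obs[OF t, of "\<lambda>u h. ?z u"]) measurable
  also have "\<dots> = (\<Sum>u\<in>HS t. \<integral>\<^sup>+y. 0 \<partial>obs_space t)"
    by (intro sum.cong refl nn_integral_cong) auto
  finally have int: "(\<integral>\<^sup>+\<omega>. ?z (hist t \<omega>) (obs2 t \<omega>) \<partial>M) = 0" by simp
  have "(\<lambda>\<omega>. ?z (hist t \<omega>) (obs2 t \<omega>)) \<in> borel_measurable M"
  proof (rule measurable_compose_countable'[where f = "\<lambda>u \<omega>. ?z u (obs2 t \<omega>)" and I = "HS t"])
    show "(\<lambda>\<omega>. ?z u (obs2 t \<omega>)) \<in> borel_measurable M" for u by measurable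
  qed (use t in \<open>auto intro: hist_measurable_M countable_finite\<close>)
  then have "AE \<omega> in M. ?z (hist t \<omega>) (obs2 t \<omega>) = 0"
    using int by (subst nn_integral_0_iff_AE[symmetric]) auto
  then show ?thesis by eventually_elim (auto split: if_splits)
qed

section \<open>The belief under an arbitrary admissible policy\<close>

context
  fixes G :: "'b policy"
  assumes pol: "is_policy T N2 G"
begin

abbreviation u1 where "u1 \<equiv> U1 G1 G Y1 Y2"
abbreviation u2 where "u2 \<equiv> U2 G1 G Y1 Y2"

definition info :: "nat \<Rightarrow> 'w \<Rightarrow> 'b history" where
  "info t \<omega> = history (\<lambda>s. Y2 s \<omega>) (u1 \<omega>) (u2 \<omega>) t"

lemma info_measurable:
  assumes t: "1 \<le> t" "t \<le> T"
  shows "info t \<in> measurable M (history_space N2 t)"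
proof -
  let ?run = "\<lambda>\<omega>. run G1 G (\<lambda>s. Y1 s \<omega>) (\<lambda>s. Y2 s \<omega>) T"
  have run: "?run \<in> measurable M (count_space (run_range T))"
  proof (rule run_measurable)
    fix m own v1 v2 assume m: "m \<in> {1..T}"
    show "(\<lambda>\<omega>. move G1 (\<lambda>s. Y1 s \<omega>) own v1 v2 m) \<in> measurable M (count_space UNIV)"
      using m by (intro move_measurable[OF policy1] measurable_restrict Y1_measurable) auto
    show "(\<lambda>\<omega>. move G (\<lambda>s. Y2 s \<omega>) own v1 v2 m) \<in> measurable M (count_space UNIV)"
      using m by (intro move_measurable[OF pol] measurable_restrict Y2_measurable) auto
  qed
  have space_eq: "PiM {1..<t} (\<lambda>_. count_space (UNIV :: decision set)) = count_space (HS t)"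
    unfolding HS_def by (rule count_space_PiM_finite) auto
  have r1: "restrict (u1 \<omega>) {1..<t} = restrict (fst (?run \<omega>)) {1..<t}"
    and r2: "restrict (u2 \<omega>) {1..<t} = restrict (snd (?run \<omega>)) {1..<t}" for \<omega>
    unfolding U1_def U2_def using t
    by (auto intro!: restrict_ext simp: run_stable(1)[of G1 G _ _ T] run_stable(2)[of G1 G _ _ T])
  have "(\<lambda>\<omega>. restrict (u1 \<omega>) {1..<t}) \<in> measurable M (count_space (HS t))"
    unfolding r1 by (rule measurable_compose[OF run, of "\<lambda>r. restrict (fst r) {1..<t}"]) (simp add: Pi_def)
  moreover have "(\<lambda>\<omega>. restrict (u2 \<omega>) {1..<t}) \<in> measurable M (count_space (HS t))"
    unfolding r2 by (rule measurable_compose[OF run, of "\<lambda>r. restrict (snd r) {1..<t}"]) (simp add: Pi_def)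
  ultimately show ?thesis
    unfolding info_def[abs_def] history_def history_space_def space_eq
    using obs2_measurable[of t] by (intro measurable_Pair) (simp_all add: obs2_def[abs_def])
qed

lemma info_of_active:
  assumes "1 \<le> t" "active (u2 \<omega>) t"
  shows "info t \<omega> = (obs2 t \<omega>, hist t \<omega>, blanks t)"
proof -
  have "restrict (u1 \<omega>) {1..<t} = hist t \<omega>"
    unfolding hist_def B_eq using U1_of_active[OF assms] by (auto intro!: restrict_ext)
  moreover have "restrict (u2 \<omega>) {1..<t} = blanks t"
    unfolding blanks_def using assms(2) by (auto intro!: restrict_ext simp: active_def)
  ultimately show ?thesis by (simp add: info_def history_def obs2_def)
qed

lemma active_iff_still_obs:
  "1 \<le> t \<Longrightarrow> active (u2 \<omega>) t \<longleftrightarrow> still G (obs2 t \<omega>) (hist t \<omega>) t"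
  by (simp add: active_iff_still still_obs B_eq)

text \<open>In general the information of observer 2 depends on how \<open>G\<close> has influenced
  observer 1. While observer 2 is active it reduces to observations, silent history and blanks. So
  the defining property of conditional expectation is checked for the indicator of activity times
  that of \<open>H0\<close>; activity is known to observer 2 and factors out at the end.\<close>

lemma belief_eq_posterior:
  assumes t: "1 \<le> t" "t \<le> T"
  shows "AE \<omega> in M. active (u2 \<omega>) t \<longrightarrow>
    belief2 M H Y1 N2 Y2 G1 G t \<omega> = posterior t (hist t \<omega>) (obs2 t \<omega>)"
proof -
  let ?HS = "history_space N2 t"
  define F where "F = vimage_algebra (space M) (info t) ?HS"
  have space_eq: "PiM {1..<t} (\<lambda>_. count_space (UNIV :: decision set)) = count_space (HS t)"
    unfolding HS_def by (rule count_space_PiM_finite) auto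
  note info [measurable] = info_measurable[OF t]
  have infoF [measurable]: "info t \<in> measurable F ?HS"
    unfolding F_def using measurable_space[OF info] by (intro measurable_vimage_algebra1) auto
  have spaceF: "space F = space M" by (simp add: F_def)
  have subalg: "subalgebra M F"
    unfolding subalgebra_def F_def
    by (simp add: sets_vimage_algebra2[OF funcsetI[OF measurable_space[OF info]]]) (blast intro: measurable_sets[OF info])
  interpret S: finite_measure_subalgebra M F by unfold_locales (rule subalg)
  define act where "act \<omega> = (if active (u2 \<omega>) t then 1 else 0 :: real)" for \<omega>
  have snd_m: "(\<lambda>x. snd (snd x)) \<in> measurable ?HS (count_space (HS t))"
    unfolding history_space_def space_eq[symmetric] by measurable
  have u_m: "(\<lambda>x. fst (snd x)) \<in> measurable ?HS (count_space (HS t))"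
    unfolding history_space_def space_eq[symmetric] by measurable
  have fst_m [measurable]: "fst \<in> measurable ?HS (obs_space t)"
    unfolding history_space_def by measurable
  have act_info: "act \<omega> = (if snd (snd (info t \<omega>)) = blanks t then 1 else 0)" for \<omega>
  proof -
    have "snd (snd (info t \<omega>)) = blanks t \<longleftrightarrow> active (u2 \<omega>) t"
      unfolding info_def history_def blanks_def active_def by (auto simp: restrict_def fun_eq_iff)
    then show ?thesis by (simp add: act_def)
  qed
  have actF [measurable]: "act \<in> borel_measurable F"
    unfolding act_info[abs_def]
    by (rule measurable_compose[OF infoF measurable_compose[OF snd_m, of "\<lambda>v. if v = blanks t then 1 else 0"]]) simp
  have actM [measurable]: "act \<in> borel_measurable M" by (rule measurable_from_subalg[OF subalg actF])
  define p where "p \<omega> = act \<omega> * posterior t (hist t \<omega>) (obs2 t \<omega>)" for \<omega>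
  have p_eq: "p \<omega> = act \<omega> * posterior t (fst (snd (info t \<omega>))) (fst (info t \<omega>))" for \<omega>
    using info_of_active[OF t(1), of \<omega>] by (auto simp: p_def act_def)
  have "(\<lambda>x. posterior t (fst (snd x)) (fst x)) \<in> borel_measurable ?HS"
  proof (rule measurable_compose_countable'[where f = "\<lambda>u x. posterior t u (fst x)" and I = "HS t", OF _ u_m])
    show "(\<lambda>x. posterior t u (fst x)) \<in> borel_measurable ?HS" for u by measurable
  qed (auto intro: countable_finite)
  then have pF [measurable]: "p \<in> borel_measurable F"
    unfolding p_eq[abs_def] by (intro borel_measurable_times actF measurable_compose[OF infoF])
  have pM [measurable]: "p \<in> borel_measurable M" by (rule measurable_from_subalg[OF subalg pF])
  have p01: "0 \<le> p \<omega>" "p \<omega> \<le> 1" for \<omega>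
    using posterior_in_01[of t "hist t \<omega>" "obs2 t \<omega>"] by (auto simp: p_def act_def)
  let ?e = "indicator (event H0) :: 'w \<Rightarrow> real"
  have integrable_act: "integrable M (\<lambda>\<omega>. act \<omega> * ?e \<omega>)"
  proof (rule integrable_const_bound[of _ 1])
    show "(\<lambda>\<omega>. act \<omega> * ?e \<omega>) \<in> borel_measurable M" by measurable
  qed (auto simp: act_def indicator_def)
  have "AE \<omega> in M. real_cond_exp M F (\<lambda>\<omega>. act \<omega> * ?e \<omega>) \<omega> = p \<omega>"
  proof (rule S.real_cond_exp_charact)
    show "integrable M (\<lambda>\<omega>. act \<omega> * ?e \<omega>)" by (rule integrable_act)
    show "integrable M p"
      using p01 by (intro integrable_const_bound[of _ 1]) auto
    show "p \<in> borel_measurable F" by (rule pF)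
    fix A assume "A \<in> sets F"
    then obtain Z where Z [measurable]: "Z \<in> sets ?HS" and A: "A = info t -` Z \<inter> space M"
      unfolding F_def using measurable_space[OF info] by (auto simp: sets_vimage_algebra2)
    have Am [measurable]: "A \<in> sets M" unfolding A using info Z by (rule measurable_sets)
    define \<Phi> where "\<Phi> u y = (if still G y u t \<and> (y, u, blanks t) \<in> Z then 1 else 0 :: ennreal)" for u y
    have \<Phi>_meas [measurable]: "\<Phi> u \<in> borel_measurable (obs_space t)" if "u \<in> HS t" for u
    proof -
      have "(\<lambda>y. (y, u, blanks t)) \<in> measurable (obs_space t) ?HS"
        unfolding history_space_def space_eq using that by (intro measurable_Pair measurable_const) auto
      then have [measurable]: "Measurable.pred (obs_space t) (\<lambda>y. (y, u, blanks t) \<in> Z)"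
        by measurable
      have [measurable]: "Measurable.pred (obs_space t) (\<lambda>y. still G y u t)"
        using t by (intro still_measurable pol) auto
      show ?thesis unfolding \<Phi>_def by measurable
    qed
    \<comment> \<open>\<open>integral_hist_obs\<close> asks for measurability at every
      \<open>u\<close>, while \<open>\<Phi> u\<close> has been shown measurable for \<open>u\<close>
      in \<open>HS t\<close>; hence the extension by 0.\<close>
    define \<Psi> where "\<Psi> u = (if u \<in> HS t then \<Phi> u else (\<lambda>_. 0))" for u
    have [measurable]: "\<Psi> u \<in> borel_measurable (obs_space t)" for u
      by (cases "u \<in> HS t") (auto simp: \<Psi>_def)
    have ind: "ennreal (indicator A \<omega> * act \<omega>) = \<Psi> (hist t \<omega>) (obs2 t \<omega>)" if "\<omega> \<in> space M" for \<omega>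
      using that info_of_active[OF t(1), of \<omega>] active_iff_still_obs[OF t(1), of \<omega>]
      by (auto simp: A \<Psi>_def \<Phi>_def act_def indicator_def)
    have "(\<integral>\<^sup>+\<omega>. ennreal (indicator A \<omega> * (act \<omega> * ?e \<omega>)) \<partial>M) =
        (\<integral>\<^sup>+\<omega>. \<Psi> (hist t \<omega>) (obs2 t \<omega>) * (if H \<omega> = H0 then 1 else 0) \<partial>M)"
    proof (rule nn_integral_cong)
      fix \<omega> assume \<omega>: "\<omega> \<in> space M"
      have "indicator A \<omega> * (act \<omega> * ?e \<omega>) = (if H \<omega> = H0 then indicator A \<omega> * act \<omega> else 0)"
        using \<omega> by (auto simp: event_def)
      then show "ennreal (indicator A \<omega> * (act \<omega> * ?e \<omega>)) = \<Psi> (hist t \<omega>) (obs2 t \<omega>) * (if H \<omega> = H0 then 1 else 0)"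
        using ind[OF \<omega>] by simp
    qed
    also have "\<dots> = (\<Sum>u\<in>HS t. \<integral>\<^sup>+y. \<Psi> u y * (if H0 = H0 then 1 else 0) * (Q t u H0 * lik t H0 y) +
        \<Psi> u y * (if H1 = H0 then 1 else 0) * (Q t u H1 * lik t H1 y) \<partial>obs_space t)"
      by (rule integral_hist_obs[OF t, of "\<lambda>u h y. \<Psi> u y * (if h = H0 then 1 else 0)"]) measurable
    also have "\<dots> = (\<Sum>u\<in>HS t. \<integral>\<^sup>+y. \<Psi> u y * ennreal (posterior t u y) * (Q t u H0 * lik t H0 y) +
        \<Psi> u y * ennreal (posterior t u y) * (Q t u H1 * lik t H1 y) \<partial>obs_space t)"
    proof (intro sum.cong refl nn_integral_cong)
      fix u y
      \<comment> \<open>Bayes' formula: posterior times total weight is the weight of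
        \<open>H0\<close>.\<close>
      have "ennreal (posterior t u y) * (Q t u H0 * lik t H0 y + Q t u H1 * lik t H1 y) = Q t u H0 * lik t H0 y"
        unfolding posterior_def by (rule ennreal_share(1)[OF weight_finite weight_finite])
      then have "\<Psi> u y * (ennreal (posterior t u y) * (Q t u H0 * lik t H0 y + Q t u H1 * lik t H1 y)) =
          \<Psi> u y * (Q t u H0 * lik t H0 y)" by simp
      then show "\<Psi> u y * (if H0 = H0 then 1 else 0) * (Q t u H0 * lik t H0 y) +
          \<Psi> u y * (if H1 = H0 then 1 else 0) * (Q t u H1 * lik t H1 y) =
        \<Psi> u y * ennreal (posterior t u y) * (Q t u H0 * lik t H0 y) +
          \<Psi> u y * ennreal (posterior t u y) * (Q t u H1 * lik t H1 y)"
        by (simp add: distrib_left mult.assoc)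
    qed
    also have "\<dots> = (\<integral>\<^sup>+\<omega>. \<Psi> (hist t \<omega>) (obs2 t \<omega>) * ennreal (posterior t (hist t \<omega>) (obs2 t \<omega>)) \<partial>M)"
      by (rule integral_hist_obs[OF t, of "\<lambda>u h y. \<Psi> u y * ennreal (posterior t u y)", symmetric]) measurable
    also have "\<dots> = (\<integral>\<^sup>+\<omega>. ennreal (indicator A \<omega> * p \<omega>) \<partial>M)"
    proof (rule nn_integral_cong)
      fix \<omega> assume "\<omega> \<in> space M"
      then show "\<Psi> (hist t \<omega>) (obs2 t \<omega>) * ennreal (posterior t (hist t \<omega>) (obs2 t \<omega>)) = ennreal (indicator A \<omega> * p \<omega>)"
        unfolding p_def using posterior_in_01[of t "hist t \<omega>" "obs2 t \<omega>"]
        by (subst ind[symmetric]) (auto simp: act_def indicator_def)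
    qed
    finally have eq: "(\<integral>\<^sup>+\<omega>. ennreal (indicator A \<omega> * (act \<omega> * ?e \<omega>)) \<partial>M) = (\<integral>\<^sup>+\<omega>. ennreal (indicator A \<omega> * p \<omega>) \<partial>M)" .
    have "(LINT \<omega>:A|M. act \<omega> * ?e \<omega>) = enn2real (\<integral>\<^sup>+\<omega>. ennreal (indicator A \<omega> * (act \<omega> * ?e \<omega>)) \<partial>M)"
      unfolding set_lebesgue_integral_def real_scaleR_def
    proof (rule integral_eq_nn_integral)
      show "(\<lambda>\<omega>. indicator A \<omega> * (act \<omega> * ?e \<omega>)) \<in> borel_measurable M" by measurable
    qed (auto simp: act_def)
    also have "\<dots> = (LINT \<omega>:A|M. p \<omega>)"
      unfolding set_lebesgue_integral_def real_scaleR_def eq using p01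
      by (intro integral_eq_nn_integral[symmetric]) auto
    finally show "(LINT \<omega>:A|M. act \<omega> * ?e \<omega>) = (LINT \<omega>:A|M. p \<omega>)" .
  qed
  moreover have "AE \<omega> in M. real_cond_exp M F (\<lambda>\<omega>. act \<omega> * ?e \<omega>) \<omega> = act \<omega> * real_cond_exp M F ?e \<omega>"
    by (rule S.real_cond_exp_mult[OF actF _ integrable_act]) measurable
  ultimately show ?thesis
  proof eventually_elim
    case (elim \<omega>)
    have "belief2 M H Y1 N2 Y2 G1 G t = real_cond_exp M F ?e"
      unfolding belief2_def F_def info_def[abs_def] event_def ..
    then show ?case using elim by (auto simp: act_def p_def)
  qed
qed

end

end

section \<open>Threshold structure of the optimal policy\<close>

lemma accept_rule_cong:
  assumes "l1 \<le> l0 \<longleftrightarrow> l1' \<le> l0'" "l1 \<le> w \<longleftrightarrow> l1' \<le> w'" "w \<le> l0 \<longleftrightarrow> w' \<le> l0'"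
  shows "accept_rule l1 l0 w = accept_rule l1' l0' w'"
  using assms by (simp add: accept_rule_def flip: not_le)

lemma message_rule_cong:
  assumes "l \<le> h \<longleftrightarrow> l' \<le> h'" "l \<le> w \<longleftrightarrow> l' \<le> w'" "h \<le> w \<longleftrightarrow> h' \<le> w'"
  shows "message_rule lo hi l h w = message_rule lo hi l' h' w'"
  using assms by (simp add: message_rule_def)

lemma weight_inverse_finite: "weight_inverse q < top"
  by (simp add: weight_inverse_def less_top[symmetric])

context detection_problem
begin

definition weight :: "nat \<Rightarrow> (nat \<Rightarrow> decision) \<Rightarrow> (nat \<Rightarrow> 'b) \<Rightarrow> hyp \<Rightarrow> ennreal" where
  "weight t u y h = Q t u h * lik t h y"

abbreviation mass :: "nat \<Rightarrow> (nat \<Rightarrow> decision) \<Rightarrow> (nat \<Rightarrow> 'b) \<Rightarrow> ennreal" where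
  "mass t u y \<equiv> weight t u y H0 + weight t u y H1"

lemma weight_less_top: "weight t u y h < top"
  unfolding weight_def by (rule weight_finite)

lemma posterior_weight: "posterior t u y = enn2real (weight t u y H0 / (mass t u y))"
  by (simp add: posterior_def weight_def)

lemma cmp_posterior:
  assumes "value_function q q X" "value_function r r Z" "q < top" "r < top"
    and "mass t u y \<noteq> 0"
  shows "X (weight t u y H0) (weight t u y H1) \<le> Z (weight t u y H0) (weight t u y H1) \<longleftrightarrow>
    on_simplex X (posterior t u y) \<le> on_simplex Z (posterior t u y)"
  unfolding posterior_weight using assms weight_less_top by (intro on_simplex_cmp[OF assms(1,2)]) auto

text \<open>The sunk term is finite, as cancellation in \<open>ennreal\<close> requires.\<close>

lemma cancel_sunk:
  "sunk t u * (mass t u y) + a \<le> sunk t u * (mass t u y) + b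
    \<longleftrightarrow> a \<le> b"
proof -
  have "sunk t u * (mass t u y) \<noteq> top"
    using weight_less_top[of t u y H0] weight_less_top[of t u y H1]
    by (auto simp: sunk_def ennreal_mult_eq_top_iff)
  then show ?thesis by (simp add: ennreal_add_left_cancel_le)
qed

lemma final_val_value_function: "value_function (ennreal (\<Sum>u\<in>UNIV. \<Sum>h\<in>UNIV. J u h)) (ennreal (\<Sum>u\<in>UNIV. \<Sum>h\<in>UNIV. J u h)) (final_val d)"
  by (rule value_function_final_val) simp

lemma affine_final_val: "affine01 (on_simplex (final_val d))"
  unfolding final_val_def[abs_def] by (rule affine_on_simplex) auto

lemma on_simplex_nonneg: "0 \<le> on_simplex X p"
  by (simp add: on_simplex_def)

lemma on_simplex_final_val: "on_simplex (final_val H1) 0 = 0" "on_simplex (final_val H0) 1 = 0"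
  using J_diag by (simp_all add: on_simplex_def final_val_def)

lemma stop_val_le_iff:
  assumes "t \<in> {1..T}" "stopped t u \<or> t = T" "mass t u y \<noteq> 0"
  shows "at_lik t y (stop_val t u d) \<le> at_lik t y (stop_val t u e) \<longleftrightarrow>
    on_simplex (final_val d) (posterior t u y) \<le> on_simplex (final_val e) (posterior t u y)"
proof -
  have "at_lik t y (stop_val t u d) \<le> at_lik t y (stop_val t u e) \<longleftrightarrow>
      final_val d (weight t u y H0) (weight t u y H1) \<le> final_val e (weight t u y H0) (weight t u y H1)"
    unfolding stop_val_stopped[OF assms(1,2)] weight_def[symmetric] by (rule cancel_sunk)
  also have "\<dots> \<longleftrightarrow> on_simplex (final_val d) (posterior t u y) \<le> on_simplex (final_val e) (posterior t u y)"
    using assms(3) by (intro cmp_posterior[OF final_val_value_function final_val_value_function]) auto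
  finally show ?thesis .
qed

lemma final_threshold:
  "\<exists>\<alpha>. 0 \<le> \<alpha> \<and> \<alpha> \<le> 1 \<and> (\<forall>u y. mass T u y \<noteq> 0 \<longrightarrow>
    at_lik T y (opt_rule T u) = (if posterior T u y \<le> \<alpha> then Decide H1 else Decide H0))"
proof -
  obtain \<alpha> where \<alpha>: "0 \<le> \<alpha>" "\<alpha> \<le> 1"
    "\<forall>p\<in>{0..1}. on_simplex (final_val H1) p \<le> on_simplex (final_val H0) p \<longleftrightarrow> p \<le> \<alpha>"
    using one_threshold[OF affine_final_val[of H1] affine_final_val[of H0]] on_simplex_nonneg
    by (auto simp: on_simplex_final_val)
  have "at_lik T y (opt_rule T u) = (if posterior T u y \<le> \<alpha> then Decide H1 else Decide H0)"
    if "mass T u y \<noteq> 0" for u y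
    using stop_val_le_iff[of T u y H1 H0] that \<alpha>(3) posterior_in_01[of T u y] horizon by (simp add: opt_rule_def)
  then show ?thesis using \<alpha> by blast
qed

text \<open>The endpoint conditions of \<open>two_thresholds\<close> come from the costs: at
  posterior 0 deciding \<open>H1\<close> is free, and at posterior 1 deciding \<open>H0\<close> is
  free whereas continuing costs at least \<open>k > 0\<close>.\<close>

lemma solo_thresholds:
  assumes t: "1 \<le> t" "t < T"
  shows "\<exists>\<alpha> \<beta>. 0 \<le> \<alpha> \<and> \<alpha> \<le> \<beta> \<and> \<beta> \<le> 1 \<and>
    (\<forall>u\<in>HS t. \<forall>y. stopped t u \<and> mass t u y \<noteq> 0 \<longrightarrow>
      at_lik t y (opt_rule t u) =
        (if posterior t u y \<le> \<alpha> then Decide H1 else if posterior t u y \<le> \<beta> then Blank else Decide H0))"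
proof -
  obtain c where c: "c < top" and vf: "value_function c c (solo_W t)"
    using value_function_solo_W_ex[OF t(2)] by blast
  interpret W: value_function c c "solo_W t" by (rule vf)
  have "ennreal k \<le> solo_W t 1 0" by (simp add: solo_W_def)
  also have "\<dots> = ennreal (on_simplex (solo_W t) 1)"
    using W.ennreal_on_simplex[OF c c, of 1] by simp
  finally have pos: "0 < on_simplex (solo_W t) 1"
    using costs(1) on_simplex_nonneg[of "solo_W t" 1] by (simp add: ennreal_le_iff)
  obtain \<alpha> \<beta> where ab: "0 \<le> \<alpha>" "\<alpha> \<le> \<beta>" "\<beta> \<le> 1"
    and rule: "\<forall>p\<in>{0..1}. accept_rule (on_simplex (final_val H1) p) (on_simplex (final_val H0) p) (on_simplex (solo_W t) p) =
       (if p \<le> \<alpha> then Decide H1 else if p \<le> \<beta> then Blank else Decide H0)"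
    using two_thresholds[OF affine_final_val[of H1] affine_final_val[of H0]
        W.concave_on_simplex[OF c c] W.continuous_on_simplex[OF c c]]
      pos on_simplex_nonneg by (auto simp: on_simplex_final_val)
  have "at_lik t y (opt_rule t u) =
        (if posterior t u y \<le> \<alpha> then Decide H1 else if posterior t u y \<le> \<beta> then Blank else Decide H0)"
    if u: "u \<in> HS t" and st: "stopped t u" and nz: "mass t u y \<noteq> 0" for u y
  proof -
    have tT: "t \<in> {1..T}" using t by auto
    have sv: "at_lik t y (stop_val t u d) = sunk t u * (mass t u y) +
        final_val d (weight t u y H0) (weight t u y H1)" for d
      unfolding weight_def using st by (intro stop_val_stopped[OF tT]) simp
    have Wv: "at_lik t y (W t u) = sunk t u * (mass t u y) +
        solo_W t (weight t u y H0) (weight t u y H1)"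
      unfolding weight_def by (rule W_stopped[OF t u st])
    have "at_lik t y (opt_rule t u) = accept_rule (at_lik t y (stop_val t u H1))
        (at_lik t y (stop_val t u H0)) (at_lik t y (W t u))"
      using t st by (simp add: opt_rule_def)
    also have "\<dots> = accept_rule (on_simplex (final_val H1) (posterior t u y)) (on_simplex (final_val H0) (posterior t u y))
        (on_simplex (solo_W t) (posterior t u y))"
    proof (rule accept_rule_cong)
      show "at_lik t y (stop_val t u H1) \<le> at_lik t y (stop_val t u H0) \<longleftrightarrow>
          on_simplex (final_val H1) (posterior t u y) \<le> on_simplex (final_val H0) (posterior t u y)"
        by (rule stop_val_le_iff[OF tT _ nz]) (simp add: st)
      show "at_lik t y (stop_val t u H1) \<le> at_lik t y (W t u) \<longleftrightarrow>
          on_simplex (final_val H1) (posterior t u y) \<le> on_simplex (solo_W t) (posterior t u y)"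
        unfolding sv Wv cancel_sunk by (rule cmp_posterior[OF final_val_value_function vf _ c nz]) simp
      show "at_lik t y (W t u) \<le> at_lik t y (stop_val t u H0) \<longleftrightarrow>
          on_simplex (solo_W t) (posterior t u y) \<le> on_simplex (final_val H0) (posterior t u y)"
        unfolding sv Wv cancel_sunk by (rule cmp_posterior[OF vf final_val_value_function c _ nz]) simp
    qed
    also have "\<dots> = (if posterior t u y \<le> \<alpha> then Decide H1 else if posterior t u y \<le> \<beta> then Blank else Decide H0)"
      using rule posterior_in_01 by blast
    finally show ?thesis .
  qed
  then show ?thesis using ab by blast
qed

text \<open>Stopping costs here contain the reaction of observer 1, so the values are rescaled as
  they stand to functions of the joint weights. At posterior 0 only the coefficient \<open>C\<close>
  for \<open>H1\<close> counts, and \<open>swapped\<close> decides which label has the smaller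
  one.\<close>

lemma joint_thresholds:
  assumes t: "1 \<le> t" "t < T" and count: "countable A"
  shows "\<exists>\<alpha> \<beta> \<delta> \<theta> e. 0 \<le> \<alpha> \<and> \<alpha> \<le> \<beta> \<and> \<beta> \<le> \<delta> \<and> \<delta> \<le> \<theta> \<and> \<theta> \<le> 1 \<and> e \<notin> A \<and>
    (\<forall>y. mass t (blanks t) y \<noteq> 0 \<and> posterior t (blanks t) y \<noteq> e \<longrightarrow>
      at_lik t y (opt_rule t (blanks t)) =
        (if swapped t then four_threshold H0 H1 \<alpha> \<beta> \<delta> \<theta> (posterior t (blanks t) y)
         else four_threshold H1 H0 \<alpha> \<beta> \<delta> \<theta> (posterior t (blanks t) y)))"
proof -
  let ?u = "blanks t"
  let ?R = "rescale (Q t ?u H0) (Q t ?u H1)"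
  have tT: "t \<in> {1..T}" using t by auto
  have fin: "Q t ?u H0 < top" "Q t ?u H1 < top" by (rule Q_finite)+
  have vfS: "value_function (D * Q t ?u H0) (D * Q t ?u H1) (stop_val t ?u d)" for d
    by (rule value_function_stop_val[OF tT])
  have vfW: "value_function (D * Q t ?u H0) (D * Q t ?u H1) (W t ?u)"
    by (rule value_function_W[OF t]) simp
  note RS = value_function_rescale[OF vfS fin] and RW = value_function_rescale[OF vfW fin]
  have S_eq: "at_lik t y (stop_val t ?u d) = ?R (stop_val t ?u d) (weight t ?u y H0) (weight t ?u y H1)" for d y
    unfolding weight_def by (rule rescale_weights[OF vfS fin])
  have W_eq: "at_lik t y (W t ?u) = ?R (W t ?u) (weight t ?u y H0) (weight t ?u y H1)" for y
    unfolding weight_def by (rule rescale_weights[OF vfW fin])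
  define f where "f d = on_simplex (?R (stop_val t ?u d))" for d
  define w where "w = on_simplex (?R (W t ?u))"
  have R_affine: "?R (stop_val t ?u d) = (\<lambda>a b. a * (weight_inverse (Q t ?u H0) * C t ?u d H0) +
      b * (weight_inverse (Q t ?u H1) * C t ?u d H1))" for d
    by (simp add: rescale_def stop_val_def fun_eq_iff mult.assoc)
  have coeff: "weight_inverse (Q t ?u h) * C t ?u d h < top" for d h
    by (simp add: ennreal_mult_less_top weight_inverse_finite C_finite[OF tT])
  have aff: "affine01 (f d)" for d
    unfolding f_def R_affine by (rule affine_on_simplex[OF coeff coeff])
  have f0: "f d 0 = enn2real (weight_inverse (Q t ?u H1) * C t ?u d H1)" for d
    by (simp add: f_def R_affine on_simplex_def)
  have f0_mono: "f d 0 \<le> f e 0" if "C t ?u d H1 \<le> C t ?u e H1" for d e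
    unfolding f0 using that coeff by (intro enn2real_mono mult_left_mono) auto
  have conc: "concave01 w" "continuous_on {0..1} w"
    unfolding w_def using D_finite
    by (auto intro: value_function.concave_on_simplex[OF RW] value_function.continuous_on_simplex[OF RW])
  \<comment> \<open>Stated for any two labels in the right order at posterior 0; the two cases of
    \<open>swapped\<close> are instances.\<close>
  have main: "\<exists>\<alpha> \<beta> \<delta> \<theta> e. 0 \<le> \<alpha> \<and> \<alpha> \<le> \<beta> \<and> \<beta> \<le> \<delta> \<and> \<delta> \<le> \<theta> \<and> \<theta> \<le> 1 \<and> e \<notin> A \<and>
    (\<forall>y. mass t ?u y \<noteq> 0 \<and> posterior t ?u y \<noteq> e \<longrightarrow>
      message_rule lo hi (at_lik t y (stop_val t ?u lo)) (at_lik t y (stop_val t ?u hi))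
        (at_lik t y (W t ?u)) = four_threshold lo hi \<alpha> \<beta> \<delta> \<theta> (posterior t ?u y))"
    if le: "C t ?u lo H1 \<le> C t ?u hi H1" for lo hi
  proof -
    have eq: "message_rule lo hi (at_lik t y (stop_val t ?u lo)) (at_lik t y (stop_val t ?u hi))
        (at_lik t y (W t ?u)) =
      message_rule lo hi (f lo (posterior t ?u y)) (f hi (posterior t ?u y)) (w (posterior t ?u y))"
      if "mass t ?u y \<noteq> 0" for y
      unfolding S_eq W_eq f_def w_def
      by (intro message_rule_cong cmp_posterior[OF RS RS D_finite D_finite that] cmp_posterior[OF RS RW D_finite D_finite that])
    obtain \<alpha> \<beta> \<delta> \<theta> e where th: "0 \<le> \<alpha>" "\<alpha> \<le> \<beta>" "\<beta> \<le> \<delta>" "\<delta> \<le> \<theta>" "\<theta> \<le> 1" "e \<notin> A"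
      and r: "\<forall>p\<in>{0..1} - {e}. message_rule lo hi (f lo p) (f hi p) (w p) = four_threshold lo hi \<alpha> \<beta> \<delta> \<theta> p"
      using four_thresholds[OF aff aff conc f0_mono[OF le] count, of lo hi] by blast
    have "message_rule lo hi (at_lik t y (stop_val t ?u lo)) (at_lik t y (stop_val t ?u hi))
        (at_lik t y (W t ?u)) = four_threshold lo hi \<alpha> \<beta> \<delta> \<theta> (posterior t ?u y)"
      if "mass t ?u y \<noteq> 0" "posterior t ?u y \<noteq> e" for y
      using eq[OF that(1)] r that(2) posterior_in_01[of t ?u y] by auto
    then show ?thesis using th by blast
  qed
  have ns: "\<not> stopped t ?u" using not_stopped_iff[of ?u t] by simp
  show ?thesis
  proof (cases "swapped t")
    case True
    then have "C t ?u H0 H1 \<le> C t ?u H1 H1" using swapped_iff[OF tT] by simp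
    from main[OF this] show ?thesis using True ns t by (simp add: opt_rule_def)
  next
    case False
    then have "C t ?u H1 H1 \<le> C t ?u H0 H1" using swapped_iff[OF tT] by simp
    from main[OF this] show ?thesis using False ns t by (simp add: opt_rule_def)
  qed
qed

abbreviation u1_opt where "u1_opt \<equiv> U1 G1 opt Y1 Y2"
abbreviation u2_opt where "u2_opt \<equiv> U2 G1 opt Y1 Y2"
abbreviation belief where "belief \<equiv> belief2 M H Y1 N2 Y2 G1 opt"

text \<open>Translates sample paths into the deterministic rule: belief becomes posterior, the
  decision becomes \<open>opt_rule\<close>, and the stop of observer 1 becomes a property of the
  history. The observations are hidden behind a quantifier, since the threshold lemmas hold for all
  of them.\<close>

lemma opt_decision_AE:
  assumes t: "1 \<le> t" "t \<le> T"
  shows "AE \<omega> in M. active (u2_opt \<omega>) t \<longrightarrow>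
    (\<exists>y. hist t \<omega> \<in> HS t \<and> mass t (hist t \<omega>) y \<noteq> 0 \<and>
      belief t \<omega> = posterior t (hist t \<omega>) y \<and>
      u2_opt \<omega> t = at_lik t y (opt_rule t (hist t \<omega>)) \<and>
      (stop_time (u1_opt \<omega>) < t \<longleftrightarrow> stopped t (hist t \<omega>)))"
  using belief_eq_posterior[OF is_policy_opt t] weight_positive[OF t] AE_space
proof eventually_elim
  case (elim \<omega>)
  show ?case
  proof
    assume act: "active (u2_opt \<omega>) t"
    have "u2_opt \<omega> t = dec opt (obs2 t \<omega>) (hist t \<omega>) t"
      using U2_of_active[OF t(1) act] by (simp add: dec_obs B_eq)
    also have "\<dots> = opt_rule t (hist t \<omega>) (lik t H0 (obs2 t \<omega>)) (lik t H1 (obs2 t \<omega>))"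
      by (rule dec_opt) simp
    finally have u2: "u2_opt \<omega> t = \<dots>" .
    have "stop_time (u1_opt \<omega>) < t \<longleftrightarrow> (\<exists>s\<in>{1..<t}. u1_opt \<omega> s \<noteq> Blank)"
      by (rule stop_time_less_iff[OF U_stops(1)[OF is_policy_opt elim(3)]])
    also have "\<dots> \<longleftrightarrow> stopped t (hist t \<omega>)"
      using U1_of_active[OF t(1) act] by (auto simp: stopped_def hist_def B_eq)
    finally have "stop_time (u1_opt \<omega>) < t \<longleftrightarrow> stopped t (hist t \<omega>)" .
    then show "\<exists>y. hist t \<omega> \<in> HS t \<and> mass t (hist t \<omega>) y \<noteq> 0 \<and>
      belief t \<omega> = posterior t (hist t \<omega>) y \<and>
      u2_opt \<omega> t = at_lik t y (opt_rule t (hist t \<omega>)) \<and>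
      (stop_time (u1_opt \<omega>) < t \<longleftrightarrow> stopped t (hist t \<omega>))"
      using elim act u2 by (intro exI[of _ "obs2 t \<omega>"]) (simp add: weight_def)
  qed
qed

theorem final_decision:
  "\<exists>\<alpha>. 0 \<le> \<alpha> \<and> \<alpha> \<le> 1 \<and> (AE \<omega> in M. active (u2_opt \<omega>) T \<longrightarrow>
    u2_opt \<omega> T = (if belief T \<omega> \<le> \<alpha> then Decide H1 else Decide H0))"
proof -
  obtain \<alpha> where \<alpha>: "0 \<le> \<alpha>" "\<alpha> \<le> 1" and rule: "\<forall>u y. mass T u y \<noteq> 0 \<longrightarrow>
    at_lik T y (opt_rule T u) = (if posterior T u y \<le> \<alpha> then Decide H1 else Decide H0)"
    using final_threshold by blast
  have "AE \<omega> in M. active (u2_opt \<omega>) T \<longrightarrow>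
    u2_opt \<omega> T = (if belief T \<omega> \<le> \<alpha> then Decide H1 else Decide H0)"
    using opt_decision_AE[OF horizon order_refl]
  proof eventually_elim
    case (elim \<omega>)
    then show ?case using rule by metis
  qed
  then show ?thesis using \<alpha> by blast
qed

theorem decision_after_stop:
  assumes t: "1 \<le> t" "t < T"
  shows "\<exists>\<alpha> \<beta>. 0 \<le> \<alpha> \<and> \<alpha> \<le> \<beta> \<and> \<beta> \<le> 1 \<and>
    (AE \<omega> in M. active (u2_opt \<omega>) t \<and> stop_time (u1_opt \<omega>) < t \<longrightarrow>
      u2_opt \<omega> t = (if belief t \<omega> \<le> \<alpha> then Decide H1 else if belief t \<omega> \<le> \<beta> then Blank else Decide H0))"
proof -
  obtain \<alpha> \<beta> where ab: "0 \<le> \<alpha>" "\<alpha> \<le> \<beta>" "\<beta> \<le> 1"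
    and rule: "\<forall>u\<in>HS t. \<forall>y. stopped t u \<and> mass t u y \<noteq> 0 \<longrightarrow>
      at_lik t y (opt_rule t u) =
        (if posterior t u y \<le> \<alpha> then Decide H1 else if posterior t u y \<le> \<beta> then Blank else Decide H0)"
    using solo_thresholds[OF t] by blast
  have "AE \<omega> in M. active (u2_opt \<omega>) t \<and> stop_time (u1_opt \<omega>) < t \<longrightarrow>
      u2_opt \<omega> t = (if belief t \<omega> \<le> \<alpha> then Decide H1 else if belief t \<omega> \<le> \<beta> then Blank else Decide H0)"
    using opt_decision_AE[OF t(1) less_imp_le[OF t(2)]]
  proof eventually_elim
    case (elim \<omega>)
    show ?case
    proof
      assume "active (u2_opt \<omega>) t \<and> stop_time (u1_opt \<omega>) < t"
      then obtain y where "hist t \<omega> \<in> HS t" "stopped t (hist t \<omega>)"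
        "mass t (hist t \<omega>) y \<noteq> 0" "belief t \<omega> = posterior t (hist t \<omega>) y"
        "u2_opt \<omega> t = at_lik t y (opt_rule t (hist t \<omega>))"
        using elim by blast
      then show "u2_opt \<omega> t = (if belief t \<omega> \<le> \<alpha> then Decide H1 else if belief t \<omega> \<le> \<beta> then Blank else Decide H0)"
        using rule by simp
    qed
  qed
  then show ?thesis using ab by blast
qed

text \<open>These points are atoms of the law of the belief, and a probability measure has only
  countably many.\<close>

lemma belief_atoms:
  "countable {x. \<not> (AE \<omega> in M. belief t \<omega> \<noteq> x)}"
proof -
  have [measurable]: "belief t \<in> borel_measurable M"
    unfolding belief2_def by (rule borel_measurable_cond_exp2)
  interpret B: prob_space "distr M borel (belief t)" by (rule prob_space_distr) measurable
  have "{x. \<not> (AE \<omega> in M. belief t \<omega> \<noteq> x)} \<subseteq> {x. measure (distr M borel (belief t)) {x} \<noteq> 0}"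
  proof (rule subsetI, rule ccontr)
    fix x assume x: "x \<in> {x. \<not> (AE \<omega> in M. belief t \<omega> \<noteq> x)}"
      and "x \<notin> {x. measure (distr M borel (belief t)) {x} \<noteq> 0}"
    then have "emeasure M {\<omega> \<in> space M. belief t \<omega> = x} = 0"
      by (simp add: measure_distr emeasure_eq_measure vimage_def Int_def conj_commute)
    then have "AE \<omega> in M. belief t \<omega> \<noteq> x"
      by (intro AE_I'[of "{\<omega> \<in> space M. belief t \<omega> = x}"]) (auto intro!: null_setsI)
    then show False using x by simp
  qed
  then show ?thesis by (rule countable_subset) (rule B.countable_support)
qed

text \<open>\<open>joint_thresholds\<close> is told to avoid the atoms of the belief, so the belief
  misses the exceptional point \<open>e\<close> almost surely, and a dummy stopping point is never
  acted upon.\<close>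

theorem decision_before_stop:
  assumes t: "1 \<le> t" "t < T"
  shows "\<exists>\<alpha> \<beta> \<delta> \<theta>. 0 \<le> \<alpha> \<and> \<alpha> \<le> \<beta> \<and> \<beta> \<le> \<delta> \<and> \<delta> \<le> \<theta> \<and> \<theta> \<le> 1 \<and>
    (AE \<omega> in M. active (u2_opt \<omega>) t \<and> \<not> stop_time (u1_opt \<omega>) < t \<longrightarrow>
      u2_opt \<omega> t = (if swapped t then four_threshold H0 H1 \<alpha> \<beta> \<delta> \<theta> (belief t \<omega>)
        else four_threshold H1 H0 \<alpha> \<beta> \<delta> \<theta> (belief t \<omega>)))"
proof -
  obtain \<alpha> \<beta> \<delta> \<theta> e where th: "0 \<le> \<alpha>" "\<alpha> \<le> \<beta>" "\<beta> \<le> \<delta>" "\<delta> \<le> \<theta>" "\<theta> \<le> 1"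
    and e: "e \<notin> {x. \<not> (AE \<omega> in M. belief t \<omega> \<noteq> x)}"
    and rule: "\<forall>y. mass t (blanks t) y \<noteq> 0 \<and> posterior t (blanks t) y \<noteq> e \<longrightarrow>
      at_lik t y (opt_rule t (blanks t)) =
        (if swapped t then four_threshold H0 H1 \<alpha> \<beta> \<delta> \<theta> (posterior t (blanks t) y)
         else four_threshold H1 H0 \<alpha> \<beta> \<delta> \<theta> (posterior t (blanks t) y))"
    using joint_thresholds[OF t belief_atoms[of t]] by blast
  from e have "AE \<omega> in M. belief t \<omega> \<noteq> e" by simp
  then have "AE \<omega> in M. active (u2_opt \<omega>) t \<and> \<not> stop_time (u1_opt \<omega>) < t \<longrightarrow>
      u2_opt \<omega> t = (if swapped t then four_threshold H0 H1 \<alpha> \<beta> \<delta> \<theta> (belief t \<omega>)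
        else four_threshold H1 H0 \<alpha> \<beta> \<delta> \<theta> (belief t \<omega>))"
    using opt_decision_AE[OF t(1) less_imp_le[OF t(2)]]
  proof eventually_elim
    case (elim \<omega>)
    show ?case
    proof
      assume "active (u2_opt \<omega>) t \<and> \<not> stop_time (u1_opt \<omega>) < t"
      then obtain y where y: "hist t \<omega> \<in> HS t" "\<not> stopped t (hist t \<omega>)"
        "mass t (hist t \<omega>) y \<noteq> 0" "belief t \<omega> = posterior t (hist t \<omega>) y"
        "u2_opt \<omega> t = at_lik t y (opt_rule t (hist t \<omega>))"
        using elim by blast
      then have "hist t \<omega> = blanks t" by (simp add: not_stopped_iff)
      then show "u2_opt \<omega> t = (if swapped t then four_threshold H0 H1 \<alpha> \<beta> \<delta> \<theta> (belief t \<omega>)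
        else four_threshold H1 H0 \<alpha> \<beta> \<delta> \<theta> (belief t \<omega>))"
        using rule y elim(1) by simp
    qed
  qed
  then show ?thesis using th by blast
qed

end

text \<open>The belief is a conditional expectation, determined only up to null sets; accordingly
  the decision rules hold almost surely. The thresholds depend on \<open>t\<close>, but neither on
  \<open>\<omega>\<close> nor on the history.\<close>

theorem theorem2:
  fixes M :: "'w measure" and H :: "'w \<Rightarrow> hyp" and p0 :: real
    and N1 :: "'a measure" and f1 :: "nat \<Rightarrow> hyp \<Rightarrow> 'a \<Rightarrow> ennreal" and Y1 :: "nat \<Rightarrow> 'w \<Rightarrow> 'a"
    and N2 :: "'b measure" and f2 :: "nat \<Rightarrow> hyp \<Rightarrow> 'b \<Rightarrow> ennreal" and Y2 :: "nat \<Rightarrow> 'w \<Rightarrow> 'b"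
    and T :: nat and K k :: real and J :: "hyp \<Rightarrow> hyp \<Rightarrow> real" and \<Gamma>1 :: "'a policy"
  assumes model: "detection_model M H p0 N1 f1 Y1 N2 f2 Y2"
    and horizon: "T \<ge> 1"
    and costs: "0 < k" "k < K"
    and J_nonneg: "\<And>u h. J u h \<ge> 0"
    and J_diag: "\<And>h. J h h = 0"
    and policy1: "is_policy T N1 \<Gamma>1"
  shows "\<exists>\<Gamma>2. is_policy T N2 \<Gamma>2 \<and>
    (\<forall>\<Gamma>2'. is_policy T N2 \<Gamma>2' \<longrightarrow>
      exp_cost M H Y1 Y2 K k J \<Gamma>1 \<Gamma>2 \<le> exp_cost M H Y1 Y2 K k J \<Gamma>1 \<Gamma>2') \<and>
    (let \<tau>1 = (\<lambda>\<omega>. stop_time (U1 \<Gamma>1 \<Gamma>2 Y1 Y2 \<omega>));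
         U = (\<lambda>t \<omega>. U2 \<Gamma>1 \<Gamma>2 Y1 Y2 \<omega> t);
         act = (\<lambda>t \<omega>. active (U2 \<Gamma>1 \<Gamma>2 Y1 Y2 \<omega>) t);
         \<pi> = belief2 M H Y1 N2 Y2 \<Gamma>1 \<Gamma>2;
         swapped = swaps_labels M H Y1 Y2 K k J \<Gamma>1
     in
      (\<exists>\<alpha>. 0 \<le> \<alpha> \<and> \<alpha> \<le> 1 \<and>
        (AE \<omega> in M. act T \<omega> \<longrightarrow>
          U T \<omega> = (if \<pi> T \<omega> \<le> \<alpha> then Decide H1 else Decide H0))) \<and>
      (\<forall>t\<in>{1..<T}. \<exists>\<alpha> \<beta>. 0 \<le> \<alpha> \<and> \<alpha> \<le> \<beta> \<and> \<beta> \<le> 1 \<and>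
        (AE \<omega> in M. act t \<omega> \<and> \<tau>1 \<omega> < t \<longrightarrow>
          U t \<omega> = (if \<pi> t \<omega> \<le> \<alpha> then Decide H1
                   else if \<pi> t \<omega> \<le> \<beta> then Blank
                   else Decide H0))) \<and>
      (\<forall>t\<in>{1..<T}. \<exists>\<alpha> \<beta> \<delta> \<theta>. 0 \<le> \<alpha> \<and> \<alpha> \<le> \<beta> \<and> \<beta> \<le> \<delta> \<and> \<delta> \<le> \<theta> \<and> \<theta> \<le> 1 \<and>
        (AE \<omega> in M. act t \<omega> \<and> \<not> \<tau>1 \<omega> < t \<longrightarrow>
          U t \<omega> = (if swapped t
                   then four_threshold H0 H1 \<alpha> \<beta> \<delta> \<theta> (\<pi> t \<omega>)
                   else four_threshold H1 H0 \<alpha> \<beta> \<delta> \<theta> (\<pi> t \<omega>)))))"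
proof -
  interpret model: detection_model M H p0 N1 f1 Y1 N2 f2 Y2 by (rule model)
  interpret P: detection_problem M H p0 N1 f1 Y1 N2 f2 Y2 T K k J \<Gamma>1
    by unfold_locales (fact horizon costs J_nonneg J_diag policy1)+
  show ?thesis
    unfolding Let_def
    using P.is_policy_opt P.opt_is_optimal P.final_decision P.decision_after_stop P.decision_before_stop
    by (intro exI[of _ P.opt] conjI allI impI ballI) auto
qed

end
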